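(* For all integers $\alpha\ge1$ and $n\ge0$, \[ b_{13}\!\left(4\cdot3^{2\alpha+1}n+\frac{17\cdot 3^{2\alpha}-1}{2}\right)\equiv 0\pmod 6,\qquad b_{13}\!\left(4\cdot3^{2\alpha}n+\frac{11\cdot 3^{2\alpha-1}-1}{2}\right)\equiv 0\pmod 6. \]
   Context: For a positive integer $\ell$, $b_\ell(n)$ denotes the number of partitions of $n$ having no part divisible by $\ell$. *)

theory Defs
  imports Main "HOL-Library.Multiset"
begin

definition b :: "nat \<Rightarrow> nat \<Rightarrow> nat" where
  "b l n = card {P :: nat multiset. (\<forall>x\<in>#P. 0 < x \<and> \<not> l dvd x) \<and> sum_mset P = n}"

end

theory Submission
  imports Defs "HOL-Computational_Algebra.Computational_Algebra"
begin

text \<open>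
  Write \<open>f\<^sub>k = \<Prod>(1 - q\<^bsup>kn\<^esup>)\<close> and \<open>F = f\<^sub>1\<^sub>3/f\<^sub>1 = \<Sum> b\<^sub>1\<^sub>3(n) q\<^sup>n\<close>. Both congruences come from modular equations
  of level 13 between \<open>f\<^sub>1\<close> and \<open>f\<^sub>1\<^sub>3\<close>.

  Modulo 3, \<open>f\<^sub>1\<^sup>2 + q f\<^sub>1\<^sub>3\<^sup>2 = f\<^sub>1 f\<^sub>1\<^sub>3 Y\<^sup>3\<close> for some series \<open>Y\<close>. As cubing is the substitution \<open>q \<mapsto> q\<^sup>3\<close>, this
  determines the trisection of \<open>F\<close>: the series \<open>V = \<Sum> b\<^sub>1\<^sub>3(3n+1) q\<^sup>n\<close> satisfies \<open>V\<^sup>2 (Y\<^sup>6 - q) = 1\<close>, so that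
  \<open>V = V\<^sup>3 (Y\<^sup>6 - q)\<close>. Hence \<open>b\<^sub>1\<^sub>3(9n+7) \<equiv> 0\<close> and \<open>b\<^sub>1\<^sub>3(9n+4) \<equiv> - b\<^sub>1\<^sub>3(3n+1)\<close>.

  Modulo 2, \<open>F = (1 + q F\<^sup>2) Z\<^sup>2\<close> with \<open>Z = f\<^sub>1\<^sup>6 + q\<^sup>3 f\<^sub>1\<^sub>3\<^sup>6\<close>, so \<open>b\<^sub>1\<^sub>3(2m)\<close> is the \<open>m\<close>-th coefficient of \<open>Z\<close>. As
  \<open>f\<^sub>1\<^sup>3\<close> is the generating function of the triangular numbers, it can be odd only if \<open>4m+1\<close> is \<open>y\<^sup>2\<close> or \<open>13 y\<^sup>2\<close>.

  The modular equations are consequences of the three-term relation for theta functions of level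
  13, which parametrise the 13-torsion of the Tate curve, together with the degenerate behaviour of
  its \<open>p\<close>-torsion in characteristic \<open>p\<close>.
\<close>

section \<open>Agreement of power series up to a given order\<close>

definition eq_upto :: "nat \<Rightarrow> 'a::zero fps \<Rightarrow> 'a fps \<Rightarrow> bool" where
  "eq_upto N f g \<longleftrightarrow> (\<forall>n<N. f $ n = g $ n)"

lemma eq_upto_refl [simp]: "eq_upto N f f"
  by (simp add: eq_upto_def)

lemma eq_upto_sym: "eq_upto N f g \<Longrightarrow> eq_upto N g f"
  by (simp add: eq_upto_def)

lemma eq_upto_trans [trans]: "eq_upto N f g \<Longrightarrow> eq_upto N g h \<Longrightarrow> eq_upto N f h"
  by (simp add: eq_upto_def)

lemma eq_upto_mono: "eq_upto N f g \<Longrightarrow> M \<le> N \<Longrightarrow> eq_upto M f g"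
  by (simp add: eq_upto_def)

lemma fps_eqI_eq_upto: "(\<And>N. eq_upto N f g) \<Longrightarrow> f = g"
  unfolding eq_upto_def fps_eq_iff by blast

lemma eq_upto_mult:
  fixes f g h k :: "'a::semiring_1 fps"
  assumes "eq_upto N f g" "eq_upto N h k"
  shows "eq_upto N (f * h) (g * k)"
  using assms by (auto simp: eq_upto_def fps_mult_nth intro!: sum.cong)

lemma eq_upto_power:
  fixes f g :: "'a::semiring_1 fps"
  assumes "eq_upto N f g"
  shows "eq_upto N (f ^ n) (g ^ n)"
  by (induction n) (auto intro: eq_upto_mult assms)

lemma eq_upto_sum:
  assumes "\<And>i. i \<in> A \<Longrightarrow> eq_upto N (f i) (g i)"
  shows "eq_upto N (sum f A) (sum g A)"
  using assms by (auto simp: eq_upto_def fps_sum_nth intro!: sum.cong)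

lemma eq_upto_prod_1:
  fixes f :: "'b \<Rightarrow> 'a::comm_ring_1 fps"
  assumes "\<And>i. i \<in> A \<Longrightarrow> eq_upto N (f i) 1"
  shows "eq_upto N (prod f A) 1"
  using assms
proof (induction A rule: infinite_finite_induct)
  case (insert i A)
  then show ?case using eq_upto_mult[of N "f i" 1 "prod f A" 1] by simp
qed auto

lemma eq_upto_one_minus_X_power:
  "N \<le> k \<Longrightarrow> eq_upto N (1 - fps_X ^ k :: 'a::comm_ring_1 fps) 1"
  by (auto simp: eq_upto_def)

lemma eq_upto_X_power_mult:
  fixes f g :: "'a::comm_ring_1 fps"
  assumes "eq_upto r f g" "N \<le> e + r"
  shows "eq_upto N (fps_X ^ e * f) (fps_X ^ e * g)"
  using assms by (auto simp: eq_upto_def fps_X_power_mult_nth)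

lemma eq_upto_compose_X_power:
  fixes f g :: "'a::comm_ring_1 fps"
  assumes "eq_upto N f g"
  shows "eq_upto N (f oo fps_X ^ d) (g oo fps_X ^ d)"
  unfolding eq_upto_def fps_nth_compose_X_power
  using assms by (auto simp: eq_upto_def intro: le_less_trans[OF div_le_dividend])

lemma fps_compose_X_power_inject:
  fixes f g :: "'a::comm_ring_1 fps"
  assumes "d > 0" "f oo fps_X ^ d = g oo fps_X ^ d"
  shows "f = g"
proof (rule fps_ext)
  fix n
  have "(f oo fps_X ^ d) $ (d * n) = (g oo fps_X ^ d) $ (d * n)" using assms by simp
  then show "f $ n = g $ n" using assms(1) by (simp add: fps_nth_compose_X_power)
qed

section \<open>Euler products\<close>

definition euler_product :: "nat set \<Rightarrow> 'a::comm_ring_1 fps" where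
  "euler_product S = Abs_fps (\<lambda>n. (\<Prod>k\<in>S \<inter> {1..n}. 1 - fps_X ^ k) $ n)"

lemma euler_product_nth_0 [simp]: "euler_product S $ 0 = 1"
  by (simp add: euler_product_def)

lemma euler_product_nonzero [simp]: "euler_product S \<noteq> 0"
  by (metis euler_product_nth_0 fps_zero_nth zero_neq_one)

lemma euler_product_empty [simp]: "euler_product {} = 1"
  by (simp add: euler_product_def fps_eq_iff)

lemma euler_product_eq_upto:
  assumes "finite T" "S \<inter> {1..<N} \<subseteq> T" "T \<subseteq> S - {0}"
  shows "eq_upto N (euler_product S) (\<Prod>k\<in>T. 1 - fps_X ^ k :: 'a::comm_ring_1 fps)"
  unfolding eq_upto_def
proof (intro allI impI)
  fix n assume n: "n < N"
  let ?P = "\<lambda>A. \<Prod>k\<in>A. 1 - fps_X ^ k :: 'a fps"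
  let ?U = "S \<inter> {1..n}"
  have "?U \<subseteq> T" using assms(2) n by auto
  then have "?P T = ?P (T - ?U) * ?P ?U"
    using assms(1) by (rule prod.subset_diff)
  moreover have "eq_upto (Suc n) (?P (T - ?U)) 1"
    using assms(3) by (intro eq_upto_prod_1 eq_upto_one_minus_X_power) (auto simp: not_le Suc_le_eq)
  then have "eq_upto (Suc n) (?P (T - ?U) * ?P ?U) (1 * ?P ?U)"
    by (rule eq_upto_mult) simp
  ultimately show "euler_product S $ n = ?P T $ n"
    by (simp add: euler_product_def eq_upto_def)
qed

lemma euler_product_Un_disjoint:
  assumes "S \<inter> T = {}"
  shows "(euler_product (S \<union> T) :: 'a::comm_ring_1 fps) = euler_product S * euler_product T"
proof (rule fps_eqI_eq_upto)
  fix N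
  let ?P = "\<lambda>A. \<Prod>k\<in>A \<inter> {1..<N}. 1 - fps_X ^ k :: 'a fps"
  have "eq_upto N (euler_product (S \<union> T)) (?P (S \<union> T))"
    by (rule euler_product_eq_upto) auto
  also have "?P (S \<union> T) = ?P S * ?P T"
    using assms by (subst prod.union_disjoint[symmetric]) (auto intro!: prod.cong)
  also have "eq_upto N \<dots> (euler_product S * euler_product T)"
    by (intro eq_upto_mult eq_upto_sym[OF euler_product_eq_upto]) auto
  finally show "eq_upto N (euler_product (S \<union> T) :: 'a fps) (euler_product S * euler_product T)" .
qed

lemma euler_product_UN_disjoint:
  assumes "finite I" "\<And>i j. i \<in> I \<Longrightarrow> j \<in> I \<Longrightarrow> i \<noteq> j \<Longrightarrow> S i \<inter> S j = {}"
  shows "(euler_product (\<Union>i\<in>I. S i) :: 'a::comm_ring_1 fps) = (\<Prod>i\<in>I. euler_product (S i))"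
  using assms
proof (induction I rule: finite_induct)
  case (insert i I)
  have "S i \<inter> (\<Union>j\<in>I. S j) = {}" using insert.hyps(2) insert.prems by fastforce
  then show ?case using insert by (simp add: euler_product_Un_disjoint)
qed simp

lemma prod_one_minus_X_power_compose:
  assumes "d > 0"
  shows "(\<Prod>k\<in>T. 1 - fps_X ^ k) oo fps_X ^ d = (\<Prod>k\<in>(*) d ` T. 1 - fps_X ^ k :: 'a::idom fps)"
proof -
  have "(1 - fps_X ^ k) oo fps_X ^ d = (1 - fps_X ^ (d * k) :: 'a fps)" for k
    using assms by (simp add: fps_compose_sub_distrib fps_X_power_compose power_mult)
  then have "(\<Prod>k\<in>T. 1 - fps_X ^ k) oo fps_X ^ d = (\<Prod>k\<in>T. 1 - fps_X ^ (d * k) :: 'a fps)"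
    using assms by (simp add: fps_compose_prod_distrib)
  also have "\<dots> = (\<Prod>k\<in>(*) d ` T. 1 - fps_X ^ k)"
    using assms by (subst prod.reindex) (auto simp: inj_on_def)
  finally show ?thesis .
qed

lemma euler_product_image_times:
  assumes "d > 0"
  shows "(euler_product ((*) d ` S) :: 'a::idom fps) = euler_product S oo fps_X ^ d"
proof (rule fps_eqI_eq_upto)
  fix N
  let ?T = "S \<inter> {1..<N}"
  have "eq_upto N (euler_product ((*) d ` S) :: 'a fps) (\<Prod>k\<in>(*) d ` ?T. 1 - fps_X ^ k)"
  proof (rule euler_product_eq_upto)
    show "(*) d ` S \<inter> {1..<N} \<subseteq> (*) d ` ?T"
    proof
      fix m assume "m \<in> (*) d ` S \<inter> {1..<N}"
      then obtain s where s: "m = d * s" "s \<in> S" "1 \<le> m" "m < N" by auto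
      then have "1 \<le> s" "s \<le> m" using assms by (auto simp: Suc_le_eq)
      then have "s \<in> ?T" using s(2) le_less_trans[OF _ s(4)] by simp
      with s(1) show "m \<in> (*) d ` ?T" by (rule image_eqI)
    qed
  qed (use assms in auto)
  also have "(\<Prod>k\<in>(*) d ` ?T. 1 - fps_X ^ k :: 'a fps) = (\<Prod>k\<in>?T. 1 - fps_X ^ k) oo fps_X ^ d"
    by (rule prod_one_minus_X_power_compose[OF assms, symmetric])
  also have "eq_upto N \<dots> (euler_product S oo fps_X ^ d)"
    by (intro eq_upto_compose_X_power eq_upto_sym[OF euler_product_eq_upto]) auto
  finally show "eq_upto N (euler_product ((*) d ` S) :: 'a fps) (euler_product S oo fps_X ^ d)" .
qed

definition residue_product :: "nat \<Rightarrow> nat \<Rightarrow> 'a::comm_ring_1 fps" where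
  "residue_product M a = euler_product {n. n mod M = a}"

abbreviation euler :: "nat \<Rightarrow> 'a::comm_ring_1 fps" where
  "euler M \<equiv> residue_product M 0"

lemma residue_product_nth_0 [simp]: "residue_product M a $ 0 = 1"
  by (simp add: residue_product_def)

lemma residue_product_nonzero [simp]: "residue_product M a \<noteq> 0"
  by (simp add: residue_product_def)

lemma residue_class_split:
  fixes a M p :: nat
  assumes "a < M" "p > 0"
  shows "{n. n mod M = a} = (\<Union>i<p. {n. n mod (p * M) = a + M * i})"
proof (intro set_eqI iffI)
  fix n assume "n \<in> {n. n mod M = a}"
  then have "n mod (p * M) = a + M * (n div M mod p)"
    using mod_mult2_eq[of n M p] by (simp add: mult.commute)
  then show "n \<in> (\<Union>i<p. {n. n mod (p * M) = a + M * i})" using assms(2) by auto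
next
  fix n assume "n \<in> (\<Union>i<p. {n. n mod (p * M) = a + M * i})"
  then obtain i where "n mod (p * M) = a + M * i" by auto
  then have "n mod (p * M) mod M = a" using assms(1) by simp
  then show "n \<in> {n. n mod M = a}" by (simp add: mod_mod_cancel)
qed

lemma residue_product_split:
  assumes "a < M" "p > 0"
  shows "(residue_product M a :: 'a::comm_ring_1 fps) = (\<Prod>i<p. residue_product (p * M) (a + M * i))"
  unfolding residue_product_def residue_class_split[OF assms]
  using assms by (subst euler_product_UN_disjoint) auto

lemma residue_product_eq_upto:
  assumes "0 < a" "a < M" "N > 0"
  shows "eq_upto N (residue_product M a) (\<Prod>n<N. 1 - fps_X ^ (a + M * n) :: 'a::comm_ring_1 fps)"
proof -
  have "eq_upto N (residue_product M a) (\<Prod>k\<in>(\<lambda>n. a + M * n) ` {..<N}. 1 - fps_X ^ k :: 'a fps)"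
    unfolding residue_product_def
  proof (rule euler_product_eq_upto)
    show "{n. n mod M = a} \<inter> {1..<N} \<subseteq> (\<lambda>n. a + M * n) ` {..<N}"
    proof
      fix n assume n: "n \<in> {n. n mod M = a} \<inter> {1..<N}"
      then have "n = a + M * (n div M)" using mod_mult_div_eq[of n M] by simp
      moreover have "n div M < N" using n le_less_trans[OF div_le_dividend, of n N M] by simp
      ultimately show "n \<in> (\<lambda>n. a + M * n) ` {..<N}" by blast
    qed
  qed (use assms in auto)
  also have "(\<Prod>k\<in>(\<lambda>n. a + M * n) ` {..<N}. 1 - fps_X ^ k :: 'a fps) = (\<Prod>n<N. 1 - fps_X ^ (a + M * n))"
    using assms by (subst prod.reindex) (auto simp: inj_on_def)
  finally show ?thesis .
qed

lemma euler_times: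
  assumes "d > 0"
  shows "(euler (d * M) :: 'a::idom fps) = euler M oo fps_X ^ d"
proof -
  have "{n. n mod (d * M) = 0} = (*) d ` {n. n mod M = 0}"
    using assms by (auto simp: image_iff mod_eq_0_iff_dvd dvd_def)
  then show ?thesis
    using assms by (simp add: residue_product_def euler_product_image_times)
qed

section \<open>Formal sums of monomials\<close>

text \<open>The value is meaningful only if the fibres of the exponent \<open>e\<close> on \<open>I\<close> are finite.\<close>

definition monomial_sum :: "'i set \<Rightarrow> ('i \<Rightarrow> 'a) \<Rightarrow> ('i \<Rightarrow> nat) \<Rightarrow> 'a::comm_ring_1 fps" where
  "monomial_sum I s e = Abs_fps (\<lambda>n. \<Sum>i | i \<in> I \<and> e i = n. s i)"

lemma monomial_sum_nth: "monomial_sum I s e $ n = (\<Sum>i | i \<in> I \<and> e i = n. s i)"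
  by (simp add: monomial_sum_def)

lemma monomial_sum_reindex:
  assumes "bij_betw h I J" "\<And>i. i \<in> I \<Longrightarrow> s i = t (h i)" "\<And>i. i \<in> I \<Longrightarrow> e i = g (h i)"
  shows "monomial_sum I s e = monomial_sum J t g"
proof (rule fps_ext)
  fix n
  have "bij_betw h {i. i \<in> I \<and> e i = n} {j. j \<in> J \<and> g j = n}"
    using assms(1,3) unfolding bij_betw_def inj_on_def by auto
  then have "(\<Sum>j | j \<in> J \<and> g j = n. t j) = (\<Sum>i | i \<in> I \<and> e i = n. t (h i))"
    by (rule sum.reindex_bij_betw[symmetric])
  also have "\<dots> = (\<Sum>i | i \<in> I \<and> e i = n. s i)"
    by (rule sum.cong) (auto simp: assms(2))
  finally show "monomial_sum I s e $ n = monomial_sum J t g $ n"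
    by (simp add: monomial_sum_nth)
qed

lemma monomial_sum_UN_disjoint:
  assumes "finite R" "\<And>q r. q \<in> R \<Longrightarrow> r \<in> R \<Longrightarrow> q \<noteq> r \<Longrightarrow> I q \<inter> I r = {}"
    and "\<And>n. finite {i. i \<in> (\<Union>r\<in>R. I r) \<and> e i = n}"
  shows "monomial_sum (\<Union>r\<in>R. I r) s e = (\<Sum>r\<in>R. monomial_sum (I r) s e)"
proof (rule fps_ext)
  fix n
  have "{i. i \<in> (\<Union>r\<in>R. I r) \<and> e i = n} = (\<Union>r\<in>R. {i. i \<in> I r \<and> e i = n})" by auto
  moreover have "finite {i. i \<in> I r \<and> e i = n}" if "r \<in> R" for r
    by (rule finite_subset[OF _ assms(3)[of n]]) (use that in auto)
  ultimately show "monomial_sum (\<Union>r\<in>R. I r) s e $ n = (\<Sum>r\<in>R. monomial_sum (I r) s e) $ n"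
    unfolding monomial_sum_nth fps_sum_nth using assms(1,2)
    by (simp only:) (rule sum.UNION_disjoint, blast+)
qed

lemma monomial_sum_Un_disjoint:
  assumes "I \<inter> J = {}" "\<And>n. finite {i. i \<in> I \<union> J \<and> e i = n}"
  shows "monomial_sum (I \<union> J) s e = monomial_sum I s e + monomial_sum J s e"
proof -
  have "(\<Union>r. if r then I else J) = I \<union> J" by (auto simp: UNIV_bool)
  then show ?thesis
    using monomial_sum_UN_disjoint[of UNIV "\<lambda>r. if r then I else J" e s] assms
    by (simp add: UNIV_bool add.commute Int_commute split: if_splits)
qed

lemma monomial_sum_mult_const: "monomial_sum I (\<lambda>i. c * s i) e = fps_const c * monomial_sum I s e"
  by (rule fps_ext) (simp add: monomial_sum_nth sum_distrib_left)

lemma monomial_sum_uminus: "monomial_sum I (\<lambda>i. - s i) e = - monomial_sum I s e"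
  by (rule fps_ext) (simp add: monomial_sum_nth sum_negf)

lemma fps_X_power_mult_monomial_sum:
  "fps_X ^ r * monomial_sum I s e = monomial_sum I s (\<lambda>i. e i + r)"
proof (rule fps_ext)
  fix n
  have "{i. i \<in> I \<and> e i + r = n} = (if n < r then {} else {i. i \<in> I \<and> e i = n - r})"
    by auto
  then show "(fps_X ^ r * monomial_sum I s e) $ n = monomial_sum I s (\<lambda>i. e i + r) $ n"
    unfolding monomial_sum_nth fps_X_power_mult_nth by simp
qed

lemma monomial_sum_compose_X_power:
  assumes "d > 0"
  shows "monomial_sum I s e oo fps_X ^ d = monomial_sum I s (\<lambda>i. d * e i)"
proof (rule fps_ext)
  fix n
  have "{i. i \<in> I \<and> d * e i = n} = (if d dvd n then {i. i \<in> I \<and> e i = n div d} else {})"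
    using assms by auto
  then show "(monomial_sum I s e oo fps_X ^ d) $ n = monomial_sum I s (\<lambda>i. d * e i) $ n"
    unfolding monomial_sum_nth fps_nth_compose_X_power by simp
qed

lemma monomial_sum_mult:
  assumes "\<And>n. finite {i. i \<in> I \<and> e i = n}" "\<And>n. finite {j. j \<in> J \<and> g j = n}"
  shows "monomial_sum I s e * monomial_sum J t g =
    monomial_sum (I \<times> J) (\<lambda>(i, j). s i * t j) (\<lambda>(i, j). e i + g j)"
proof (rule fps_ext)
  fix n
  let ?A = "\<lambda>m. {i. i \<in> I \<and> e i = m}" and ?B = "\<lambda>m. {j. j \<in> J \<and> g j = m}"
  have "(monomial_sum I s e * monomial_sum J t g) $ n =
      (\<Sum>m=0..n. \<Sum>p\<in>?A m \<times> ?B (n - m). s (fst p) * t (snd p))"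
    by (simp add: fps_mult_nth monomial_sum_nth sum_product sum.cartesian_product case_prod_unfold)
  also have "\<dots> = (\<Sum>p\<in>(\<Union>m\<in>{0..n}. ?A m \<times> ?B (n - m)). s (fst p) * t (snd p))"
    by (rule sum.UNION_disjoint[symmetric]) (use assms in auto)
  also have "(\<Union>m\<in>{0..n}. ?A m \<times> ?B (n - m)) = {p. p \<in> I \<times> J \<and> e (fst p) + g (snd p) = n}"
    by force
  finally show "(monomial_sum I s e * monomial_sum J t g) $ n =
      monomial_sum (I \<times> J) (\<lambda>(i, j). s i * t j) (\<lambda>(i, j). e i + g j) $ n"
    by (simp add: monomial_sum_nth case_prod_unfold)
qed

lemma monomial_sum_eq_upto:
  assumes "finite J" "J \<subseteq> I" "\<And>i. i \<in> I - J \<Longrightarrow> N \<le> e i"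
  shows "eq_upto N (monomial_sum I s e) (\<Sum>i\<in>J. fps_const (s i) * fps_X ^ e i)"
  unfolding eq_upto_def
proof (intro allI impI)
  fix n assume n: "n < N"
  have "i \<in> J" if "i \<in> I" "e i < N" for i
    using assms(3)[of i] that by (meson DiffI leD)
  then have "{i. i \<in> I \<and> e i = n} = {i \<in> J. e i = n}"
    using assms(2) n by blast
  moreover have "(\<Sum>i\<in>J. fps_const (s i) * fps_X ^ e i) $ n = (\<Sum>i\<in>{i \<in> J. e i = n}. s i)"
    using assms(1) by (auto simp: fps_sum_nth sum.inter_filter intro!: sum.cong)
  ultimately show "monomial_sum I s e $ n = (\<Sum>i\<in>J. fps_const (s i) * fps_X ^ e i) $ n"
    by (simp add: monomial_sum_nth)
qed

section \<open>The Jacobi triple product\<close>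

fun qbinomial :: "'a::comm_ring_1 \<Rightarrow> nat \<Rightarrow> nat \<Rightarrow> 'a" where
  "qbinomial q n 0 = 1"
| "qbinomial q 0 (Suc k) = 0"
| "qbinomial q (Suc n) (Suc k) = qbinomial q n k + q ^ Suc k * qbinomial q n (Suc k)"

lemma qbinomial_eq_0: "n < k \<Longrightarrow> qbinomial q n k = 0"
  by (induction q n k rule: qbinomial.induct) auto

theorem qbinomial_theorem:
  fixes x y q :: "'a::comm_ring_1"
  shows "(\<Prod>i<n. y + x * q ^ i) = (\<Sum>j\<le>n. q ^ (j choose 2) * qbinomial q n j * x ^ j * y ^ (n - j))"
proof (induction n arbitrary: x)
  case (Suc n)
  let ?c = "\<lambda>n j. q ^ (j choose 2) * qbinomial q n j"
  have choose_Suc: "Suc j choose 2 = (j choose 2) + j" for j by (simp add: numeral_2_eq_2)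
  have "(\<Prod>i<Suc n. y + x * q ^ i) = (y + x) * (\<Prod>i<n. y + (x * q) * q ^ i)"
    by (simp add: prod.lessThan_Suc_shift mult.assoc del: prod.lessThan_Suc)
  also have "\<dots> = (\<Sum>j\<le>n. ?c n j * q ^ j * x ^ j * y ^ (Suc n - j)) +
      (\<Sum>j\<le>n. ?c n j * q ^ j * x ^ Suc j * y ^ (n - j))"
    unfolding Suc.IH sum_distrib_left sum.distrib[symmetric]
    by (rule sum.cong) (auto simp: algebra_simps Suc_diff_le)
  also have "(\<Sum>j\<le>n. ?c n j * q ^ j * x ^ j * y ^ (Suc n - j)) =
      (\<Sum>j\<le>Suc n. ?c n j * q ^ j * x ^ j * y ^ (Suc n - j))"
    by (simp add: qbinomial_eq_0)
  also have "\<dots> = y ^ Suc n + (\<Sum>j\<le>n. ?c n (Suc j) * q ^ Suc j * x ^ Suc j * y ^ (n - j))"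
    by (subst sum.atMost_Suc_shift) (simp add: numeral_2_eq_2)
  also have "\<dots> + (\<Sum>j\<le>n. ?c n j * q ^ j * x ^ Suc j * y ^ (n - j)) =
      y ^ Suc n + (\<Sum>j\<le>n. ?c (Suc n) (Suc j) * x ^ Suc j * y ^ (n - j))"
    unfolding add.assoc sum.distrib[symmetric]
    by (rule arg_cong[of _ _ "(+) (y ^ Suc n)"], rule sum.cong)
      (auto simp: choose_Suc power_add algebra_simps)
  also have "\<dots> = (\<Sum>j\<le>Suc n. ?c (Suc n) j * x ^ j * y ^ (Suc n - j))"
    by (subst sum.atMost_Suc_shift) (simp add: numeral_2_eq_2)
  finally show ?case .
qed (simp add: numeral_2_eq_2)

lemma qbinomial_mult_prod:
  fixes q :: "'a::comm_ring_1"
  assumes "k \<le> n"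
  shows "qbinomial q n k * (\<Prod>i=1..k. 1 - q ^ i) = (\<Prod>i=Suc (n - k)..n. 1 - q ^ i)"
  using assms
proof (induction n arbitrary: k)
  case (Suc n)
  show ?case
  proof (cases k)
    case (Suc j)
    then have j: "j \<le> n" using Suc.prems by simp
    define D where "D = (\<Prod>i=Suc (n - j)..n. 1 - q ^ i)"
    have left: "qbinomial q n j * (\<Prod>i=1..j. 1 - q ^ i) = D"
      using Suc.IH[OF j] by (simp add: D_def)
    have right: "qbinomial q n (Suc j) * (\<Prod>i=1..Suc j. 1 - q ^ i) = D * (1 - q ^ (n - j))"
    proof (cases "j = n")
      case False
      then have "Suc j \<le> n" using j by simp
      then have "qbinomial q n (Suc j) * (\<Prod>i=1..Suc j. 1 - q ^ i) = (\<Prod>i=Suc (n - Suc j)..n. 1 - q ^ i)"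
        by (rule Suc.IH)
      also have "Suc (n - Suc j) = n - j" using False j by simp
      also have "(\<Prod>i=n - j..n. 1 - q ^ i) = (1 - q ^ (n - j)) * D"
        unfolding D_def by (rule prod.atLeast_Suc_atMost) simp
      finally show ?thesis by (simp add: mult.commute)
    qed (simp add: qbinomial_eq_0)
    have "qbinomial q (Suc n) (Suc j) * (\<Prod>i=1..Suc j. 1 - q ^ i) =
        (qbinomial q n j * (\<Prod>i=1..j. 1 - q ^ i)) * (1 - q ^ Suc j) +
        q ^ Suc j * (qbinomial q n (Suc j) * (\<Prod>i=1..Suc j. 1 - q ^ i))"
      by (simp add: algebra_simps)
    also have "\<dots> = D * (1 - q ^ (Suc j + (n - j)))"
      unfolding left right power_add by (simp only: right_diff_distrib mult_ac) simp
    also have "\<dots> = D * (1 - q ^ Suc n)" using j by simp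
    also have "\<dots> = (\<Prod>i=Suc (n - j)..Suc n. 1 - q ^ i)"
      using j by (simp add: D_def)
    finally show ?thesis using Suc by simp
  qed simp
qed simp

lemma euler_mult_qbinomial_eq_upto:
  fixes M N j :: nat
  assumes "M > 0" "j \<le> 2 * N"
  shows "eq_upto (M * min j (2 * N - j)) (euler M * qbinomial (fps_X ^ M) (2 * N) j) (1 :: 'a::comm_ring_1 fps)"
proof -
  let ?r = "M * min j (2 * N - j)" and ?q = "fps_X ^ M :: 'a fps"
  have "eq_upto ?r (euler M) (\<Prod>k\<in>(*) M ` {1..j}. 1 - fps_X ^ k :: 'a fps)"
    unfolding residue_product_def
  proof (rule euler_product_eq_upto)
    show "{n. n mod M = 0} \<inter> {1..<?r} \<subseteq> (*) M ` {1..j}"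
    proof
      fix n assume n: "n \<in> {n. n mod M = 0} \<inter> {1..<?r}"
      then obtain i where i: "n = M * i" by auto
      with n assms(1) have "i < min j (2 * N - j)" "i \<ge> 1" by (auto simp: Suc_le_eq)
      then show "n \<in> (*) M ` {1..j}" using i by auto
    qed
  qed (use assms in auto)
  also have "(\<Prod>k\<in>(*) M ` {1..j}. 1 - fps_X ^ k :: 'a fps) = (\<Prod>i=1..j. 1 - ?q ^ i)"
    using assms(1) by (subst prod.reindex) (auto simp: inj_on_def power_mult)
  finally have "eq_upto ?r (euler M * qbinomial ?q (2 * N) j) (qbinomial ?q (2 * N) j * (\<Prod>i=1..j. 1 - ?q ^ i))"
    by (subst mult.commute, intro eq_upto_mult) simp_all
  also have "\<dots> = (\<Prod>i=Suc (2 * N - j)..2 * N. 1 - ?q ^ i)"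
    by (rule qbinomial_mult_prod[OF assms(2)])
  also have "eq_upto ?r \<dots> 1"
  proof (intro eq_upto_prod_1)
    fix i assume "i \<in> {Suc (2 * N - j)..2 * N}"
    then have "?r \<le> M * i" by (intro mult_le_mono2) auto
    then show "eq_upto ?r (1 - ?q ^ i) 1"
      unfolding power_mult[symmetric] by (rule eq_upto_one_minus_X_power)
  qed
  finally show ?thesis .
qed

definition triangle :: "int \<Rightarrow> nat" where
  "triangle k = nat (k * (k + 1) div 2)"

lemma double_triangle: "2 * int (triangle k) = k * (k + 1)"
proof -
  have "0 \<le> k * (k + 1)" by (cases "k \<ge> 0") (auto simp: zero_le_mult_iff)
  moreover have "even (k * (k + 1))" by simp
  ultimately show ?thesis by (simp add: triangle_def pos_imp_zdiv_nonneg_iff)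
qed

lemma triangle_ge: "\<bar>k\<bar> - 1 \<le> int (triangle k)"
proof -
  have "0 \<le> (\<bar>k\<bar> - 1) * (\<bar>k\<bar> - 2)"
    by (cases "k = 0"; cases "\<bar>k\<bar> = 1") (auto intro!: mult_nonneg_nonneg)
  also have "\<dots> = k * k - 3 * \<bar>k\<bar> + 2" by (simp add: algebra_simps)
  finally show ?thesis
    using double_triangle[of k] by (simp add: distrib_left abs_if split: if_splits)
qed

definition parity_sign :: "int \<Rightarrow> 'a::comm_ring_1" where
  "parity_sign k = (if even k then 1 else - 1)"

lemma fps_const_parity_sign: "fps_const (parity_sign k) = parity_sign k"
  by (simp add: parity_sign_def)

lemma neg_one_power_triangle: "(- 1) ^ (triangle k + triangle (- k)) = parity_sign k"
proof -
  have "2 * int (triangle k + triangle (- k)) = 2 * (k * k)"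
    using double_triangle[of k] double_triangle[of "- k"] by (simp add: algebra_simps)
  then have "int (triangle k + triangle (- k)) = k * k" by (simp only: mult_cancel_left) simp
  then have "even (triangle k + triangle (- k)) \<longleftrightarrow> even k"
    by (metis even_mult_iff even_of_nat_iff)
  then show ?thesis by (simp add: parity_sign_def)
qed

lemma double_choose_2: "2 * int (n choose 2) = int n * (int n - 1)"
  by (induction n) (auto simp: numeral_2_eq_2 algebra_simps)

lemma prod_symmetric_split:
  fixes z w :: "'a::comm_ring_1"
  defines "q \<equiv> z * w"
  shows "(\<Prod>i<2 * N. q ^ N + z * q ^ i) =
    z ^ N * q ^ (N * N + (N choose 2)) * ((\<Prod>n<N. 1 + z * q ^ n) * (\<Prod>n<N. 1 + w * q ^ n))"
proof -
  have "z * q ^ i * (w * q ^ (N - Suc i)) = q ^ N" if "i < N" for i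
  proof -
    have "z * q ^ i * (w * q ^ (N - Suc i)) = q ^ Suc (i + (N - Suc i))"
      unfolding power_Suc power_add by (simp add: q_def mult_ac)
    also have "Suc (i + (N - Suc i)) = N" using that by simp
    finally show ?thesis .
  qed
  then have "(\<Prod>i<N. q ^ N + z * q ^ i) = (\<Prod>i<N. z * q ^ i * (1 + w * q ^ (N - Suc i)))"
    by (intro prod.cong) (auto simp: distrib_left)
  also have "\<dots> = z ^ N * (\<Prod>i<N. q ^ i) * (\<Prod>n<N. 1 + w * q ^ n)"
    by (simp add: prod.distrib prod.nat_diff_reindex[of "\<lambda>n. 1 + w * q ^ n"])
  also have "(\<Prod>i<N. q ^ i) = q ^ (N choose 2)"
    by (induction N) (auto simp: numeral_2_eq_2 power_add)
  finally have low: "(\<Prod>i<N. q ^ N + z * q ^ i) = z ^ N * q ^ (N choose 2) * (\<Prod>n<N. 1 + w * q ^ n)" .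
  have "(\<Prod>i=N..<2 * N. q ^ N + z * q ^ i) = (\<Prod>n<N. q ^ N + z * q ^ (N + n))"
    by (rule prod.reindex_bij_witness[of _ "\<lambda>n. N + n" "\<lambda>i. i - N"]) auto
  also have "\<dots> = (\<Prod>n<N. q ^ N * (1 + z * q ^ n))"
    by (simp add: power_add algebra_simps)
  finally have high: "(\<Prod>i=N..<2 * N. q ^ N + z * q ^ i) = q ^ (N * N) * (\<Prod>n<N. 1 + z * q ^ n)"
    by (simp add: prod.distrib power_mult)
  have "(\<Prod>i<2 * N. q ^ N + z * q ^ i) = (\<Prod>i<N. q ^ N + z * q ^ i) * (\<Prod>i=N..<2 * N. q ^ N + z * q ^ i)"
    unfolding lessThan_atLeast0 by (rule prod.atLeastLessThan_concat[symmetric]) auto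
  then show ?thesis unfolding low high by (simp only: power_add mult_ac)
qed

lemma exponent_eq_triangle:
  assumes "j \<le> 2 * N"
  shows "(j choose 2) + j + N * (2 * N - j) = N + N * N + (N choose 2) + triangle (int j - int N)"
    and "(j choose 2) + N * (2 * N - j) = N * N + (N choose 2) + triangle (- (int j - int N))"
proof -
  have diff: "int (2 * N - j) = 2 * int N - int j" using assms by simp
  note double = double_choose_2[of j] double_choose_2[of N]
    double_triangle[of "int j - int N"] double_triangle[of "- (int j - int N)"]
  have "2 * int ((j choose 2) + j + N * (2 * N - j)) =
      2 * int (N + N * N + (N choose 2) + triangle (int j - int N))"
    unfolding of_nat_add of_nat_mult distrib_left double diff by (simp add: algebra_simps)
  then show "(j choose 2) + j + N * (2 * N - j) = N + N * N + (N choose 2) + triangle (int j - int N)"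
    by (simp only: mult_cancel_left of_nat_eq_iff) simp
  have "2 * int ((j choose 2) + N * (2 * N - j)) =
      2 * int (N * N + (N choose 2) + triangle (- (int j - int N)))"
    unfolding of_nat_add of_nat_mult distrib_left double diff by (simp add: algebra_simps)
  then show "(j choose 2) + N * (2 * N - j) = N * N + (N choose 2) + triangle (- (int j - int N))"
    by (simp only: mult_cancel_left of_nat_eq_iff) simp
qed

lemma finite_triple_product:
  fixes z w :: "'a::idom"
  assumes "z \<noteq> 0" "w \<noteq> 0"
  defines "q \<equiv> z * w"
  shows "(\<Prod>n<N. 1 + z * q ^ n) * (\<Prod>n<N. 1 + w * q ^ n) =
    (\<Sum>j\<le>2 * N. z ^ triangle (int j - int N) * w ^ triangle (- (int j - int N)) * qbinomial q (2 * N) j)"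
proof -
  define K where "K = z ^ N * q ^ (N * N + (N choose 2))"
  have exponents: "q ^ (j choose 2) * z ^ j * (q ^ N) ^ (2 * N - j) =
      K * (z ^ triangle (int j - int N) * w ^ triangle (- (int j - int N)))" if "j \<le> 2 * N" for j
  proof -
    have "q ^ (j choose 2) * z ^ j * (q ^ N) ^ (2 * N - j) =
        z ^ ((j choose 2) + j + N * (2 * N - j)) * w ^ ((j choose 2) + N * (2 * N - j))"
      unfolding q_def power_mult_distrib power_mult[symmetric] power_add by (simp only: mult_ac)
    also have "\<dots> = K * (z ^ triangle (int j - int N) * w ^ triangle (- (int j - int N)))"
      unfolding exponent_eq_triangle[OF that] K_def q_def power_mult_distrib power_add by (simp only: mult_ac)
    finally show ?thesis .
  qed
  have "K * ((\<Prod>n<N. 1 + z * q ^ n) * (\<Prod>n<N. 1 + w * q ^ n)) = (\<Prod>i<2 * N. q ^ N + z * q ^ i)"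
    unfolding K_def q_def by (rule prod_symmetric_split[symmetric])
  also have "\<dots> = (\<Sum>j\<le>2 * N. q ^ (j choose 2) * z ^ j * (q ^ N) ^ (2 * N - j) * qbinomial q (2 * N) j)"
    unfolding qbinomial_theorem by (simp only: mult_ac)
  also have "\<dots> = K *
      (\<Sum>j\<le>2 * N. z ^ triangle (int j - int N) * w ^ triangle (- (int j - int N)) * qbinomial q (2 * N) j)"
    unfolding sum_distrib_left by (rule sum.cong) (simp_all only: exponents atMost_iff, simp only: mult.assoc)
  finally show ?thesis using assms by (simp add: K_def)
qed

definition triple_product :: "nat \<Rightarrow> nat \<Rightarrow> 'a::comm_ring_1 fps" where
  "triple_product M a = euler M * residue_product M a * residue_product M (M - a)"

lemma triple_product_nth_0 [simp]: "triple_product M a $ 0 = 1"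
  by (simp add: triple_product_def)

lemma triple_product_nonzero [simp]: "triple_product M a \<noteq> (0 :: 'a::idom fps)"
  by (simp add: triple_product_def)

text \<open>This is Ramanujan's \<open>f(z, w) = \<Sum> z\<^bsup>k(k+1)/2\<^esup> w\<^bsup>k(k-1)/2\<^esup>\<close> at \<open>z = -X\<^sup>r\<close>, \<open>w = -X\<^sup>s\<close>.\<close>

definition ramanujan_theta :: "nat \<Rightarrow> nat \<Rightarrow> 'a::comm_ring_1 fps" where
  "ramanujan_theta r s = monomial_sum UNIV parity_sign (\<lambda>k. r * triangle k + s * triangle (- k))"

lemma ramanujan_exponent_ge: "int (r + s) * (\<bar>k\<bar> - 1) \<le> int (r * triangle k + s * triangle (- k))"
proof -
  have "int r * (\<bar>k\<bar> - 1) \<le> int r * int (triangle k)" "int s * (\<bar>k\<bar> - 1) \<le> int s * int (triangle (- k))"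
    using triangle_ge[of k] triangle_ge[of "- k"] by (auto intro!: mult_left_mono)
  then show ?thesis by (simp add: distrib_right)
qed

lemma ramanujan_theta_eq_upto:
  assumes "r + s > 0"
  shows "eq_upto N (ramanujan_theta r s :: 'a::comm_ring_1 fps)
    (\<Sum>j\<le>2 * Suc N. fps_const (parity_sign (int j - int (Suc N))) *
      fps_X ^ (r * triangle (int j - int (Suc N)) + s * triangle (- (int j - int (Suc N)))))"
proof -
  let ?I = "{- int (Suc N)..int (Suc N)}"
  have "eq_upto N (ramanujan_theta r s :: 'a fps)
      (\<Sum>k\<in>?I. fps_const (parity_sign k) * fps_X ^ (r * triangle k + s * triangle (- k)))"
    unfolding ramanujan_theta_def
  proof (rule monomial_sum_eq_upto)
    fix k :: int assume "k \<in> UNIV - ?I"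
    then have "int N \<le> \<bar>k\<bar> - 1" by auto
    then have "1 * int N \<le> int (r + s) * (\<bar>k\<bar> - 1)" using assms by (intro mult_mono) auto
    then show "N \<le> r * triangle k + s * triangle (- k)"
      using ramanujan_exponent_ge[of r s k] by linarith
  qed auto
  also have "(\<Sum>k\<in>?I. fps_const (parity_sign k) * fps_X ^ (r * triangle k + s * triangle (- k)) :: 'a fps) =
      (\<Sum>j\<le>2 * Suc N. fps_const (parity_sign (int j - int (Suc N))) *
        fps_X ^ (r * triangle (int j - int (Suc N)) + s * triangle (- (int j - int (Suc N)))))"
    by (rule sum.reindex_bij_witness[of _ "\<lambda>j. int j - int (Suc N)" "\<lambda>k. nat (k + int (Suc N))"]) auto
  finally show ?thesis .
qed

lemma neg_X_power_triangle:
  "(- (fps_X ^ r)) ^ triangle k * (- (fps_X ^ s)) ^ triangle (- k) =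
    (fps_const (parity_sign k) * fps_X ^ (r * triangle k + s * triangle (- k)) :: 'a::comm_ring_1 fps)"
proof -
  have "(- (fps_X ^ r)) ^ triangle k * (- (fps_X ^ s)) ^ triangle (- k) =
      (- 1) ^ (triangle k + triangle (- k)) * (fps_X ^ (r * triangle k + s * triangle (- k)) :: 'a fps)"
    by (simp only: power_minus[of "fps_X ^ _"] power_mult power_add mult_ac)
  then show ?thesis
    unfolding neg_one_power_triangle fps_const_parity_sign .
qed

lemma ramanujan_term_eq_upto:
  fixes r s j L :: nat
  defines "k \<equiv> int j - int (Suc L)"
  assumes "r + s > 0" "j \<le> 2 * Suc L"
  shows "eq_upto L
    (fps_X ^ (r * triangle k + s * triangle (- k)) * (euler (r + s) * qbinomial (fps_X ^ (r + s)) (2 * Suc L) j))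
    (fps_X ^ (r * triangle k + s * triangle (- k)) * 1 :: 'a::comm_ring_1 fps)"
proof -
  let ?M = "r + s" and ?e = "r * triangle k + s * triangle (- k)" and ?m = "min j (2 * Suc L - j)"
  have "int ?m = int L + 1 - \<bar>k\<bar>" using assms(3) by (auto simp: k_def min_def)
  then have "int ?M * int L = int ?M * (\<bar>k\<bar> - 1) + int ?M * int ?m"
    unfolding distrib_left[symmetric] by simp
  also have "\<dots> \<le> int ?e + int (?M * ?m)"
    using ramanujan_exponent_ge[of r s k] by simp
  finally have "L \<le> ?e + ?M * ?m"
    using assms(2) mult_right_mono[of 1 "int ?M" "int L"] by linarith
  then show ?thesis
    using assms by (intro eq_upto_X_power_mult[OF euler_mult_qbinomial_eq_upto]) auto
qed

theorem jacobi_triple_product: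
  assumes "0 < r" "0 < s"
  shows "ramanujan_theta r s = (triple_product (r + s) r :: 'a::idom fps)"
proof (rule fps_eqI_eq_upto)
  fix L
  define N where "N = Suc L"
  let ?M = "r + s" and ?k = "\<lambda>j. int j - int N"
  let ?t = "\<lambda>j. fps_const (parity_sign (?k j)) :: 'a fps"
    and ?X = "\<lambda>j. fps_X ^ (r * triangle (?k j) + s * triangle (- ?k j)) :: 'a fps"
  let ?P = "\<lambda>c. \<Prod>n<N. 1 - fps_X ^ (c + ?M * n) :: 'a fps"
  have "eq_upto L (ramanujan_theta r s) (\<Sum>j\<le>2 * N. ?t j * (?X j * 1))"
    using ramanujan_theta_eq_upto[of r s L] assms by (simp add: N_def)
  also have "eq_upto L \<dots>
      (\<Sum>j\<le>2 * N. ?t j * (?X j * (euler ?M * qbinomial (fps_X ^ ?M) (2 * N) j)))"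
    using assms unfolding N_def
    by (intro eq_upto_sum eq_upto_mult eq_upto_refl eq_upto_sym[OF ramanujan_term_eq_upto]) auto
  also have "\<dots> = euler ?M * ?P r * ?P s"
  proof -
    have q: "- (fps_X ^ r) * - (fps_X ^ s) = (fps_X ^ ?M :: 'a fps)"
      by (simp add: power_add)
    have "?P c = (\<Prod>n<N. 1 + - (fps_X ^ c) * (fps_X ^ ?M) ^ n)" for c
      by (simp add: power_add power_mult)
    then have "?P r * ?P s = (\<Sum>j\<le>2 * N. ?t j * ?X j * qbinomial (fps_X ^ ?M) (2 * N) j)"
      using finite_triple_product[of "- (fps_X ^ r) :: 'a fps" "- (fps_X ^ s)" N]
      unfolding q neg_X_power_triangle by simp
    then show ?thesis
      by (simp only: mult.assoc) (simp only: sum_distrib_left mult.left_commute[of "euler ?M"])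
  qed
  also have "eq_upto L \<dots> (triple_product ?M r)"
  proof -
    have "eq_upto L (?P c) (residue_product ?M c)" if "0 < c" "c < ?M" for c
      by (rule eq_upto_sym, rule eq_upto_mono, rule residue_product_eq_upto[OF that]) (simp_all add: N_def)
    then show ?thesis unfolding triple_product_def using assms by (intro eq_upto_mult) auto
  qed
  finally show "eq_upto L (ramanujan_theta r s) (triple_product ?M r :: 'a fps)" .
qed

section \<open>Power series over prime fields\<close>

class prime_field = field_prime_char +
  assumes power_CHAR: "x ^ CHAR('a) = x"

lemma CHAR_eqI:
  assumes "prime p" "of_nat p = (0 :: 'a::semiring_1)" "(1 :: 'a) \<noteq> 0"
  shows "CHAR('a) = p"
proof -
  have "CHAR('a) dvd p" using assms(2) by (simp add: of_nat_eq_0_iff_char_dvd)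
  moreover have "CHAR('a) \<noteq> 1" using assms(3) of_nat_CHAR[where 'a = 'a] by auto
  ultimately show ?thesis using assms(1) by (auto simp: prime_nat_iff)
qed

lemma CHAR_finite_2: "CHAR(Enum.finite_2) = 2"
proof (rule CHAR_eqI)
  have "of_nat 2 = 1 + (1 + (0 :: Enum.finite_2))"
    by (simp only: numeral_2_eq_2 of_nat_Suc of_nat_0)
  then show "of_nat 2 = (0 :: Enum.finite_2)" by (simp add: plus_finite_2_def)
qed (rule two_is_prime_nat, rule one_neq_zero)

lemma CHAR_finite_3: "CHAR(Enum.finite_3) = 3"
proof (rule CHAR_eqI)
  have "of_nat 3 = 1 + (1 + (1 + (0 :: Enum.finite_3)))"
    by (simp only: numeral_3_eq_3 of_nat_Suc of_nat_0)
  then show "of_nat 3 = (0 :: Enum.finite_3)" by (simp add: plus_finite_3_def)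
qed (simp_all only: prime_nat_numeral_eq one_neq_zero, simp_all)

instance Enum.finite_2 :: prime_field
proof
  show "\<exists>n>0. of_nat n = (0 :: Enum.finite_2)"
    using of_nat_CHAR[where 'a = Enum.finite_2] unfolding CHAR_finite_2 by (intro exI[of _ 2]) simp
  show "x ^ CHAR(Enum.finite_2) = x" for x :: Enum.finite_2
    unfolding CHAR_finite_2 power2_eq_square by (cases x) (simp_all add: times_finite_2_def)
qed

instance Enum.finite_3 :: prime_field
proof
  show "\<exists>n>0. of_nat n = (0 :: Enum.finite_3)"
    using of_nat_CHAR[where 'a = Enum.finite_3] unfolding CHAR_finite_3 by (intro exI[of _ 3]) simp
  show "x ^ CHAR(Enum.finite_3) = x" for x :: Enum.finite_3
    unfolding CHAR_finite_3 power3_eq_cube by (cases x) (simp_all add: times_finite_3_def)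
qed

lemma numeral_eq_0_if_CHAR: "CHAR('a::semiring_1) = numeral p \<Longrightarrow> (numeral p :: 'a) = 0"
  using of_nat_CHAR[where 'a = 'a] by simp

lemma fps_power_CHAR:
  fixes f :: "'a::prime_field fps"
  shows "f ^ CHAR('a) = f oo fps_X ^ CHAR('a)"
proof (rule fps_eqI_eq_upto)
  fix N
  let ?p = "CHAR('a)"
  define t where "t = (\<Sum>i<N. fps_const (f $ i) * fps_X ^ i)"
  have t: "eq_upto N f t"
    by (auto simp: eq_upto_def t_def fps_sum_nth if_distrib[of "(*) _"] cong: if_cong)
  have "t ^ ?p = (\<Sum>i<N. (fps_const (f $ i) * fps_X ^ i) ^ ?p)"
    unfolding t_def by (rule freshmans_dream_sum) simp_all
  also have "\<dots> = t oo fps_X ^ ?p"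
    unfolding t_def fps_compose_sum_distrib
    by (simp add: power_mult_distrib power_CHAR fps_X_power_compose power_mult[symmetric]
        mult.commute[of _ ?p] flip: fps_const_mult_apply_left)
  finally have "t ^ ?p = t oo fps_X ^ ?p" .
  then have "eq_upto N (f ^ ?p) (t oo fps_X ^ ?p)"
    using eq_upto_power[OF t, of ?p] by simp
  also have "eq_upto N \<dots> (f oo fps_X ^ ?p)"
    by (intro eq_upto_compose_X_power eq_upto_sym[OF t])
  finally show "eq_upto N (f ^ ?p) (f oo fps_X ^ ?p)" .
qed

lemma fps_power_CHAR_nth:
  fixes f :: "'a::prime_field fps"
  shows "(f ^ CHAR('a)) $ n = (if CHAR('a) dvd n then f $ (n div CHAR('a)) else 0)"
  by (subst fps_power_CHAR, rule fps_nth_compose_X_power)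

definition fps_section :: "nat \<Rightarrow> nat \<Rightarrow> 'a fps \<Rightarrow> 'a fps" where
  "fps_section p r f = Abs_fps (\<lambda>n. f $ (p * n + r))"

lemma fps_section_nth [simp]: "fps_section p r f $ n = f $ (p * n + r)"
  by (simp add: fps_section_def)

lemma fps_section_sum_power_CHAR:
  fixes g :: "nat \<Rightarrow> 'a::prime_field fps"
  assumes "r < CHAR('a)"
  shows "fps_section CHAR('a) r (\<Sum>i<CHAR('a). fps_X ^ i * g i ^ CHAR('a)) = g r"
proof (rule fps_ext)
  fix n
  let ?p = "CHAR('a)"
  have "(fps_X ^ i * g i ^ ?p) $ (?p * n + r) = (if i = r then g r $ n else 0)" if "i < ?p" for i
  proof -
    have "?p dvd ?p * n + r - i \<longleftrightarrow> i = r" if "i \<le> ?p * n + r"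
    proof
      assume "?p dvd ?p * n + r - i"
      then have "(?p * n + r) mod ?p = i mod ?p"
        unfolding mod_eq_dvd_iff_nat[OF that] .
      then show "i = r" using assms \<open>i < ?p\<close> by simp
    qed simp
    then show ?thesis
      by (auto simp: fps_X_power_mult_nth fps_power_CHAR_nth)
  qed
  then show "fps_section ?p r (\<Sum>i<?p. fps_X ^ i * g i ^ ?p) $ n = g r $ n"
    using assms by (simp add: fps_sum_nth)
qed

lemma fps_eq_sum_sections:
  fixes f :: "'a::prime_field fps"
  shows "f = (\<Sum>r<CHAR('a). fps_X ^ r * fps_section CHAR('a) r f ^ CHAR('a))"
proof (rule fps_ext)
  fix n
  let ?p = "CHAR('a)" and ?S = "\<Sum>r<CHAR('a). fps_X ^ r * fps_section CHAR('a) r f ^ CHAR('a)"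
  have "?S $ n = fps_section ?p (n mod ?p) ?S $ (n div ?p)"
    by (simp only: fps_section_nth mult_div_mod_eq)
  also have "fps_section ?p (n mod ?p) ?S = fps_section ?p (n mod ?p) f"
    by (rule fps_section_sum_power_CHAR[of "n mod ?p" "\<lambda>r. fps_section ?p r f"]) simp
  also have "\<dots> $ (n div ?p) = f $ n"
    by (simp only: fps_section_nth mult_div_mod_eq)
  finally show "f $ n = ?S $ n" by (rule sym)
qed

lemma power_CHAR_inject:
  fixes x y :: "'a::idom_prime_char"
  assumes "x ^ CHAR('a) = y ^ CHAR('a)"
  shows "x = y"
proof -
  have "(x - y) ^ CHAR('a) + y ^ CHAR('a) = x ^ CHAR('a)"
    using freshmans_dream[of "CHAR('a)" "x - y" y] by simp
  then show ?thesis using assms by simp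
qed

text \<open>
  In the applications to polynomial identities the cofactor \<open>q\<close> is the difference of both sides,
  expanded over the integers, divided by the characteristic.
\<close>

lemma eq_if_multiple_of_char:
  fixes x y q n :: "'a::comm_ring_1"
  assumes "n = 0" "x - y = n * q"
  shows "x = y"
  using assms by simp

lemma cube_add_if_3_eq_0:
  fixes x y :: "'a::idom"
  assumes "(3 :: 'a) = 0"
  shows "(x + y) ^ 3 = x ^ 3 + y ^ 3"
  by (rule eq_if_multiple_of_char[OF assms, of _ _ "x * y * (x + y)"]) algebra

lemma cube_diff_if_3_eq_0:
  fixes x y :: "'a::idom"
  assumes "(3 :: 'a) = 0"
  shows "(x - y) ^ 3 = x ^ 3 - y ^ 3"
  by (rule eq_if_multiple_of_char[OF assms, of _ _ "- (x * y * (x - y))"]) algebra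

lemma mult_left_cancelD:
  fixes c x y :: "'a::idom"
  assumes "c * x = c * y" "c \<noteq> 0"
  shows "x = y"
  using assms by simp

lemma euler_power_CHAR:
  "(euler M :: 'a::prime_field fps) ^ CHAR('a) = euler (CHAR('a) * M)"
  by (subst fps_power_CHAR, rule euler_times[symmetric]) simp

section \<open>Theta series\<close>

text \<open>
  With \<open>q = X\<^bsup>8Mc\<^esup>\<close> this is the theta function of multiplicative period \<open>q\<^sup>M\<close> at the point \<open>q\<^sup>a\<close>,
  multiplied by the power of \<open>X\<close> that makes it odd and antiperiodic in \<open>a\<close>.
\<close>

definition theta :: "nat \<Rightarrow> nat \<Rightarrow> int \<Rightarrow> 'a::comm_ring_1 fps" where
  "theta c M a = monomial_sum UNIV parity_sign (\<lambda>k. c * nat ((2 * int M * k - int M + 2 * a)\<^sup>2))"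

lemma theta_uminus: "theta c M (- a) = - theta c M a"
proof -
  have "theta c M (- a) =
      monomial_sum UNIV (\<lambda>k. - parity_sign k) (\<lambda>k. c * nat ((2 * int M * k - int M + 2 * a)\<^sup>2))"
    unfolding theta_def
  proof (rule monomial_sum_reindex[of "\<lambda>k. 1 - k"])
    show "bij_betw (\<lambda>k. 1 - k) (UNIV :: int set) UNIV"
      by (rule bij_betwI[where g = "\<lambda>k. 1 - k"]) auto
    fix i :: int
    have "2 * int M * i - int M + 2 * - a = - (2 * int M * (1 - i) - int M + 2 * a)"
      by (simp add: algebra_simps)
    then show "c * nat ((2 * int M * i - int M + 2 * - a)\<^sup>2) =
        c * nat ((2 * int M * (1 - i) - int M + 2 * a)\<^sup>2)"
      by (simp only: power2_minus)
  qed (auto simp: parity_sign_def)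
  then show ?thesis by (simp add: theta_def monomial_sum_uminus)
qed

lemma theta_add_period: "theta c M (a + int M) = - theta c M a"
proof -
  have "theta c M (a + int M) =
      monomial_sum UNIV (\<lambda>k. - parity_sign k) (\<lambda>k. c * nat ((2 * int M * k - int M + 2 * a)\<^sup>2))"
    unfolding theta_def
  proof (rule monomial_sum_reindex[of "\<lambda>k. k + 1"])
    show "bij_betw (\<lambda>k. k + 1) (UNIV :: int set) UNIV"
      by (rule bij_betwI[where g = "\<lambda>k. k - 1"]) auto
  qed (auto simp: parity_sign_def algebra_simps)
  then show ?thesis by (simp add: theta_def monomial_sum_uminus)
qed

lemma theta_reflect: "theta c M (int M - a) = theta c M a"
  using theta_add_period[of c M "- a"] by (simp add: theta_uminus)

lemma antiperiodic_mod:
  fixes f :: "int \<Rightarrow> 'a::comm_ring_1"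
  assumes "\<And>a. f (a + d) = - f a"
  shows "f a = parity_sign (a div d) * f (a mod d)"
proof -
  have "f (r + k * d) = parity_sign k * f r" for k r
  proof (induction k rule: int_induct[where k = 0])
    case (step1 k)
    then show ?case
      using assms[of "r + k * d"] by (simp add: parity_sign_def algebra_simps split: if_splits)
  next
    case (step2 k)
    then show ?case
      using assms[of "r + (k - 1) * d"] by (simp add: parity_sign_def algebra_simps split: if_splits)
  qed (simp add: parity_sign_def)
  from this[of "a mod d" "a div d"] show ?thesis by simp
qed

lemma theta_rescale:
  assumes "s > 0"
  shows "theta c (s * M) (int s * a) = theta (c * s\<^sup>2) M a"
proof -
  have "c * nat ((2 * int (s * M) * k - int (s * M) + 2 * (int s * a))\<^sup>2) =
      c * s\<^sup>2 * nat ((2 * int M * k - int M + 2 * a)\<^sup>2)" for k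
  proof -
    have "(2 * int (s * M) * k - int (s * M) + 2 * (int s * a))\<^sup>2 =
        (int s)\<^sup>2 * (2 * int M * k - int M + 2 * a)\<^sup>2"
      unfolding power_mult_distrib[symmetric] by (rule arg_cong[of _ _ "\<lambda>x. x\<^sup>2"]) (simp add: algebra_simps)
    also have "nat \<dots> = s\<^sup>2 * nat ((2 * int M * k - int M + 2 * a)\<^sup>2)"
      by (simp add: nat_mult_distrib nat_power_eq)
    finally show ?thesis by (simp add: mult.assoc)
  qed
  then show ?thesis unfolding theta_def by (simp only:)
qed

lemma theta_power_CHAR:
  "(theta c M a :: 'a::prime_field fps) ^ CHAR('a) = theta (CHAR('a) * c) M a"
  by (subst fps_power_CHAR) (simp add: theta_def monomial_sum_compose_X_power mult.assoc)

lemma theta_rescale_CHAR: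
  "(theta c (CHAR('a) * M) (int CHAR('a) * a) :: 'a::prime_field fps) = theta (CHAR('a) * c) M a ^ CHAR('a)"
  unfolding theta_power_CHAR by (subst theta_rescale) (simp_all add: power2_eq_square mult_ac)

lemma finite_quadratic_fibre:
  fixes u v :: int
  assumes "c > 0" "u \<noteq> 0"
  shows "finite {k. k \<in> A \<and> c * nat ((u * k + v)\<^sup>2) = n}"
proof (rule finite_subset)
  show "{k. k \<in> A \<and> c * nat ((u * k + v)\<^sup>2) = n} \<subseteq> (\<lambda>k. u * k + v) -` {- int n..int n}"
  proof
    fix k assume "k \<in> {k. k \<in> A \<and> c * nat ((u * k + v)\<^sup>2) = n}"
    then have "n = c * nat ((u * k + v)\<^sup>2)" by simp
    then have "nat ((u * k + v)\<^sup>2) \<le> n" using assms(1) by simp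
    then have "(u * k + v)\<^sup>2 \<le> int n" by linarith
    moreover have "\<bar>u * k + v\<bar> \<le> (u * k + v)\<^sup>2"
      using self_le_power[of "\<bar>u * k + v\<bar>" 2] by (cases "u * k + v = 0") auto
    ultimately show "k \<in> (\<lambda>k. u * k + v) -` {- int n..int n}" by auto
  qed
  show "finite ((\<lambda>k. u * k + v) -` {- int n..int n})"
    by (rule finite_vimageI) (use assms(2) in \<open>auto simp: inj_on_def\<close>)
qed

lemma finite_theta_fibre:
  assumes "c > 0" "M > 0"
  shows "finite {k. k \<in> A \<and> c * nat ((2 * int M * k - int M + 2 * a)\<^sup>2) = n}"
  using finite_quadratic_fibre[OF assms(1), of "2 * int M" A "- int M + 2 * a" n] assms(2)
  by (simp add: algebra_simps)

lemma finite_sum_fibre: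
  fixes e :: "'i \<Rightarrow> nat" and g :: "'j \<Rightarrow> nat"
  assumes "\<And>n. finite {i. e i = n}" "\<And>n. finite {j. g j = n}"
  shows "finite {p. p \<in> A \<and> (case p of (i, j) \<Rightarrow> e i + g j) = n}"
proof (rule finite_subset)
  show "finite ((\<Union>m\<le>n. {i. e i = m}) \<times> (\<Union>m\<le>n. {j. g j = m}))"
    by (intro finite_cartesian_product finite_UN_I assms) auto
qed auto

lemma int_eq_UN_residue_classes:
  fixes p :: nat
  assumes "p > 0"
  shows "(UNIV :: int set) = (\<Union>r<p. range (\<lambda>j. int p * j - int r))"
proof -
  have "k \<in> (\<Union>r<p. range (\<lambda>j. int p * j - int r))" for k :: int
  proof
    let ?r = "nat ((- k) mod int p)"
    show "?r \<in> {..<p}" using assms by (simp add: nat_less_iff)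
    have "int ?r = - k - int p * ((- k) div int p)"
      using assms by (simp add: minus_mult_div_eq_mod)
    then have "k = int p * (- ((- k) div int p)) - int ?r"
      by simp
    then show "k \<in> range (\<lambda>j. int p * j - int ?r)" by blast
  qed
  then show ?thesis by blast
qed

lemma disjoint_residue_classes:
  fixes p q r :: nat
  assumes "q < p" "r < p" "q \<noteq> r"
  shows "range (\<lambda>j. int p * j - int q) \<inter> range (\<lambda>j. int p * j - int r) = {}"
proof (rule ccontr)
  assume "\<not> ?thesis"
  then obtain i j where "int p * i - int q = int p * j - int r" by auto
  then have "int q - int r = int p * (i - j)" by (simp add: algebra_simps)
  then have "int q mod int p = int r mod int p" by (simp add: mod_eq_dvd_iff)
  then show False using assms by simp
qed

theorem theta_multisection:
  fixes c M p :: nat and a h :: int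
  assumes "c > 0" "M > 0" "p > 0" "2 * h = int M * (int p - 1)" "odd p \<or> (2 :: 'a::comm_ring_1) = 0"
  shows "(theta c M a :: 'a fps) = (\<Sum>r<p. parity_sign (int r) * theta c (p * M) (a + h - int M * int r))"
proof -
  let ?e = "\<lambda>k. c * nat ((2 * int M * k - int M + 2 * a)\<^sup>2)"
  let ?R = "\<lambda>r. range (\<lambda>j. int p * j - int r)"
  have sign: "(parity_sign (int p * j - int r) :: 'a) = parity_sign (int r) * parity_sign j" for j r
  proof (cases "odd p")
    case False
    then have "(- 1 :: 'a) = 1"
      using assms(5) by (metis add.right_inverse add_left_imp_eq one_add_one)
    then show ?thesis by (simp add: parity_sign_def)
  qed (simp add: parity_sign_def)
  have "2 * int M * (int p * j - int r) - int M + 2 * a =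
      2 * int (p * M) * j - int (p * M) + 2 * (a + h - int M * int r)" for j r
    using assms(4) by (simp add: algebra_simps)
  then have exponent: "?e (int p * j - int r) =
      c * nat ((2 * int (p * M) * j - int (p * M) + 2 * (a + h - int M * int r))\<^sup>2)" for j r
    by (simp only:)
  have part: "monomial_sum (?R r) parity_sign ?e =
      (parity_sign (int r) * theta c (p * M) (a + h - int M * int r) :: 'a fps)" for r
  proof -
    have "monomial_sum (?R r) parity_sign ?e =
        (monomial_sum UNIV (\<lambda>j. parity_sign (int p * j - int r)) (\<lambda>j. ?e (int p * j - int r)) :: 'a fps)"
      by (rule monomial_sum_reindex[of "\<lambda>j. int p * j - int r", symmetric])
        (use assms(3) in \<open>auto simp: bij_betw_def inj_on_def\<close>)
    also have "\<dots> = fps_const (parity_sign (int r)) * theta c (p * M) (a + h - int M * int r)"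
      unfolding sign exponent monomial_sum_mult_const theta_def ..
    finally show ?thesis by (simp only: fps_const_parity_sign)
  qed
  have "theta c M a = (monomial_sum (\<Union>r<p. ?R r) parity_sign ?e :: 'a fps)"
    unfolding theta_def int_eq_UN_residue_classes[OF assms(3), symmetric] ..
  also have "\<dots> = (\<Sum>r<p. monomial_sum (?R r) parity_sign ?e)"
    by (intro monomial_sum_UN_disjoint finite_theta_fibre disjoint_residue_classes) (use assms in auto)
  finally show ?thesis unfolding part .
qed

lemma bij_betw_sum_difference:
  "bij_betw (\<lambda>(i, j). (i + j - 1, i - j)) (UNIV \<times> UNIV)
    ({k :: int. odd k} \<times> {l. even l} \<union> {k. even k} \<times> {l. odd l})"
    (is "bij_betw ?h _ ?S")
proof (rule bij_betwI[where g = "\<lambda>(k, l). ((k + 1 + l) div 2, (k + 1 - l) div 2)"])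
  show "?h \<in> UNIV \<times> UNIV \<rightarrow> ?S" by auto
  show "?h (case p of (k, l) \<Rightarrow> ((k + 1 + l) div 2, (k + 1 - l) div 2)) = p" if "p \<in> ?S" for p
    using that by (auto elim!: evenE oddE)
qed auto

lemma theta_exponents_add:
  fixes M a b i j :: int
  shows "nat ((2 * M * i - M + 2 * (a + b))\<^sup>2) + nat ((2 * M * j - M + 2 * (a - b))\<^sup>2) =
    2 * nat ((M * (i + j - 1) + 2 * a)\<^sup>2) + 2 * nat ((M * (i - j) + 2 * b)\<^sup>2)"
    (is "nat (?u\<^sup>2) + nat (?v\<^sup>2) = 2 * nat (?x\<^sup>2) + 2 * nat (?y\<^sup>2)")
proof -
  have "?u\<^sup>2 + ?v\<^sup>2 = 2 * ?x\<^sup>2 + 2 * ?y\<^sup>2" by (simp add: power2_eq_square algebra_simps)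
  then have "int (nat (?u\<^sup>2) + nat (?v\<^sup>2)) = int (2 * nat (?x\<^sup>2) + 2 * nat (?y\<^sup>2))" by simp
  then show ?thesis by (simp only: of_nat_eq_iff)
qed

text \<open>
  Writing the double sum in terms of the sum and the difference of the indices separates \<open>a\<close> from
  \<open>b\<close>; the antisymmetric rank two form of the result implies the three-term relation.
\<close>

lemma theta_mult:
  fixes a b :: int
  assumes "c > 0" "M > 0"
  defines "g \<equiv> \<lambda>a k. 2 * c * nat ((int M * k + 2 * a)\<^sup>2)"
  shows "theta c M (a + b) * theta c M (a - b) =
    monomial_sum {k. odd k} (\<lambda>_. 1) (g a) * monomial_sum {k. even k} (\<lambda>_. 1) (g b) -
    monomial_sum {k. even k} (\<lambda>_. 1) (g a) * (monomial_sum {k. odd k} (\<lambda>_. 1) (g b) :: 'a::comm_ring_1 fps)"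
proof -
  let ?e = "\<lambda>a k. c * nat ((2 * int M * k - int M + 2 * a)\<^sup>2)"
  let ?O = "{k :: int. odd k}" and ?E = "{k :: int. even k}"
  let ?t = "\<lambda>(k, l :: int). if odd k then 1 else - 1 :: 'a"
  let ?g = "\<lambda>(k, l). g a k + g b l"
  have fin: "finite {k. k \<in> A \<and> g a k = n}" for A n a
    unfolding g_def using finite_quadratic_fibre[of "2 * c" "int M" A "2 * a" n] assms(1,2) by simp
  have "theta c M (a + b) * theta c M (a - b) =
      monomial_sum (UNIV \<times> UNIV) (\<lambda>(i, j). parity_sign i * parity_sign j) (\<lambda>(i, j). ?e (a + b) i + ?e (a - b) j)"
    unfolding theta_def by (rule monomial_sum_mult; rule finite_theta_fibre[OF assms(1,2)])
  also have "\<dots> = monomial_sum (?O \<times> ?E \<union> ?E \<times> ?O) ?t ?g"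
  proof (rule monomial_sum_reindex[OF bij_betw_sum_difference])
    fix p :: "int \<times> int"
    obtain i j where p: "p = (i, j)" by (cases p)
    show "(case p of (i, j) \<Rightarrow> parity_sign i * parity_sign j) = ?t (case p of (i, j) \<Rightarrow> (i + j - 1, i - j))"
      by (auto simp: p parity_sign_def)
    have "c * (nat ((2 * int M * i - int M + 2 * (a + b))\<^sup>2) + nat ((2 * int M * j - int M + 2 * (a - b))\<^sup>2)) =
        c * (2 * nat ((int M * (i + j - 1) + 2 * a)\<^sup>2) + 2 * nat ((int M * (i - j) + 2 * b)\<^sup>2))"
      unfolding theta_exponents_add ..
    then show "(case p of (i, j) \<Rightarrow> ?e (a + b) i + ?e (a - b) j) = ?g (case p of (i, j) \<Rightarrow> (i + j - 1, i - j))"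
      by (simp add: p g_def distrib_left mult.assoc mult.left_commute[of c 2])
  qed
  also have "\<dots> = monomial_sum (?O \<times> ?E) ?t ?g + monomial_sum (?E \<times> ?O) ?t ?g"
    by (rule monomial_sum_Un_disjoint, force, rule finite_sum_fibre) (use fin[of UNIV] in simp_all)
  also have "monomial_sum (?O \<times> ?E) ?t ?g = monomial_sum ?O (\<lambda>_. 1) (g a) * monomial_sum ?E (\<lambda>_. 1) (g b)"
    unfolding monomial_sum_mult[OF fin fin] by (rule monomial_sum_reindex[of id]) auto
  also have "monomial_sum (?E \<times> ?O) ?t ?g = - (monomial_sum ?E (\<lambda>_. 1) (g a) * monomial_sum ?O (\<lambda>_. 1) (g b))"
    unfolding monomial_sum_mult[OF fin fin] monomial_sum_uminus[symmetric]
    by (rule monomial_sum_reindex[of id]) auto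
  finally show ?thesis by simp
qed

theorem theta_three_term:
  fixes a b x y :: int
  assumes "c > 0" "M > 0"
  defines "T \<equiv> theta c M :: int \<Rightarrow> 'a::comm_ring_1 fps"
  shows "T (a + b) * T (a - b) * (T (x + y) * T (x - y)) -
    T (a + x) * T (a - x) * (T (b + y) * T (b - y)) +
    T (a + y) * T (a - y) * (T (b + x) * T (b - x)) = 0"
proof -
  define P Q :: "int \<Rightarrow> 'a fps"
    where "P = (\<lambda>a. monomial_sum {k. odd k} (\<lambda>_. 1) (\<lambda>k. 2 * c * nat ((int M * k + 2 * a)\<^sup>2)))"
      and "Q = (\<lambda>a. monomial_sum {k. even k} (\<lambda>_. 1) (\<lambda>k. 2 * c * nat ((int M * k + 2 * a)\<^sup>2)))"
  have PQ: "T (a + b) * T (a - b) = P a * Q b - Q a * P b" for a b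
    unfolding T_def P_def Q_def by (rule theta_mult[OF assms(1,2)])
  show ?thesis unfolding PQ by (simp add: algebra_simps)
qed

theorem theta_triple_product:
  fixes a c M :: nat
  assumes "0 < a" "a < M" "c > 0"
  shows "theta c M (int a) =
    fps_X ^ (c * nat ((int M - 2 * int a)\<^sup>2)) * (triple_product M a oo fps_X ^ (8 * M * c) :: 'a::idom fps)"
proof -
  obtain d where M: "M = a + d" "d > 0" using assms(2) by (auto simp: less_iff_Suc_add)
  have "c * nat ((2 * int M * k - int M + 2 * int a)\<^sup>2) =
      8 * M * c * (a * triangle k + d * triangle (- k)) + c * nat ((int M - 2 * int a)\<^sup>2)" for k
  proof -
    have "(2 * int M * k - int M + 2 * int a)\<^sup>2 =
        4 * int M * (int a * (2 * int (triangle k)) + int d * (2 * int (triangle (- k)))) + (int M - 2 * int a)\<^sup>2"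
      unfolding double_triangle M by (simp add: power2_eq_square algebra_simps)
    then have "int (nat ((2 * int M * k - int M + 2 * int a)\<^sup>2)) =
        int (8 * M * (a * triangle k + d * triangle (- k)) + nat ((int M - 2 * int a)\<^sup>2))"
      by (simp add: algebra_simps)
    then show ?thesis by (simp only: of_nat_eq_iff) (simp add: algebra_simps)
  qed
  then have "theta c M (int a) = fps_X ^ (c * nat ((int M - 2 * int a)\<^sup>2)) *
      (ramanujan_theta a d oo fps_X ^ (8 * M * c) :: 'a fps)"
    using assms
    by (simp add: theta_def ramanujan_theta_def monomial_sum_compose_X_power fps_X_power_mult_monomial_sum)
  then show ?thesis
    using jacobi_triple_product[of a d, where 'a = 'a] assms M by simp
qed

lemma fps_compose_X_power_eq_0_iff:
  fixes f :: "'a::comm_ring_1 fps"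
  assumes "d > 0"
  shows "f oo fps_X ^ d = 0 \<longleftrightarrow> f = 0"
  using fps_compose_X_power_inject[OF assms, of f 0] by auto

lemma obtain_nonzero_residue:
  fixes M :: nat and a :: int
  assumes "M > 0" "\<not> int M dvd a"
  obtains r where "0 < r" "r < M" "a mod int M = int r"
proof
  have "a mod int M > 0"
    using assms by (metis dvd_eq_mod_eq_0 of_nat_0_less_iff order_le_less pos_mod_sign)
  then show "0 < nat (a mod int M)" "nat (a mod int M) < M" "a mod int M = int (nat (a mod int M))"
    using assms(1) by (auto simp: nat_less_iff)
qed

lemma theta_nonzero:
  assumes "c > 0" "M > 0" "\<not> int M dvd a"
  shows "theta c M a \<noteq> (0 :: 'a::idom fps)"
proof -
  obtain r where "0 < r" "r < M" "a mod int M = int r"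
    using obtain_nonzero_residue[OF assms(2,3)] .
  then have "theta c M (a mod int M) \<noteq> (0 :: 'a fps)"
    using theta_triple_product[of r M c, where 'a = 'a] assms
    by (simp add: fps_compose_X_power_eq_0_iff)
  moreover have "theta c M a = (parity_sign (a div int M) * theta c M (a mod int M) :: 'a fps)"
    by (rule antiperiodic_mod) (rule theta_add_period)
  ultimately show ?thesis by (simp add: parity_sign_def)
qed

lemma prod_triple_product:
  fixes b M p :: nat
  assumes "0 < b" "b < M" "p > 0"
  shows "euler M * (\<Prod>i<p. triple_product (p * M) (b + M * i)) =
    (euler (p * M) ^ p * triple_product M b :: 'a::comm_ring_1 fps)"
proof -
  have "p * M - (b + M * i) = (M - b) + M * (p - Suc i)" if "i < p" for i
  proof -
    have "p * M = M * (i + Suc (p - Suc i))" using that by simp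
    then show ?thesis using assms(2) unfolding distrib_left mult_Suc_right by linarith
  qed
  then have "(\<Prod>i<p. residue_product (p * M) (p * M - (b + M * i))) =
      (\<Prod>i<p. residue_product (p * M) ((M - b) + M * (p - Suc i)) :: 'a fps)"
    by (intro prod.cong) auto
  also have "\<dots> = (\<Prod>i<p. residue_product (p * M) ((M - b) + M * i))"
    by (rule prod.nat_diff_reindex)
  also have "\<dots> = residue_product M (M - b)"
    by (rule residue_product_split[symmetric]) (use assms in auto)
  finally show ?thesis
    using residue_product_split[of b M p, where 'a = 'a] assms
    by (simp add: triple_product_def prod.distrib mult_ac)
qed

lemma sum_squares_arithmetic_progression:
  fixes u v :: int
  shows "(\<Sum>i<p. (u * (int p - 1 - 2 * int i) + v)\<^sup>2) = u\<^sup>2 * (\<Sum>i<p. (int p - 1 - 2 * int i)\<^sup>2) + int p * v\<^sup>2"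
proof -
  have "(\<Sum>i<p. 2 * int i) = int p * (int p - 1)"
    by (induction p) (auto simp: algebra_simps)
  then have "(\<Sum>i<p. int p - 1 - 2 * int i) = 0" by (simp add: sum_subtractf)
  then have "(\<Sum>i<p. 2 * u * v * (int p - 1 - 2 * int i)) = 0" unfolding sum_distrib_left[symmetric] by simp
  moreover have "(u * (int p - 1 - 2 * int i) + v)\<^sup>2 =
      u\<^sup>2 * (int p - 1 - 2 * int i)\<^sup>2 + 2 * u * v * (int p - 1 - 2 * int i) + v\<^sup>2" for i
    by (simp add: power2_eq_square algebra_simps)
  ultimately show ?thesis by (simp add: sum.distrib sum_distrib_left)
qed

lemma sum_theta_exponents:
  fixes b M p :: nat
  shows "(\<Sum>i<p. nat ((int (p * M) - 2 * int (b + M * i))\<^sup>2)) =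
    M\<^sup>2 * (\<Sum>i<p. nat ((int p - 1 - 2 * int i)\<^sup>2)) + p * nat ((int M - 2 * int b)\<^sup>2)"
proof -
  have progression: "int (p * M) - 2 * int (b + M * i) =
      int M * (int p - 1 - 2 * int i) + (int M - 2 * int b)" for i
    by (simp add: algebra_simps)
  have "int (\<Sum>i<p. nat ((int (p * M) - 2 * int (b + M * i))\<^sup>2)) =
      (\<Sum>i<p. (int M * (int p - 1 - 2 * int i) + (int M - 2 * int b))\<^sup>2)"
    unfolding progression by simp
  also have "\<dots> = int (M\<^sup>2 * (\<Sum>i<p. nat ((int p - 1 - 2 * int i)\<^sup>2)) + p * nat ((int M - 2 * int b)\<^sup>2))"
    unfolding sum_squares_arithmetic_progression by simp
  finally show ?thesis by (simp only: of_nat_eq_iff)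
qed

lemma theta_distribution:
  fixes b c M p :: nat
  assumes "0 < b" "b < M" "c > 0" "p > 0"
  defines "Y \<equiv> fps_X ^ (8 * (p * M) * c)"
  shows "(euler M oo Y) * (\<Prod>i<p. theta c (p * M) (int (b + M * i))) =
    fps_X ^ (c * M\<^sup>2 * (\<Sum>i<p. nat ((int p - 1 - 2 * int i)\<^sup>2))) *
      (euler (p * M) oo Y) ^ p * (theta (p * c) M (int b) :: 'a::idom fps)"
proof -
  let ?m = "\<lambda>i. c * nat ((int (p * M) - 2 * int (b + M * i))\<^sup>2)"
    and ?s = "\<Sum>i<p. nat ((int p - 1 - 2 * int i)\<^sup>2)"
  have Y0: "Y $ 0 = 0" using assms by (simp add: Y_def)
  have exponent: "(\<Sum>i<p. ?m i) = c * M\<^sup>2 * ?s + p * c * nat ((int M - 2 * int b)\<^sup>2)"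
    unfolding sum_distrib_left[symmetric] sum_theta_exponents by (simp add: algebra_simps)
  have "theta c (p * M) (int (b + M * i)) = fps_X ^ ?m i * (triple_product (p * M) (b + M * i) oo Y :: 'a fps)"
    if "i < p" for i
  proof -
    have "M * Suc i \<le> p * M" using mult_le_mono2[of "Suc i" p M] that by (simp add: mult.commute)
    then have "b + M * i < p * M" using assms(2) by simp
    then show ?thesis using theta_triple_product[of "b + M * i" "p * M" c, where 'a = 'a] assms by simp
  qed
  then have "(euler M oo Y) * (\<Prod>i<p. theta c (p * M) (int (b + M * i))) =
      (euler M oo Y) * (\<Prod>i<p. fps_X ^ ?m i * (triple_product (p * M) (b + M * i) oo Y :: 'a fps))"
    by simp
  also have "\<dots> = fps_X ^ (\<Sum>i<p. ?m i) * ((euler M * (\<Prod>i<p. triple_product (p * M) (b + M * i))) oo Y)"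
    using Y0 by (simp add: prod.distrib power_sum fps_compose_mult_distrib fps_compose_prod_distrib mult_ac)
  also have "\<dots> = fps_X ^ (c * M\<^sup>2 * ?s) * (euler (p * M) oo Y) ^ p *
      (fps_X ^ (p * c * nat ((int M - 2 * int b)\<^sup>2)) * (triple_product M b oo Y))"
    unfolding exponent power_add prod_triple_product[OF assms(1,2,4)]
    using Y0 by (simp add: fps_compose_mult_distrib fps_compose_power mult_ac)
  also have "fps_X ^ (p * c * nat ((int M - 2 * int b)\<^sup>2)) * (triple_product M b oo Y) = theta (p * c) M (int b)"
    using theta_triple_product[of b M "p * c", where 'a = 'a] assms by (simp add: mult_ac)
  finally show ?thesis .
qed

lemma prod_antiperiodic_shift:
  fixes f :: "int \<Rightarrow> 'a::comm_ring_1"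
  assumes "p > 0" "\<And>x. f (x + int p * d) = - f x"
  shows "(\<Prod>i<p. f (x + d + d * int i)) = - (\<Prod>i<p. f (x + d * int i))"
proof -
  obtain n where p: "p = Suc n" using assms(1) gr0_implies_Suc by blast
  have "(\<Prod>i<p. f (x + d + d * int i)) = f (x + int p * d) * (\<Prod>i<n. f (x + d * int (Suc i)))"
    by (simp add: p algebra_simps)
  also have "\<dots> = - (f (x + d * int 0) * (\<Prod>i<n. f (x + d * int (Suc i))))"
    by (simp add: assms(2))
  also have "\<dots> = - (\<Prod>i<p. f (x + d * int i))"
    unfolding p prod.lessThan_Suc_shift ..
  finally show ?thesis .
qed

theorem theta_distribution_CHAR:
  fixes c M :: nat and b :: int
  assumes "c > 0" "M > 0" "\<not> int M dvd b"
  defines "p \<equiv> CHAR('a::prime_field)"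
  shows "(\<Prod>i<p. theta c (p * M) (b + int M * int i)) =
    fps_X ^ (c * M\<^sup>2 * (\<Sum>i<p. nat ((int p - 1 - 2 * int i)\<^sup>2))) *
      (euler M oo fps_X ^ (8 * (p * M) * c)) ^ (p * p - 1) * (theta (p * c) M b :: 'a fps)"
    (is "?L b = ?K * ?e ^ _ * ?t b")
proof -
  have p: "p > 0" by (simp add: p_def)
  have d: "8 * (p * M) * c > 0" using assms p by simp
  have nat_case: "?L (int r) = ?K * ?e ^ (p * p - 1) * ?t (int r)" if "0 < r" "r < M" for r
  proof -
    have "?e * ?L (int r) = ?K * (?e ^ p) ^ p * ?t (int r)"
      using theta_distribution[OF that assms(1) p, where 'a = 'a] d euler_power_CHAR[of M, where 'a = 'a]
      by (simp add: p_def fps_compose_power)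
    also have "(?e ^ p) ^ p = ?e * ?e ^ (p * p - 1)"
      using p by (simp flip: power_mult power_Suc)
    finally have "?e * ?L (int r) = ?e * (?K * ?e ^ (p * p - 1) * ?t (int r))"
      by (simp only: mult_ac)
    then show ?thesis
      by (rule mult_left_cancelD) (use d in \<open>simp add: fps_compose_X_power_eq_0_iff\<close>)
  qed
  obtain r where r: "0 < r" "r < M" "b mod int M = int r"
    using obtain_nonzero_residue[OF assms(2,3)] .
  have "?L (x + int M) = - ?L x" for x
    using theta_add_period[of c "p * M"] by (intro prod_antiperiodic_shift[OF p]) simp
  then have "?L b = parity_sign (b div int M) * ?L (b mod int M)" by (rule antiperiodic_mod)
  moreover have "?t b = parity_sign (b div int M) * ?t (b mod int M)"
    by (rule antiperiodic_mod) (rule theta_add_period)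
  ultimately show ?thesis using nat_case[OF r(1,2)] unfolding r(3) by (simp only: mult_ac)
qed

section \<open>Algebraic form of the modular equations\<close>

text \<open>
  In both characteristics \<open>A\<close>, \<open>B\<close>, \<open>C\<close> stand for the reciprocals of \<open>\<theta>\<^sub>1\<theta>\<^sub>5\<close>, \<open>\<theta>\<^sub>2\<theta>\<^sub>3\<close>, \<open>\<theta>\<^sub>4\<theta>\<^sub>6\<close>, where
  \<open>\<theta>\<^sub>a\<close> are the theta series of level 13, and \<open>E = \<eta>(13\<tau>)\<^sup>6\<close>. As \<open>ABC = 1 / (\<eta>(\<tau>) \<eta>(13\<tau>)\<^sup>5)\<close>, an equation
  between \<open>A\<close>, \<open>B\<close>, \<open>C\<close> and \<open>E\<close> becomes a relation between \<open>\<eta>(\<tau>)\<close> and \<open>\<eta>(13\<tau>)\<close>. The linear relation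
  \<open>C = A - B\<close> makes \<open>A/B\<close> the parameter of a rational curve.
\<close>

locale level_13_char_2 =
  fixes A B C E :: "'a::field"
  assumes two: "(2 :: 'a) = 0"
    and nonzero: "A \<noteq> 0" "B \<noteq> 0" "C \<noteq> 0"
    and C_eq: "C = A - B"
    and doubling_A: "E * A ^ 3 * B\<^sup>2 * C\<^sup>2 = A ^ 8 * E\<^sup>2 + B\<^sup>2"
    and doubling_B: "E * B ^ 3 * C\<^sup>2 * A\<^sup>2 = B ^ 8 * E\<^sup>2 + C\<^sup>2"
    and cubic_nonzero: "A ^ 3 + A * B\<^sup>2 + B ^ 3 \<noteq> 0"
begin

definition "T = A * B * C"
definition "k = A ^ 3 + A\<^sup>2 * B + B ^ 3"
definition "l = A ^ 3 + A * B\<^sup>2 + B ^ 3"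
definition "m = A\<^sup>2 + A * B + B\<^sup>2"

lemma E_square_mult_k: "E\<^sup>2 * T * k = 1"
proof -
  have "l * (E\<^sup>2 * T * k) = E\<^sup>2 * (T * k * l)" by algebra
  also have "T * k * l = A * B * (A ^ 7 - B ^ 7)"
    by (rule eq_if_multiple_of_char[OF two, of _ _ "A^5*B^4 - A^4*B^5"])
      (unfold T_def k_def l_def, unfold C_eq, algebra)
  also have "E\<^sup>2 * \<dots> = A * C\<^sup>2 - B ^ 3"
    using doubling_A doubling_B by algebra
  also have "\<dots> = l * 1"
    by (rule eq_if_multiple_of_char[OF two, of _ _ "- (A^2*B) - B^3"]) (unfold l_def, unfold C_eq, algebra)
  finally show ?thesis by (rule mult_left_cancelD) (use cubic_nonzero in \<open>simp add: l_def\<close>)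
qed

lemma E_mult_m_square: "E * (m\<^sup>2 * l) = T\<^sup>2"
proof -
  have "l * (E * T ^ 3 * k) = E * T\<^sup>2 * (T * k * l)" by algebra
  also have "T * k * l = A * B * (B ^ 7 - A ^ 7)"
    by (rule eq_if_multiple_of_char[OF two, of _ _ "A^8*B + A^5*B^4 - A^4*B^5 - A*B^8"])
      (unfold T_def k_def l_def, unfold C_eq, algebra)
  also have "E * T\<^sup>2 * \<dots> = B ^ 10 - A ^ 8 * C\<^sup>2"
    using doubling_A doubling_B unfolding T_def by algebra
  also have "\<dots> = l * (m\<^sup>2 * l)"
    by (rule eq_if_multiple_of_char[OF two, of _ _
          "- (A^10) - 3*A^8*B^2 - 4*A^7*B^3 - 6*A^6*B^4 - 7*A^5*B^5 - 7*A^4*B^6 - 6*A^3*B^7 - 4*A^2*B^8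
            - 2*A*B^9"])
      (unfold m_def l_def, unfold C_eq, algebra)
  finally have "E * T ^ 3 * k = m\<^sup>2 * l"
    by (rule mult_left_cancelD) (use cubic_nonzero in \<open>simp add: l_def\<close>)
  then have "E * (m\<^sup>2 * l) = T\<^sup>2 * (E\<^sup>2 * T * k)" by algebra
  then show ?thesis unfolding E_square_mult_k by simp
qed

lemma E_T_equation: "(1 + E\<^sup>2 * T\<^sup>2) ^ 3 * (1 + E\<^sup>2 * T\<^sup>2 + E ^ 4 * T ^ 4)\<^sup>2 = E ^ 11 * T ^ 13"
proof -
  have l: "k + T = l"
    by (rule eq_if_multiple_of_char[OF two, of _ _ "A^2*B - A*B^2"])
      (unfold T_def l_def k_def, unfold C_eq, algebra)
  have m: "k\<^sup>2 + k * T + T\<^sup>2 = m ^ 3"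
    by (rule eq_if_multiple_of_char[OF two, of _ _ "- (2*A^4*B^2) - 4*A^3*B^3 - A^2*B^4 - 2*A*B^5"])
      (unfold T_def m_def k_def, unfold C_eq, algebra)
  have "1 + E\<^sup>2 * T\<^sup>2 = E\<^sup>2 * T * (k + T)"
    using E_square_mult_k by algebra
  then have "1 + E\<^sup>2 * T\<^sup>2 = E\<^sup>2 * T * l" unfolding l .
  moreover have "1 + E\<^sup>2 * T\<^sup>2 + E ^ 4 * T ^ 4 = E ^ 4 * T\<^sup>2 * (k\<^sup>2 + k * T + T\<^sup>2)"
    using E_square_mult_k by algebra
  then have "1 + E\<^sup>2 * T\<^sup>2 + E ^ 4 * T ^ 4 = E ^ 4 * T\<^sup>2 * m ^ 3" unfolding m .
  ultimately have "(1 + E\<^sup>2 * T\<^sup>2) ^ 3 * (1 + E\<^sup>2 * T\<^sup>2 + E ^ 4 * T ^ 4)\<^sup>2 =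
      E ^ 11 * T ^ 7 * (E * (m\<^sup>2 * l)) ^ 3"
    by algebra
  then show ?thesis unfolding E_mult_m_square by algebra
qed

theorem modular_equation:
  assumes "P * T = 1"
  shows "P * E ^ 11 = (P\<^sup>2 + E\<^sup>2) ^ 3 * (P ^ 4 + P\<^sup>2 * E\<^sup>2 + E ^ 4)\<^sup>2"
proof -
  have "P\<^sup>2 + E\<^sup>2 = P\<^sup>2 * (1 + E\<^sup>2 * T\<^sup>2)"
    "P ^ 4 + P\<^sup>2 * E\<^sup>2 + E ^ 4 = P ^ 4 * (1 + E\<^sup>2 * T\<^sup>2 + E ^ 4 * T ^ 4)"
    using assms by algebra+
  then have "(P\<^sup>2 + E\<^sup>2) ^ 3 * (P ^ 4 + P\<^sup>2 * E\<^sup>2 + E ^ 4)\<^sup>2 =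
      P ^ 14 * ((1 + E\<^sup>2 * T\<^sup>2) ^ 3 * (1 + E\<^sup>2 * T\<^sup>2 + E ^ 4 * T ^ 4)\<^sup>2)"
    by algebra
  also have "\<dots> = P * E ^ 11 * (P * T) ^ 13"
    unfolding E_T_equation by algebra
  finally show ?thesis unfolding assms by simp
qed

end

lemma doubling_relation:
  fixes A B C E x y x' y' :: "'a::field"
  assumes "(2 :: 'a) = 0" "A \<noteq> 0" "B \<noteq> 0" "C \<noteq> 0" "E \<noteq> 0"
    and double: "x' * x\<^sup>2 = E * (x ^ 4 + 1)" "y' * y\<^sup>2 = E * (y ^ 4 + 1)"
    and sum: "x + y = A\<^sup>2 / C" "x' + y' = B\<^sup>2 / A" and prod: "x * y = E * A ^ 4 / B"
  shows "E * A ^ 3 * B\<^sup>2 * C\<^sup>2 = A ^ 8 * E\<^sup>2 + B\<^sup>2"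
proof -
  have "(x' + y') * (x * y)\<^sup>2 = (x' * x\<^sup>2) * y\<^sup>2 + (y' * y\<^sup>2) * x\<^sup>2" by algebra
  also have "\<dots> = E * ((x + y)\<^sup>2 * ((x * y)\<^sup>2 + 1))"
    unfolding double
    by (rule eq_if_multiple_of_char[OF assms(1), of _ _ "- (E * (x * y) * ((x * y)\<^sup>2 + 1))"]) algebra
  finally have "B\<^sup>2 / A * (E * A ^ 4 / B)\<^sup>2 = E * ((A\<^sup>2 / C)\<^sup>2 * ((E * A ^ 4 / B)\<^sup>2 + 1))"
    unfolding sum prod .
  then have "A ^ 4 * E * (E * A ^ 3 * B\<^sup>2 * C\<^sup>2) = A ^ 4 * E * (A ^ 8 * E\<^sup>2 + B\<^sup>2)"
    using assms(2-5) by (simp add: field_simps) algebra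
  then show ?thesis by (rule mult_left_cancelD) (use assms in simp)
qed

locale level_13_relations =
  fixes W1 W2 W3 W4 W5 W6 :: "'a::field"
  assumes W_nonzero: "W1 \<noteq> 0" "W2 \<noteq> 0" "W3 \<noteq> 0" "W4 \<noteq> 0" "W5 \<noteq> 0" "W6 \<noteq> 0"
    and three_term:
      "W1 * W2 * W3 * W5 + W1 * W4 * W5 * W6 = W2 * W3 * W4 * W6"
      "W1 ^ 3 * W5 + W1 * W3 ^ 3 = W2 ^ 3 * W4"
      "W1 * W5 ^ 3 + W2 ^ 3 * W5 = W3 ^ 3 * W6"
      "W1 * W2\<^sup>2 * W6 + W1 * W4\<^sup>2 * W5 = W2 * W3\<^sup>2 * W6"
      "W1\<^sup>2 * W2 * W5 + W2 * W4 * W5\<^sup>2 = W3\<^sup>2 * W4 * W6"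
      "W1 ^ 3 * W6 + W2 * W4 ^ 3 = W3 ^ 3 * W5"
      "W1 * W2 ^ 3 + W3 * W6 ^ 3 = W4 * W5 ^ 3"
begin

definition "A = 1 / (W1 * W5)"
definition "B = 1 / (W2 * W3)"
definition "C = 1 / (W4 * W6)"

lemma nonzero: "A \<noteq> 0" "B \<noteq> 0" "C \<noteq> 0"
  using W_nonzero by (auto simp: A_def B_def C_def)

lemma reciprocals: "A * (W1 * W5) = 1" "B * (W2 * W3) = 1" "C * (W4 * W6) = 1"
  using W_nonzero by (auto simp: A_def B_def C_def)

lemma C_eq: "C = A - B"
proof -
  have "C * (A * (W1 * W5)) * (B * (W2 * W3)) + B * (A * (W1 * W5)) * (C * (W4 * W6)) =
      A * (B * (W2 * W3)) * (C * (W4 * W6))"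
    using three_term(1) by algebra
  then show ?thesis unfolding reciprocals by (simp add: algebra_simps)
qed

definition "\<mu> = A\<^sup>2 * B\<^sup>2 * C * (W3 ^ 3 * W5)"
definition "\<nu> = A\<^sup>2 * B\<^sup>2 * C * (W1 * W2 ^ 3)"
definition "S = A ^ 3 - A * B\<^sup>2 + B ^ 3"
definition "N = A ^ 3 * B * C\<^sup>2"

lemma mu_mult_nu: "\<mu> * \<nu> = N"
proof -
  have "\<mu> * \<nu> = N * (A * (W1 * W5)) * (B * (W2 * W3)) ^ 3"
    unfolding \<mu>_def \<nu>_def N_def by algebra
  then show ?thesis unfolding reciprocals by simp
qed

lemma mu_add_nu: "\<mu> + \<nu> = S"
proof -
  have "W1 * W5 * ((W1 * W5) ^ 3 + (W2 * W3) ^ 3 + W1 * W5 * (W3 ^ 3 * W5 + W1 * W2 ^ 3)) =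
      (W1 ^ 3 * W5 + W1 * W3 ^ 3) * (W1 * W5 ^ 3 + W2 ^ 3 * W5)"
    by algebra
  also have "\<dots> = (W2 * W3) ^ 3 * (W4 * W6)"
    unfolding three_term(2,3) by algebra
  finally have "A * B ^ 3 * C * (A * (W1 * W5)) ^ 4 + A ^ 4 * C * (A * (W1 * W5)) * (B * (W2 * W3)) ^ 3 +
      (A * (W1 * W5))\<^sup>2 * A * B * (\<mu> + \<nu>) = A ^ 5 * (B * (W2 * W3)) ^ 3 * (C * (W4 * W6))"
    unfolding \<mu>_def \<nu>_def by algebra
  then have "(A * B) * (\<mu> + \<nu>) = (A * B) * S"
    unfolding reciprocals power_one mult_1_right mult_1 unfolding S_def C_eq by algebra
  then show ?thesis by (rule mult_left_cancelD) (use nonzero in simp)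
qed

abbreviation "D \<equiv> A\<^sup>2 * B\<^sup>2 * C\<^sup>2"
abbreviation "Q \<equiv> A * (A\<^sup>2 - A * B + B\<^sup>2)"

lemma monomials:
  shows "D * (W2 * W4 ^ 3) = - (A * (\<nu> - A\<^sup>2 * C))"
    and "D * (W3 * W6 ^ 3) = A * (\<mu> - A\<^sup>2 * C)"
    and "D * (W1 ^ 3 * W6) = B * (Q - \<mu>)"
    and "D * (W4 * W5 ^ 3) = B * (Q - \<nu>)"
proof -
  have "W1 * W2 ^ 3 * (W4 * W6) + W1 * W5 * (W2 * W4 ^ 3) = (W2 * W3)\<^sup>2 * (W4 * W6)"
    using three_term(4) by algebra
  then have "A * (C * (W4 * W6)) * \<nu> + (A * (W1 * W5)) * (D * (W2 * W4 ^ 3)) =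
      A ^ 3 * C * (B * (W2 * W3))\<^sup>2 * (C * (W4 * W6))"
    unfolding \<nu>_def by algebra
  then show W24: "D * (W2 * W4 ^ 3) = - (A * (\<nu> - A\<^sup>2 * C))"
    unfolding reciprocals power_one mult_1_right mult_1 by algebra
  have "(W1 * W5)\<^sup>2 * (W2 * W3) + W2 * W3 * (W4 * W5 ^ 3) = W4 * W6 * (W3 ^ 3 * W5)"
    using three_term(5) by algebra
  then have "(A * (W1 * W5))\<^sup>2 * (B * (W2 * W3)) * B\<^sup>2 * C\<^sup>2 + (B * (W2 * W3)) * (D * (W4 * W5 ^ 3)) =
      (C * (W4 * W6)) * B * \<mu>"
    unfolding \<mu>_def by algebra
  then have "D * (W4 * W5 ^ 3) = B * (\<mu> - B * C\<^sup>2)"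
    unfolding reciprocals power_one mult_1_right mult_1 by algebra
  also have "\<mu> - B * C\<^sup>2 = Q - \<nu>"
    using mu_add_nu unfolding C_eq S_def by algebra
  finally show W45: "D * (W4 * W5 ^ 3) = B * (Q - \<nu>)" .
  have "D * (W3 * W6 ^ 3) = D * (W4 * W5 ^ 3) - C * \<nu>"
    using three_term(7) unfolding \<nu>_def by algebra
  also have "\<dots> = A * (\<mu> - A\<^sup>2 * C)"
    unfolding W45 using mu_add_nu unfolding C_eq S_def by algebra
  finally show "D * (W3 * W6 ^ 3) = A * (\<mu> - A\<^sup>2 * C)" .
  have "D * (W1 ^ 3 * W6) = C * \<mu> - D * (W2 * W4 ^ 3)"
    using three_term(6) unfolding \<mu>_def by algebra
  also have "\<dots> = B * (Q - \<mu>)"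
    unfolding W24 using mu_add_nu unfolding C_eq S_def by algebra
  finally show "D * (W1 ^ 3 * W6) = B * (Q - \<mu>)" .
qed

definition "\<alpha> = W3 / W1 ^ 9"
definition "\<beta> = W2 / W5 ^ 9"

lemma alpha_eq: "B ^ 5 * C ^ 5 * \<alpha> = A\<^sup>2 * ((Q - \<nu>) ^ 3 * (\<mu> - A\<^sup>2 * C))"
proof -
  have "\<alpha> = A ^ 9 * (W3 * W5 ^ 9)"
    using W_nonzero by (simp add: \<alpha>_def A_def field_simps)
  then have "A ^ 5 * B ^ 3 * C ^ 3 * (B ^ 5 * C ^ 5 * \<alpha>) = A ^ 6 * (D ^ 4 * (W3 * W5 ^ 9) * (C * (W4 * W6)) ^ 3)"
    unfolding reciprocals power_one mult_1_right by algebra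
  also have "\<dots> = A ^ 6 * (C ^ 3 * (D * (W4 * W5 ^ 3)) ^ 3 * (D * (W3 * W6 ^ 3)))"
    by algebra
  also have "\<dots> = A ^ 5 * B ^ 3 * C ^ 3 * (A\<^sup>2 * ((Q - \<nu>) ^ 3 * (\<mu> - A\<^sup>2 * C)))"
    unfolding monomials by algebra
  finally show ?thesis by (rule mult_left_cancelD) (use nonzero in simp)
qed

lemma beta_eq: "B ^ 5 * C ^ 5 * \<beta> = - (A\<^sup>2 * ((Q - \<mu>) ^ 3 * (\<nu> - A\<^sup>2 * C)))"
proof -
  have "\<beta> = A ^ 9 * (W2 * W1 ^ 9)"
    using W_nonzero by (simp add: \<beta>_def A_def field_simps)
  then have "A ^ 5 * B ^ 3 * C ^ 3 * (B ^ 5 * C ^ 5 * \<beta>) = A ^ 6 * (D ^ 4 * (W2 * W1 ^ 9) * (C * (W4 * W6)) ^ 3)"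
    unfolding reciprocals power_one mult_1_right by algebra
  also have "\<dots> = A ^ 6 * (C ^ 3 * (D * (W1 ^ 3 * W6)) ^ 3 * (D * (W2 * W4 ^ 3)))"
    by algebra
  also have "\<dots> = A ^ 5 * B ^ 3 * C ^ 3 * (- (A\<^sup>2 * ((Q - \<mu>) ^ 3 * (\<nu> - A\<^sup>2 * C))))"
    unfolding monomials by algebra
  finally show ?thesis by (rule mult_left_cancelD) (use nonzero in simp)
qed

lemma square_quotients:
  "A\<^sup>2 * B * C * (W2\<^sup>2 / W1 ^ 8) = \<alpha> * \<nu>"
  "A\<^sup>2 * B * C * (W3\<^sup>2 / W5 ^ 8) = \<beta> * \<mu>"
proof -
  have "W2\<^sup>2 / W1 ^ 8 = \<alpha> * (B * (W1 * W2 ^ 3))" "W3\<^sup>2 / W5 ^ 8 = \<beta> * (B * (W3 ^ 3 * W5))"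
    using W_nonzero by (simp_all add: \<alpha>_def \<beta>_def B_def field_simps power2_eq_square power3_eq_cube) algebra+
  then show "A\<^sup>2 * B * C * (W2\<^sup>2 / W1 ^ 8) = \<alpha> * \<nu>" "A\<^sup>2 * B * C * (W3\<^sup>2 / W5 ^ 8) = \<beta> * \<mu>"
    unfolding \<mu>_def \<nu>_def by algebra+
qed

end

text \<open>
  The points \<open>x\<^sub>a\<close> are the abscissae of 13-torsion points on the curve \<open>y\<^sup>2 = x\<^sup>3 + x\<^sup>2 - E\<^sup>4\<close>. In characteristic 3
  their cubes and squares are given by quotients of theta series. The cube of \<open>x\<^sub>1 - x\<^sub>5\<close> determines \<open>E\<close>
  as a rational function of \<open>A\<close>, \<open>B\<close> and \<open>\<mu> - \<nu>\<close>, the squares determine \<open>x\<^sub>1 + x\<^sub>5\<close>, and the cube of the latter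
  yields the second relation needed to eliminate \<open>\<mu> - \<nu>\<close>.
\<close>

locale level_13_char_3 = level_13_relations +
  fixes E x1 x5 :: 'a
  assumes three: "(3 :: 'a) = 0"
    and E_nonzero: "E \<noteq> 0"
    and difference: "x1 - x5 = E * A\<^sup>2 / C"
    and cubes: "x1 ^ 3 = E ^ 4 * (1 + W3 / W1 ^ 9)" "x5 ^ 3 = E ^ 4 * (1 - W2 / W5 ^ 9)"
    and squares: "x1\<^sup>2 = E ^ 3 * (W2\<^sup>2 / W1 ^ 8) - E ^ 4 * (W3 / W1 ^ 9)"
      "x5\<^sup>2 = E ^ 3 * (W3\<^sup>2 / W5 ^ 8) + E ^ 4 * (W2 / W5 ^ 9)"
begin

definition "T = A * B * C"
definition "\<delta> = \<mu> - \<nu>"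
definition "f = A ^ 7 - A ^ 6 * B + A ^ 5 * B\<^sup>2 - A ^ 3 * B ^ 4 - A * B ^ 6 - B ^ 7"
definition "g = A ^ 4 - A * B ^ 3 + B ^ 4"
definition "h = A ^ 7 + A ^ 6 * B + A ^ 5 * B\<^sup>2 + A ^ 4 * B ^ 3 + A * B ^ 6 - B ^ 7"

lemmas cube_add = cube_add_if_3_eq_0[OF three]
lemmas cube_diff = cube_diff_if_3_eq_0[OF three]

lemma alpha_add_beta: "B ^ 5 * C ^ 5 * (\<alpha> + \<beta>) = A ^ 4 * B ^ 3 * (\<delta> * g)"
proof -
  have "B ^ 5 * C ^ 5 * (\<alpha> + \<beta>) =
      A\<^sup>2 * (\<delta> * (Q ^ 3 + \<mu> * \<nu> * (\<mu> + \<nu>) - A\<^sup>2 * C * ((\<mu> + \<nu>)\<^sup>2 - \<mu> * \<nu>)))"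
    using alpha_eq beta_eq unfolding cube_diff \<delta>_def by algebra
  also have "Q ^ 3 + \<mu> * \<nu> * (\<mu> + \<nu>) - A\<^sup>2 * C * ((\<mu> + \<nu>)\<^sup>2 - \<mu> * \<nu>) = A\<^sup>2 * B ^ 3 * g"
    unfolding mu_mult_nu mu_add_nu
    by (rule eq_if_multiple_of_char[OF three, of _ _ "A^7*B^2 - 3*A^6*B^3 + 3*A^5*B^4 - A^4*B^5"])
      (unfold N_def S_def g_def C_eq, algebra)
  finally show ?thesis by algebra
qed

lemma alpha_diff_beta: "B ^ 5 * C ^ 5 * (\<alpha> - \<beta>) = A ^ 4 * B ^ 3 * h"
proof -
  have "B ^ 5 * C ^ 5 * (\<alpha> - \<beta>) = A\<^sup>2 * (Q ^ 3 * (\<mu> + \<nu> - 2 * (A\<^sup>2 * C)) - \<mu> * \<nu> * ((\<mu> + \<nu>)\<^sup>2 - 2 * (\<mu> * \<nu>))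
      + A\<^sup>2 * C * ((\<mu> + \<nu>) ^ 3 - 3 * (\<mu> * \<nu>) * (\<mu> + \<nu>)))"
    using alpha_eq beta_eq unfolding cube_diff by algebra
  also have "Q ^ 3 * (\<mu> + \<nu> - 2 * (A\<^sup>2 * C)) - \<mu> * \<nu> * ((\<mu> + \<nu>)\<^sup>2 - 2 * (\<mu> * \<nu>))
      + A\<^sup>2 * C * ((\<mu> + \<nu>) ^ 3 - 3 * (\<mu> * \<nu>) * (\<mu> + \<nu>)) = A\<^sup>2 * B ^ 3 * h"
    unfolding mu_mult_nu mu_add_nu
    by (rule eq_if_multiple_of_char[OF three, of _ _
          "- (A^10*B^2) + 5*A^9*B^3 - 11*A^8*B^4 + 11*A^7*B^5 - 7*A^6*B^6 + 3*A^5*B^7 - 2*A^4*B^8 + A^3*B^9"])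
      (unfold N_def S_def h_def C_eq, algebra)
  finally show ?thesis by algebra
qed

lemma alpha_nu_diff_beta_mu: "B ^ 5 * C ^ 4 * (\<alpha> * \<nu> - \<beta> * \<mu>) = A ^ 4 * (f * B ^ 4 * C + A ^ 4 * B ^ 6 * C\<^sup>2)"
proof -
  have "(\<mu> - A\<^sup>2 * C) * \<nu> = A\<^sup>2 * C * (T - \<nu>)" "(\<nu> - A\<^sup>2 * C) * \<mu> = A\<^sup>2 * C * (T - \<mu>)"
    using mu_mult_nu unfolding T_def N_def by algebra+
  then have "C * (B ^ 5 * C ^ 4 * (\<alpha> * \<nu> - \<beta> * \<mu>)) = C * (A ^ 4 * (2 * T * Q ^ 3 - Q ^ 3 * (\<mu> + \<nu>)
      - T * ((\<mu> + \<nu>) ^ 3 - 3 * (\<mu> * \<nu>) * (\<mu> + \<nu>))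
      + ((\<mu> + \<nu>) ^ 4 - 4 * (\<mu> + \<nu>)\<^sup>2 * (\<mu> * \<nu>) + 2 * (\<mu> * \<nu>)\<^sup>2)))"
    using alpha_eq beta_eq unfolding cube_diff by algebra
  also have "2 * T * Q ^ 3 - Q ^ 3 * (\<mu> + \<nu>) - T * ((\<mu> + \<nu>) ^ 3 - 3 * (\<mu> * \<nu>) * (\<mu> + \<nu>))
      + ((\<mu> + \<nu>) ^ 4 - 4 * (\<mu> + \<nu>)\<^sup>2 * (\<mu> * \<nu>) + 2 * (\<mu> * \<nu>)\<^sup>2) = f * B ^ 4 * C + A ^ 4 * B ^ 6 * C\<^sup>2"
    unfolding mu_mult_nu mu_add_nu
    by (rule eq_if_multiple_of_char[OF three, of _ _
          "- (A^10*B^2) + 5*A^9*B^3 - 10*A^8*B^4 + 9*A^7*B^5 - 2*A^6*B^6 - 2*A^5*B^7 + A^4*B^8 + A^2*B^10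
            - A*B^11"])
      (unfold N_def S_def T_def f_def C_eq, algebra)
  finally show ?thesis by (rule mult_left_cancelD) (use nonzero in simp)
qed

lemma E_mult_alpha_add_beta: "C ^ 3 * (E * (\<alpha> + \<beta>)) = A ^ 6"
proof -
  have "C * (x1 - x5) = E * A\<^sup>2"
    unfolding difference using nonzero by simp
  then have "E ^ 3 * A ^ 6 = C ^ 3 * (x1 - x5) ^ 3" by algebra
  also have "\<dots> = C ^ 3 * (E ^ 4 * (\<alpha> + \<beta>))"
    unfolding cube_diff cubes \<alpha>_def \<beta>_def by algebra
  finally have "E ^ 3 * (C ^ 3 * (E * (\<alpha> + \<beta>))) = E ^ 3 * A ^ 6" by algebra
  then show ?thesis by (rule mult_left_cancelD) (use E_nonzero in simp)
qed

lemma T_square: "T\<^sup>2 = E * (\<delta> * g)"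
proof -
  have "A ^ 4 * B ^ 3 * T\<^sup>2 = B ^ 5 * C\<^sup>2 * (C ^ 3 * (E * (\<alpha> + \<beta>)))"
    unfolding E_mult_alpha_add_beta T_def by algebra
  also have "\<dots> = A ^ 4 * B ^ 3 * (E * (\<delta> * g))"
    using alpha_add_beta by algebra
  finally show ?thesis by (rule mult_left_cancelD) (use nonzero in simp)
qed

lemma x1_add_x5: "B\<^sup>2 * C ^ 3 * (x1 + x5) = E\<^sup>2 * f"
proof -
  have "C * (x1 - x5) = E * A\<^sup>2"
    unfolding difference using nonzero by simp
  then have "A ^ 4 * B ^ 6 * C ^ 5 * E * (x1 + x5) = A\<^sup>2 * B ^ 6 * C ^ 6 * (x1\<^sup>2 - x5\<^sup>2)" by algebra
  also have "\<dots> = B ^ 5 * C ^ 5 * (E ^ 3 * (A\<^sup>2 * B * C * (W2\<^sup>2 / W1 ^ 8) - A\<^sup>2 * B * C * (W3\<^sup>2 / W5 ^ 8)))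
      - A\<^sup>2 * B ^ 6 * C ^ 3 * E ^ 3 * (C ^ 3 * (E * (\<alpha> + \<beta>)))"
    unfolding squares \<alpha>_def[symmetric] \<beta>_def[symmetric] by algebra
  also have "\<dots> = C * E ^ 3 * (B ^ 5 * C ^ 4 * (\<alpha> * \<nu> - \<beta> * \<mu>)) - A ^ 8 * B ^ 6 * C ^ 3 * E ^ 3"
    unfolding square_quotients E_mult_alpha_add_beta by algebra
  also have "\<dots> = A ^ 4 * B ^ 4 * C\<^sup>2 * E * (E\<^sup>2 * f)"
    unfolding alpha_nu_diff_beta_mu by algebra
  finally have "A ^ 4 * B ^ 4 * C\<^sup>2 * E * (B\<^sup>2 * C ^ 3 * (x1 + x5)) = A ^ 4 * B ^ 4 * C\<^sup>2 * E * (E\<^sup>2 * f)"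
    by algebra
  then show ?thesis by (rule mult_left_cancelD) (use nonzero E_nonzero in simp)
qed

lemma E_square_mult_f_cube: "E\<^sup>2 * f ^ 3 = T ^ 4 * h - B ^ 6 * C ^ 9"
proof -
  have "(x1 + x5) ^ 3 = E ^ 4 * (2 + \<alpha> - \<beta>)"
    unfolding cube_add cubes \<alpha>_def \<beta>_def by algebra
  also have "2 + \<alpha> - \<beta> = \<alpha> - \<beta> - 1"
    by (rule eq_if_multiple_of_char[OF three, of _ _ 1]) simp
  finally have sum: "(x1 + x5) ^ 3 = E ^ 4 * (\<alpha> - \<beta> - 1)" .
  have "E ^ 4 * (E\<^sup>2 * f ^ 3) = (B\<^sup>2 * C ^ 3 * (x1 + x5)) ^ 3"
    unfolding x1_add_x5 by algebra
  also have "\<dots> = E ^ 4 * (B * C ^ 4 * (B ^ 5 * C ^ 5 * (\<alpha> - \<beta>)) - B ^ 6 * C ^ 9)"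
    using sum by algebra
  also have "\<dots> = E ^ 4 * (T ^ 4 * h - B ^ 6 * C ^ 9)"
    unfolding alpha_diff_beta T_def by algebra
  finally show ?thesis by (rule mult_left_cancelD) (use E_nonzero in simp)
qed

lemma E_T_equation: "E\<^sup>2 * T * ((A + B) ^ 3 + T) = - 1"
proof -
  define \<Delta> where "\<Delta> = A ^ 6 - A ^ 5 * B + A ^ 3 * B ^ 3 + A\<^sup>2 * B ^ 4 + A * B ^ 5 + B ^ 6"
  have "\<delta>\<^sup>2 = (\<mu> + \<nu>)\<^sup>2 - 4 * (\<mu> * \<nu>)" unfolding \<delta>_def by algebra
  also have "\<dots> = \<Delta>"
    unfolding mu_mult_nu mu_add_nu
    by (rule eq_if_multiple_of_char[OF three, of _ _ "- (A^5*B) + 2*A^4*B^2 - A^3*B^3 - A*B^5"])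
      (unfold N_def S_def \<Delta>_def C_eq, algebra)
  finally have \<delta>: "\<delta>\<^sup>2 = \<Delta>" .
  have "T ^ 4 = (T\<^sup>2)\<^sup>2" by simp
  then have T4: "T ^ 4 = E\<^sup>2 * (\<Delta> * g\<^sup>2)"
    unfolding T_square power_mult_distrib \<delta> .
  then have "B ^ 6 * C ^ 9 * (\<Delta> * g\<^sup>2) = T ^ 4 * (\<Delta> * g\<^sup>2 * h - f ^ 3)"
    using E_square_mult_f_cube by algebra
  also have "\<Delta> * g\<^sup>2 * h - f ^ 3 = - (T * ((A + B) ^ 3 + T) * B ^ 6 * C ^ 9)"
    by (rule eq_if_multiple_of_char[OF three, of _ _
          "A^20*B - 2*A^19*B^2 + 2*A^18*B^3 + 5*A^15*B^6 - 3*A^14*B^7 - A^13*B^8 + 4*A^12*B^9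
            + 12*A^11*B^10 - 63*A^10*B^11 + 131*A^9*B^12 - 170*A^8*B^13 + 145*A^7*B^14 - 90*A^6*B^15
            + 47*A^5*B^16 - 21*A^4*B^17 + 11*A^3*B^18 - 2*A^2*B^19 + 2*A*B^20"])
      (unfold \<Delta>_def T_def f_def g_def h_def C_eq, algebra)
  finally have "B ^ 6 * C ^ 9 * T ^ 4 * (E\<^sup>2 * T * ((A + B) ^ 3 + T)) = B ^ 6 * C ^ 9 * T ^ 4 * (- 1)"
    using T4 by algebra
  then show ?thesis by (rule mult_left_cancelD) (use nonzero in \<open>simp add: T_def\<close>)
qed

theorem modular_equation:
  defines "V1 \<equiv> W1 * W5" and "V2 \<equiv> W2 * W3" and "V4 \<equiv> W4 * W6"
  shows "((V1 * V2 * V4)\<^sup>2 + E\<^sup>2) * (V1 * V2) ^ 3 = - (E\<^sup>2 * (V1 * V2 * V4) * (V1 + V2) ^ 3)"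
proof -
  have rec: "A * V1 = 1" "B * V2 = 1" "C * V4 = 1"
    using reciprocals by (simp_all add: V1_def V2_def V4_def)
  have "(V1 * V2 * V4) * T = 1" unfolding T_def using rec by algebra
  then have "(V1 * V2 * V4)\<^sup>2 + E\<^sup>2 = - (E\<^sup>2 * (V1 * V2 * V4) * (A + B) ^ 3)"
    using E_T_equation by algebra
  then show ?thesis using rec(1,2) by algebra
qed

end

section \<open>Theta series as Laurent series\<close>

definition dilate :: "nat \<Rightarrow> 'a::comm_ring_1 fps \<Rightarrow> 'a fls" where
  "dilate d f = fps_to_fls (f oo fps_X ^ d)"

lemma dilate_add: "dilate d (f + g) = dilate d f + dilate d g"
  by (simp add: dilate_def fps_compose_add_distrib)

lemma dilate_uminus: "dilate d (- f) = - dilate d f"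
  by (simp add: dilate_def fps_compose_uminus)

lemma dilate_mult: "d > 0 \<Longrightarrow> dilate d (f * g) = dilate d f * dilate d (g :: 'a::idom fps)"
  by (simp add: dilate_def fps_compose_mult_distrib fls_times_fps_to_fls)

lemma dilate_power: "d > 0 \<Longrightarrow> dilate d (f ^ n) = dilate d (f :: 'a::idom fps) ^ n"
  by (simp add: dilate_def fps_to_fls_power flip: fps_compose_power)

lemma dilate_X: "d > 0 \<Longrightarrow> dilate d fps_X = (fls_X :: 'a::idom fls) ^ d"
  by (simp add: dilate_def fps_to_fls_power)

lemma dilate_eq_iff: "d > 0 \<Longrightarrow> dilate d f = dilate d g \<longleftrightarrow> f = g"
  unfolding dilate_def fps_to_fls_eq_iff by (auto dest: fps_compose_X_power_inject)

lemma dilate_eq_0_iff: "d > 0 \<Longrightarrow> dilate d f = 0 \<longleftrightarrow> f = 0"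
  by (simp add: dilate_def fps_compose_X_power_eq_0_iff)

lemmas dilate_hom = dilate_add dilate_uminus dilate_mult dilate_power dilate_X

definition fls_theta :: "nat \<Rightarrow> nat \<Rightarrow> int \<Rightarrow> 'a::comm_ring_1 fls" where
  "fls_theta c M a = fps_to_fls (theta c M a)"

lemma fls_theta_uminus: "fls_theta c M (- a) = - fls_theta c M a"
  by (simp add: fls_theta_def theta_uminus)

lemma fls_theta_add_period: "fls_theta c M (a + int M) = - fls_theta c M a"
  by (simp add: fls_theta_def theta_add_period)

lemma fls_theta_reflect: "fls_theta c M (int M - a) = fls_theta c M a"
  by (simp add: fls_theta_def theta_reflect)

lemma fls_theta_nonzero:
  "c > 0 \<Longrightarrow> M > 0 \<Longrightarrow> \<not> int M dvd a \<Longrightarrow> fls_theta c M a \<noteq> (0 :: 'a::idom fls)"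
  by (simp add: fls_theta_def theta_nonzero)

lemma fls_theta_power_CHAR:
  "(fls_theta c M a :: 'a::prime_field fls) ^ CHAR('a) = fls_theta (CHAR('a) * c) M a"
  by (simp add: fls_theta_def theta_power_CHAR flip: fps_to_fls_power)

lemma fls_theta_rescale_CHAR:
  "(fls_theta c (CHAR('a) * M) (int CHAR('a) * a) :: 'a::prime_field fls) = fls_theta (CHAR('a) * c) M a ^ CHAR('a)"
  by (simp add: fls_theta_def theta_rescale_CHAR flip: fps_to_fls_power)

lemma fls_theta_three_term:
  fixes a b x y :: int
  assumes "c > 0" "M > 0"
  defines "T \<equiv> fls_theta c M :: int \<Rightarrow> 'a::idom fls"
  shows "T (a + b) * T (a - b) * (T (x + y) * T (x - y)) -
    T (a + x) * T (a - x) * (T (b + y) * T (b - y)) +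
    T (a + y) * T (a - y) * (T (b + x) * T (b - x)) = 0"
  using theta_three_term[OF assms(1,2), of a b x y, where 'a = 'a, THEN arg_cong, of fps_to_fls]
  unfolding T_def fls_theta_def
  by (simp only: fls_times_fps_to_fls fps_to_fls_plus fps_to_fls_minus fps_zero_to_fls)

lemma fls_theta_triple_product:
  fixes a c M :: nat
  assumes "0 < a" "a < M" "c > 0"
  shows "fls_theta c M (int a) =
    fls_X ^ (c * nat ((int M - 2 * int a)\<^sup>2)) * (dilate (8 * M * c) (triple_product M a) :: 'a::idom fls)"
  unfolding fls_theta_def dilate_def theta_triple_product[OF assms]
  by (simp add: fls_times_fps_to_fls fps_to_fls_power)

lemma fls_theta_distribution_CHAR:
  fixes c M :: nat and b :: int
  assumes "c > 0" "M > 0" "\<not> int M dvd b"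
  defines "p \<equiv> CHAR('a::prime_field)"
  shows "(\<Prod>i<p. fls_theta c (p * M) (b + int M * int i)) =
    fls_X ^ (c * M\<^sup>2 * (\<Sum>i<p. nat ((int p - 1 - 2 * int i)\<^sup>2))) *
      dilate (8 * (p * M) * c) (euler M) ^ (p * p - 1) * (fls_theta (p * c) M b :: 'a fls)"
proof -
  have prod: "fps_to_fls (prod f S) = (\<Prod>i\<in>S. fps_to_fls (f i))" for f :: "nat \<Rightarrow> 'a fps" and S
    by (induction S rule: infinite_finite_induct) (auto simp: fls_times_fps_to_fls)
  have "(\<Prod>i<p. fls_theta c (p * M) (b + int M * int i)) =
      fps_to_fls (\<Prod>i<p. theta c (p * M) (b + int M * int i) :: 'a fps)"
    unfolding fls_theta_def prod ..
  then show ?thesis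
    unfolding p_def theta_distribution_CHAR[OF assms(1-3)]
    by (simp add: dilate_def fls_theta_def fls_times_fps_to_fls fps_to_fls_power)
qed

section \<open>Torsion points in characteristic 3\<close>

locale theta_char_3 =
  fixes M :: nat and F :: "'a::prime_field itself"
  assumes M_pos: "M > 0" and CHAR_3: "CHAR('a) = 3"
begin

lemma three_eq_0: "(3 :: 'a fls) = 0"
  by (rule numeral_eq_0_if_CHAR) (simp add: CHAR_3)

lemma cube_inject: "x ^ 3 = y ^ 3 \<Longrightarrow> x = y" for x y :: "'a fls"
  by (rule power_CHAR_inject) (simp add: CHAR_3)

lemmas cube_add = cube_add_if_3_eq_0[OF three_eq_0]
lemmas cube_diff = cube_diff_if_3_eq_0[OF three_eq_0]

definition W :: "int \<Rightarrow> 'a fls" where "W = fls_theta 3 M"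
definition \<Theta> :: "int \<Rightarrow> 'a fls" where "\<Theta> = fls_theta 1 (3 * M)"
definition \<eta> :: "'a fls" where "\<eta> = \<Theta> (int M)"

lemma W_nonzero: "\<not> int M dvd a \<Longrightarrow> W a \<noteq> 0"
  unfolding W_def using M_pos by (intro fls_theta_nonzero) simp_all

lemma \<eta>_nonzero: "\<eta> \<noteq> 0"
  unfolding \<eta>_def \<Theta>_def using M_pos by (intro fls_theta_nonzero) (auto simp: zdvd_not_zless)

lemma \<eta>_eq: "\<eta> = fls_X ^ M\<^sup>2 * dilate (24 * M) (euler M)"
proof -
  have "(euler M :: 'a fps) = triple_product (3 * M) M"
    using residue_product_split[of 0 M 3, where 'a = 'a] M_pos
    by (simp add: triple_product_def lessThan_nat_numeral lessThan_Suc mult_ac)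
  then show ?thesis
    using fls_theta_triple_product[of M "3 * M" 1, where 'a = 'a] M_pos
    by (simp add: \<eta>_def \<Theta>_def nat_power_eq)
qed

lemma \<Theta>_cube: "\<Theta> (3 * a) = W a ^ 3"
  using fls_theta_rescale_CHAR[of 1 M a, where 'a = 'a] by (simp add: CHAR_3 \<Theta>_def W_def)

lemma \<Theta>_period:
  "\<Theta> (2 * int M) = \<eta>" "\<Theta> (a + 2 * int M) = - \<Theta> (a - int M)" "\<Theta> (a - 2 * int M) = - \<Theta> (a + int M)"
  using fls_theta_reflect[of 1 "3 * M" "int M", where 'a = 'a]
    fls_theta_add_period[of 1 "3 * M" "a - int M", where 'a = 'a]
    fls_theta_add_period[of 1 "3 * M" "a - 2 * int M", where 'a = 'a]
  by (simp_all add: \<Theta>_def \<eta>_def algebra_simps)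

lemma trisection: "(\<Theta> (3 * a + int M) + \<Theta> (3 * a - int M) - W a ^ 3) ^ 3 = W (3 * a)"
proof -
  have "(theta 1 M (3 * a) :: 'a fps) =
      theta 1 (3 * M) (3 * a + int M) - theta 1 (3 * M) (3 * a) + theta 1 (3 * M) (3 * a - int M)"
    using theta_multisection[of 1 M 3 "int M" "3 * a", where 'a = 'a] M_pos
    by (simp add: lessThan_nat_numeral lessThan_Suc parity_sign_def algebra_simps)
  then have "fls_theta 1 M (3 * a) = \<Theta> (3 * a + int M) + \<Theta> (3 * a - int M) - W a ^ 3"
    unfolding \<Theta>_cube[symmetric] by (simp add: fls_theta_def \<Theta>_def)
  moreover have "(fls_theta 1 M (3 * a) :: 'a fls) ^ 3 = W (3 * a)"
    using fls_theta_power_CHAR[of 1 M "3 * a", where 'a = 'a] by (simp add: CHAR_3 W_def)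
  ultimately show ?thesis by (simp only:)
qed

lemma duplication: "W (2 * a) * \<eta> = W a * (\<Theta> (3 * a + int M) - \<Theta> (3 * a - int M))"
proof (rule cube_inject)
  have "\<Theta> (3 * (2 * a)) * \<Theta> (2 * int M) * (\<eta> * \<eta>) -
      \<Theta> (3 * a + 2 * int M) * \<Theta> (3 * a) * (\<Theta> (3 * a - int M) * \<Theta> (3 * a - int M)) +
      \<Theta> (3 * a + int M) * \<Theta> (3 * a + int M) * (\<Theta> (3 * a) * \<Theta> (3 * a - 2 * int M)) = 0"
    using fls_theta_three_term[of 1 "3 * M" "3 * a + int M" "3 * a - int M" "int M" 0, where 'a = 'a] M_pos
    by (simp add: \<Theta>_def \<eta>_def algebra_simps)
  then show "(W (2 * a) * \<eta>) ^ 3 = (W a * (\<Theta> (3 * a + int M) - \<Theta> (3 * a - int M))) ^ 3"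
    unfolding \<Theta>_period \<Theta>_cube power_mult_distrib cube_diff by algebra
qed

lemma addition:
  fixes a b :: int
  shows "(W (a + b) * W (a - b)) ^ 3 * \<eta>\<^sup>2 =
    \<Theta> (3 * a + int M) * \<Theta> (3 * a - int M) * W b ^ 6 - \<Theta> (3 * b + int M) * \<Theta> (3 * b - int M) * W a ^ 6"
proof -
  have "\<Theta> (3 * (a + b)) * \<Theta> (3 * (a - b)) * (\<eta> * \<eta>) -
      \<Theta> (3 * a + int M) * \<Theta> (3 * a - int M) * (\<Theta> (3 * b) * \<Theta> (3 * b)) +
      \<Theta> (3 * a) * \<Theta> (3 * a) * (\<Theta> (3 * b + int M) * \<Theta> (3 * b - int M)) = 0"
    using fls_theta_three_term[of 1 "3 * M" "3 * a" "3 * b" "int M" 0, where 'a = 'a] M_pos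
    by (simp add: \<Theta>_def \<eta>_def algebra_simps)
  then show ?thesis unfolding \<Theta>_cube by algebra
qed

lemma triplication:
  assumes "\<not> int M dvd 3 * a"
  shows "\<Theta> (3 * a + int M) * \<Theta> (3 * a - int M) * W a ^ 3 = - (W (3 * a) * \<eta> ^ 8)"
proof -
  have "\<not> int M dvd 3 * a - int M"
    using assms dvd_add[of "int M" "3 * a - int M" "int M"] by auto
  then have "(\<Prod>i<3. \<Theta> (3 * a - int M + int M * int i)) =
      fls_X ^ (M\<^sup>2 * 8) * dilate (24 * M) (euler M) ^ 8 * W (3 * a - int M)"
    using fls_theta_distribution_CHAR[of 1 M "3 * a - int M", where 'a = 'a] M_pos
    by (simp add: \<Theta>_def W_def CHAR_3 lessThan_nat_numeral lessThan_Suc)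
  moreover have "(\<Prod>i<3. \<Theta> (3 * a - int M + int M * int i)) = \<Theta> (3 * a - int M) * (\<Theta> (3 * a) * \<Theta> (3 * a + int M))"
    by (simp add: lessThan_nat_numeral lessThan_Suc add.commute[of "int M"])
  moreover have "\<eta> ^ 8 = fls_X ^ (M\<^sup>2 * 8) * dilate (24 * M) (euler M) ^ 8"
    unfolding \<eta>_eq power_mult_distrib power_mult ..
  moreover have "W (3 * a - int M) = - W (3 * a)"
    using fls_theta_add_period[of 3 M "3 * a - int M", where 'a = 'a] by (simp add: W_def)
  ultimately have "\<Theta> (3 * a - int M) * (\<Theta> (3 * a) * \<Theta> (3 * a + int M)) = - (W (3 * a) * \<eta> ^ 8)"
    by simp
  then show ?thesis unfolding \<Theta>_cube by (simp only: mult_ac)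
qed

definition E :: "'a fls" where "E = \<eta> ^ 6"

text \<open>The abscissa, on the Tate curve of modulus \<open>q\<^sup>M\<close> reduced modulo 3, of the point \<open>q\<^sup>a\<close>.\<close>

definition abscissa :: "int \<Rightarrow> 'a fls" where
  "abscissa a = \<eta> ^ 8 * (\<Theta> (3 * a + int M) + \<Theta> (3 * a - int M)) / W a ^ 3"

lemma abscissa_cube:
  assumes "\<not> int M dvd a"
  shows "abscissa a ^ 3 = E ^ 4 * (1 + W (3 * a) / W a ^ 9)"
proof -
  let ?s = "\<Theta> (3 * a + int M) + \<Theta> (3 * a - int M)"
  have "?s ^ 3 = (?s - W a ^ 3) ^ 3 + (W a ^ 3) ^ 3"
    unfolding cube_add[symmetric] by simp
  also have "\<dots> = W (3 * a) + W a ^ 9"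
    unfolding trisection by (simp flip: power_mult)
  finally have s: "?s ^ 3 = W (3 * a) + W a ^ 9" .
  have "abscissa a ^ 3 = E ^ 4 * (?s ^ 3 / W a ^ 9)"
    by (simp add: abscissa_def E_def power_mult_distrib power_divide flip: power_mult)
  then show ?thesis
    unfolding s using W_nonzero[OF assms] by (simp add: add_divide_distrib)
qed

lemma abscissa_square:
  assumes "\<not> int M dvd 3 * a"
  shows "(abscissa a)\<^sup>2 = E ^ 3 * ((W (2 * a))\<^sup>2 / W a ^ 8) - E ^ 4 * (W (3 * a) / W a ^ 9)"
proof -
  let ?p = "\<Theta> (3 * a + int M)" and ?m = "\<Theta> (3 * a - int M)"
  have W: "W a \<noteq> 0" using assms by (intro W_nonzero) auto
  have "W a ^ 3 * (?p + ?m)\<^sup>2 = W a * (W a * (?p - ?m))\<^sup>2 + ?p * ?m * W a ^ 3"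
    by (rule eq_if_multiple_of_char[OF three_eq_0, of _ _ "W a ^ 3 * ?p * ?m"]) algebra
  also have "\<dots> = W a * (W (2 * a) * \<eta>)\<^sup>2 - W (3 * a) * \<eta> ^ 8"
    unfolding duplication triplication[OF assms] by simp
  finally have sum: "W a ^ 3 * (?p + ?m)\<^sup>2 = W a * (W (2 * a) * \<eta>)\<^sup>2 - W (3 * a) * \<eta> ^ 8" .
  have "W a ^ 9 * (abscissa a)\<^sup>2 = \<eta> ^ 16 * (W a ^ 3 * (?p + ?m)\<^sup>2)"
    using W unfolding abscissa_def by (simp add: field_simps) algebra
  also have "\<dots> = W a ^ 9 * (E ^ 3 * ((W (2 * a))\<^sup>2 / W a ^ 8) - E ^ 4 * (W (3 * a) / W a ^ 9))"
    unfolding sum E_def using W by (simp add: field_simps) algebra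
  finally show ?thesis by (rule mult_left_cancelD) (use W in simp)
qed

lemma abscissa_diff:
  fixes a b :: int
  assumes "\<not> int M dvd 3 * a" "\<not> int M dvd 3 * b"
  shows "abscissa a - abscissa b = - (E * (W (a + b) * W (a - b)) / (W a * W b)\<^sup>2)"
proof (rule cube_inject)
  have ndvd: "\<not> int M dvd a" "\<not> int M dvd b" using assms by auto
  note W = W_nonzero[OF ndvd(1)] W_nonzero[OF ndvd(2)]
  have "(W a * W b) ^ 3 * ((W (a + b) * W (a - b)) ^ 3 * \<eta>\<^sup>2) =
      (\<Theta> (3 * a + int M) * \<Theta> (3 * a - int M) * W a ^ 3) * W b ^ 9 -
      (\<Theta> (3 * b + int M) * \<Theta> (3 * b - int M) * W b ^ 3) * W a ^ 9"
    unfolding addition by algebra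
  also have "\<dots> = \<eta> ^ 8 * (W (3 * b) * W a ^ 9 - W (3 * a) * W b ^ 9)"
    unfolding triplication[OF assms(1)] triplication[OF assms(2)] by algebra
  finally have "\<eta>\<^sup>2 * ((W a * W b) ^ 3 * (W (a + b) * W (a - b)) ^ 3) =
      \<eta>\<^sup>2 * (\<eta> ^ 6 * (W (3 * b) * W a ^ 9 - W (3 * a) * W b ^ 9))"
    by algebra
  then have sum: "(W a * W b) ^ 3 * (W (a + b) * W (a - b)) ^ 3 = E * (W (3 * b) * W a ^ 9 - W (3 * a) * W b ^ 9)"
    unfolding E_def by (rule mult_left_cancelD) (use \<eta>_nonzero in simp)
  have "(abscissa a - abscissa b) ^ 3 = E ^ 4 * (W (3 * a) / W a ^ 9 - W (3 * b) / W b ^ 9)"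
    unfolding cube_diff abscissa_cube[OF ndvd(1)] abscissa_cube[OF ndvd(2)] by (simp add: algebra_simps)
  also have "\<dots> = - (E ^ 3 * (E * (W (3 * b) * W a ^ 9 - W (3 * a) * W b ^ 9)) / (W a * W b) ^ 9)"
    using W by (simp add: field_simps power4_eq_xxxx power3_eq_cube)
  also have "(W a * W b) ^ 9 = (W a * W b) ^ 3 * ((W a * W b)\<^sup>2) ^ 3"
    by (simp flip: power_mult power_add)
  also have "- (E ^ 3 * (E * (W (3 * b) * W a ^ 9 - W (3 * a) * W b ^ 9)) / \<dots>) =
      (- (E * (W (a + b) * W (a - b)) / (W a * W b)\<^sup>2)) ^ 3"
    unfolding sum[symmetric] using W by (simp add: power_divide power_mult_distrib)
  finally show "(abscissa a - abscissa b) ^ 3 = (- (E * (W (a + b) * W (a - b)) / (W a * W b)\<^sup>2)) ^ 3" .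
qed

end

section \<open>Torsion points in characteristic 2\<close>

locale theta_char_2 =
  fixes M :: nat and F :: "'a::prime_field itself"
  assumes M_pos: "M > 0" and CHAR_2: "CHAR('a) = 2"
begin

lemma two_eq_0: "(2 :: 'a fls) = 0"
  by (rule numeral_eq_0_if_CHAR) (simp add: CHAR_2)

lemma uminus_eq: "- x = x" for x :: "'a fls"
  by (rule uminus_CHAR_2) (simp add: CHAR_2)

lemma square_inject: "x\<^sup>2 = y\<^sup>2 \<Longrightarrow> x = y" for x y :: "'a fls"
  by (rule power_CHAR_inject) (simp add: CHAR_2)

lemma square_add: "(x + y)\<^sup>2 = x\<^sup>2 + y\<^sup>2" for x y :: "'a fls"
  by (rule freshmans_dream) (simp_all add: CHAR_2)

definition W :: "int \<Rightarrow> 'a fls" where "W = fls_theta 2 M"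
definition \<Theta> :: "int \<Rightarrow> 'a fls" where "\<Theta> = fls_theta 1 (2 * M)"
definition H :: "'a fls" where "H = fls_X ^ (M\<^sup>2 * 2) * dilate (16 * M) (euler M) ^ 3"

lemma W_nonzero: "\<not> int M dvd a \<Longrightarrow> W a \<noteq> 0"
  unfolding W_def using M_pos by (intro fls_theta_nonzero) simp_all

lemma W_reflect: "W (int M - a) = W a"
  by (simp add: W_def fls_theta_reflect)

lemma H_nonzero: "H \<noteq> 0"
  using M_pos by (simp add: H_def dilate_eq_0_iff)

lemma \<Theta>_square: "\<Theta> (2 * a) = (W a)\<^sup>2"
  using fls_theta_rescale_CHAR[of 1 M a, where 'a = 'a] by (simp add: CHAR_2 \<Theta>_def W_def)

lemma \<Theta>_half_period: "\<Theta> (int M) = 1"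
proof -
  have "(euler M :: 'a fps)\<^sup>2 = euler (2 * M)"
    using euler_power_CHAR[of M, where 'a = 'a] by (simp add: CHAR_2)
  moreover have "(euler M :: 'a fps) = euler (2 * M) * residue_product (2 * M) M"
    using residue_product_split[of 0 M 2, where 'a = 'a] M_pos
    by (simp add: lessThan_nat_numeral lessThan_Suc mult.commute)
  ultimately have "euler (2 * M) * triple_product (2 * M) M = (euler (2 * M) :: 'a fps) * 1"
    by (simp add: triple_product_def power2_eq_square mult_ac)
  then have "triple_product (2 * M) M = (1 :: 'a fps)"
    by (rule mult_left_cancelD) simp
  then show ?thesis
    using fls_theta_triple_product[of M "2 * M" 1, where 'a = 'a] M_pos by (simp add: \<Theta>_def dilate_def)
qed

lemma \<Theta>_add_period: "\<Theta> (a + 2 * int M) = \<Theta> a"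
  using fls_theta_add_period[of 1 "2 * M" a, where 'a = 'a] by (simp add: \<Theta>_def uminus_eq)

lemma addition:
  fixes a b :: int
  shows "W (a + b) * W (a - b) = \<Theta> (2 * a + int M) * (W b)\<^sup>2 + \<Theta> (2 * b + int M) * (W a)\<^sup>2"
proof (rule square_inject)
  have shift: "\<Theta> (2 * x - int M) = \<Theta> (2 * x + int M)" for x
    using \<Theta>_add_period[of "2 * x - int M"] by (simp add: algebra_simps)
  have "\<Theta> (2 * (a + b)) * \<Theta> (2 * (a - b)) * (\<Theta> (int M) * \<Theta> (int M)) -
      \<Theta> (2 * a + int M) * \<Theta> (2 * a - int M) * (\<Theta> (2 * b) * \<Theta> (2 * b)) +
      \<Theta> (2 * a) * \<Theta> (2 * a) * (\<Theta> (2 * b + int M) * \<Theta> (2 * b - int M)) = 0"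
    using fls_theta_three_term[of 1 "2 * M" "2 * a" "2 * b" "int M" 0, where 'a = 'a] M_pos
    by (simp add: \<Theta>_def algebra_simps)
  then have "(W (a + b) * W (a - b))\<^sup>2 =
      (\<Theta> (2 * a + int M) * (W b)\<^sup>2)\<^sup>2 + - (\<Theta> (2 * b + int M) * (W a)\<^sup>2)\<^sup>2"
    unfolding \<Theta>_square \<Theta>_half_period shift by algebra
  then show "(W (a + b) * W (a - b))\<^sup>2 = (\<Theta> (2 * a + int M) * (W b)\<^sup>2 + \<Theta> (2 * b + int M) * (W a)\<^sup>2)\<^sup>2"
    unfolding square_add uminus_eq .
qed

definition E :: "'a fls" where "E = H\<^sup>2"

text \<open>The abscissa, on the Tate curve of modulus \<open>q\<^sup>M\<close> reduced modulo 2, of the point \<open>q\<^sup>a\<close>.\<close>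

definition abscissa :: "int \<Rightarrow> 'a fls" where
  "abscissa a = \<Theta> (2 * a + int M) / (W a)\<^sup>2"

lemma abscissa_reflect: "abscissa (int M - a) = abscissa a"
proof -
  have "\<Theta> (2 * (int M - a) + int M) = \<Theta> (int (2 * M) - (2 * a - int M))"
    by (rule arg_cong[of _ _ \<Theta>]) simp
  also have "\<dots> = \<Theta> (2 * a - int M)"
    unfolding \<Theta>_def by (rule fls_theta_reflect)
  also have "\<dots> = \<Theta> (2 * a + int M)"
    using \<Theta>_add_period[of "2 * a - int M"] by (simp add: algebra_simps)
  finally show ?thesis by (simp add: abscissa_def W_reflect)
qed

lemma abscissa_add:
  fixes a b :: int
  assumes "\<not> int M dvd a" "\<not> int M dvd b"
  shows "abscissa a + abscissa b = W (a + b) * W (a - b) / (W a * W b)\<^sup>2"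
  unfolding addition abscissa_def
  using W_nonzero[OF assms(1)] W_nonzero[OF assms(2)] by (simp add: field_simps)

lemma H_mult_W_double:
  assumes "\<not> int M dvd 2 * a"
  shows "H * W (2 * a) = W a ^ 4 * abscissa a"
proof -
  have "(\<Prod>i<2. fls_theta 1 (2 * M) (2 * a + int M * int i)) = H * W (2 * a)"
    using fls_theta_distribution_CHAR[of 1 M "2 * a", where 'a = 'a] M_pos assms
    by (simp add: CHAR_2 H_def W_def lessThan_nat_numeral lessThan_Suc mult_2_right)
  moreover have "(\<Prod>i<2. fls_theta 1 (2 * M) (2 * a + int M * int i)) = \<Theta> (2 * a) * \<Theta> (2 * a + int M)"
    by (simp add: \<Theta>_def lessThan_nat_numeral lessThan_Suc)
  moreover have "W a \<noteq> 0" using assms by (intro W_nonzero) auto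
  ultimately show ?thesis
    unfolding \<Theta>_square abscissa_def by (simp add: field_simps)
qed

lemma \<Theta>_double: "\<Theta> (4 * a + int M) = \<Theta> (2 * a + int M) ^ 4 + W a ^ 8"
proof -
  have square: "(fls_theta c N r :: 'a fls)\<^sup>2 = fls_theta (2 * c) N r" for c N r
    using fls_theta_power_CHAR[of c N r, where 'a = 'a] by (simp add: CHAR_2)
  have rescale: "fls_theta c (2 * N) (2 * r) = (fls_theta c N r :: 'a fls) ^ 4" for c N r
    using fls_theta_rescale_CHAR[of c N r, where 'a = 'a]
    unfolding CHAR_2 square[symmetric] by (simp flip: power_mult)
  have "(2 :: 'a) = 0" by (rule numeral_eq_0_if_CHAR) (rule CHAR_2)
  then have "(theta 1 (2 * M) (4 * a + int M) :: 'a fps) =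
      theta 1 (4 * M) (4 * a + 2 * int M) - theta 1 (4 * M) (4 * a)"
    using theta_multisection[of 1 "2 * M" 2 "int M" "4 * a + int M", where 'a = 'a] M_pos
    by (simp add: lessThan_nat_numeral lessThan_Suc parity_sign_def add.commute[of "4 * a"])
  then have "\<Theta> (4 * a + int M) = fls_theta 1 (4 * M) (4 * a + 2 * int M) + - fls_theta 1 (4 * M) (4 * a)"
    by (simp add: \<Theta>_def fls_theta_def)
  also have "fls_theta 1 (4 * M) (4 * a + 2 * int M) = \<Theta> (2 * a + int M) ^ 4"
    using rescale[of 1 "2 * M" "2 * a + int M"] by (simp add: \<Theta>_def)
  also have "fls_theta 1 (4 * M) (4 * a) = ((W a)\<^sup>2) ^ 4"
    using rescale[of 1 "2 * M" "2 * a"] by (simp add: \<Theta>_square[symmetric] \<Theta>_def)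
  finally show ?thesis unfolding uminus_eq by (simp flip: power_mult)
qed

lemma abscissa_double:
  assumes "\<not> int M dvd 2 * a"
  shows "abscissa (2 * a) * (abscissa a)\<^sup>2 = E * (abscissa a ^ 4 + 1)"
proof -
  have "\<not> int M dvd a" using assms by auto
  then have W: "W a \<noteq> 0" "W (2 * a) \<noteq> 0" using assms by (simp_all add: W_nonzero)
  have "W a ^ 8 * (abscissa (2 * a) * (abscissa a)\<^sup>2) = abscissa (2 * a) * (H * W (2 * a))\<^sup>2"
    unfolding H_mult_W_double[OF assms] by algebra
  also have "\<dots> = E * (\<Theta> (2 * a + int M) ^ 4 + W a ^ 8)"
    using W \<Theta>_double[of a] by (simp add: abscissa_def E_def power_mult_distrib)
  also have "\<dots> = W a ^ 8 * (E * (abscissa a ^ 4 + 1))"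
    using W unfolding abscissa_def by (simp add: field_simps)
  finally show ?thesis by (rule mult_left_cancelD) (use W in simp)
qed

end

section \<open>The modular equations of level 13\<close>

lemma fls_theta_13_relations:
  fixes c :: nat
  assumes "c > 0"
  defines "T \<equiv> fls_theta c 13 :: int \<Rightarrow> 'a::idom fls"
  shows "T 1 * T 2 * T 3 * T 5 + T 1 * T 4 * T 5 * T 6 = T 2 * T 3 * T 4 * T 6"
    and "T 1 ^ 3 * T 5 + T 1 * T 3 ^ 3 = T 2 ^ 3 * T 4"
    and "T 1 * T 5 ^ 3 + T 2 ^ 3 * T 5 = T 3 ^ 3 * T 6"
    and "T 1 * (T 2)\<^sup>2 * T 6 + T 1 * (T 4)\<^sup>2 * T 5 = T 2 * (T 3)\<^sup>2 * T 6"
    and "(T 1)\<^sup>2 * T 2 * T 5 + T 2 * T 4 * (T 5)\<^sup>2 = (T 3)\<^sup>2 * T 4 * T 6"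
    and "T 1 ^ 3 * T 6 + T 2 * T 4 ^ 3 = T 3 ^ 3 * T 5"
    and "T 1 * T 2 ^ 3 + T 3 * T 6 ^ 3 = T 4 * T 5 ^ 3"
proof -
  have rel: "T (a + b) * T (a - b) * (T (x + y) * T (x - y)) - T (a + x) * T (a - x) * (T (b + y) * T (b - y)) +
      T (a + y) * T (a - y) * (T (b + x) * T (b - x)) = 0" for a b x y
    unfolding T_def using assms(1) by (intro fls_theta_three_term) simp_all
  have "T 7 = T 6" "T 8 = T 5" "T 11 = T 2"
    using fls_theta_reflect[of c 13 6, where 'a = 'a] fls_theta_reflect[of c 13 5, where 'a = 'a]
      fls_theta_reflect[of c 13 2, where 'a = 'a]
    by (simp_all add: T_def)
  note arith = arith_simps arith_special numeral_One this
  show "T 1 * T 2 * T 3 * T 5 + T 1 * T 4 * T 5 * T 6 = T 2 * T 3 * T 4 * T 6"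
    using rel[of 5 3 2 1] by (simp only: arith) algebra
  show "T 1 ^ 3 * T 5 + T 1 * T 3 ^ 3 = T 2 ^ 3 * T 4"
    using rel[of 3 2 1 0] by (simp only: arith) algebra
  show "T 1 * T 5 ^ 3 + T 2 ^ 3 * T 5 = T 3 ^ 3 * T 6"
    using rel[of 5 3 2 0] by (simp only: arith) algebra
  show "T 1 * (T 2)\<^sup>2 * T 6 + T 1 * (T 4)\<^sup>2 * T 5 = T 2 * (T 3)\<^sup>2 * T 6"
    using rel[of 4 3 2 0] by (simp only: arith) algebra
  show "(T 1)\<^sup>2 * T 2 * T 5 + T 2 * T 4 * (T 5)\<^sup>2 = (T 3)\<^sup>2 * T 4 * T 6"
    using rel[of 5 3 1 0] by (simp only: arith) algebra
  show "T 1 ^ 3 * T 6 + T 2 * T 4 ^ 3 = T 3 ^ 3 * T 5"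
    using rel[of 4 3 1 0] by (simp only: arith) algebra
  show "T 1 * T 2 ^ 3 + T 3 * T 6 ^ 3 = T 4 * T 5 ^ 3"
    using rel[of 6 5 2 0] by (simp only: arith) algebra
qed

lemma prod_triple_product_13:
  "triple_product 13 1 * triple_product 13 5 * (triple_product 13 2 * triple_product 13 3) *
    (triple_product 13 4 * triple_product 13 6) = (euler 1 * euler 13 ^ 5 :: 'a::comm_ring_1 fps)"
proof -
  have "(euler 1 :: 'a fps) = (\<Prod>a<13. residue_product 13 a)"
    using residue_product_split[of 0 1 13, where 'a = 'a] by simp
  then show ?thesis
    by (simp add: triple_product_def lessThan_nat_numeral lessThan_Suc power_numeral_reduce mult_ac)
qed

lemma fls_theta_13_products:
  fixes c :: nat
  assumes "c > 0" and z_def: "z = (fls_X ^ (26 * c) :: 'a::idom fls)" and \<phi>_def: "\<phi> = dilate (104 * c)"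
  defines "T \<equiv> fls_theta c 13"
  shows "T 1 * T 5 = z ^ 5 * \<phi> (triple_product 13 1 * triple_product 13 5)"
    and "T 2 * T 3 = z ^ 5 * \<phi> (triple_product 13 2 * triple_product 13 3)"
    and "T 1 * T 5 * (T 2 * T 3) * (T 4 * T 6) = z ^ 11 * \<phi> (euler 1 * euler 13 ^ 5)"
proof -
  have T: "T 1 = fls_X ^ (121 * c) * \<phi> (triple_product 13 1)" "T 2 = fls_X ^ (81 * c) * \<phi> (triple_product 13 2)"
    "T 3 = fls_X ^ (49 * c) * \<phi> (triple_product 13 3)" "T 4 = fls_X ^ (25 * c) * \<phi> (triple_product 13 4)"
    "T 5 = fls_X ^ (9 * c) * \<phi> (triple_product 13 5)" "T 6 = fls_X ^ c * \<phi> (triple_product 13 6)"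
    using fls_theta_triple_product[where 'a = 'a and M = 13 and c = c, of 1]
      fls_theta_triple_product[where 'a = 'a and M = 13 and c = c, of 2]
      fls_theta_triple_product[where 'a = 'a and M = 13 and c = c, of 3]
      fls_theta_triple_product[where 'a = 'a and M = 13 and c = c, of 4]
      fls_theta_triple_product[where 'a = 'a and M = 13 and c = c, of 5]
      fls_theta_triple_product[where 'a = 'a and M = 13 and c = c, of 6] assms(1)
    by (simp_all add: T_def \<phi>_def mult.commute)
  have \<phi>: "\<phi> (f * g) = \<phi> f * \<phi> g" for f g
    unfolding \<phi>_def using assms(1) by (simp add: dilate_mult)
  have X: "fls_X ^ (121 * c) * fls_X ^ (9 * c) = z ^ 5" "fls_X ^ (81 * c) * fls_X ^ (49 * c) = z ^ 5"
    "fls_X ^ (25 * c) * fls_X ^ c = z"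
    by (simp_all add: z_def flip: power_add power_mult)
  show T15: "T 1 * T 5 = z ^ 5 * \<phi> (triple_product 13 1 * triple_product 13 5)"
    unfolding T \<phi> X(1)[symmetric] by (simp only: mult_ac)
  show T23: "T 2 * T 3 = z ^ 5 * \<phi> (triple_product 13 2 * triple_product 13 3)"
    unfolding T \<phi> X(2)[symmetric] by (simp only: mult_ac)
  have "T 4 * T 6 = z * \<phi> (triple_product 13 4 * triple_product 13 6)"
    unfolding T \<phi> X(3)[symmetric] by (simp only: mult_ac)
  then show "T 1 * T 5 * (T 2 * T 3) * (T 4 * T 6) = z ^ 11 * \<phi> (euler 1 * euler 13 ^ 5)"
    unfolding T15 T23 prod_triple_product_13[symmetric] \<phi> by algebra
qed

locale theta_13_char_3 = theta_char_3 13 F for F :: "'a::prime_field itself"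
begin

lemma W_values: "W 10 = W 3" "W 15 = - W 2" "W (- 4) = - W 4"
  using fls_theta_reflect[of 3 13 3, where 'a = 'a] fls_theta_add_period[of 3 13 2, where 'a = 'a]
    fls_theta_uminus[of 3 13 4, where 'a = 'a]
  by (simp_all add: W_def)

sublocale level_13_relations "W 1" "W 2" "W 3" "W 4" "W 5" "W 6"
proof
  show "W 1 \<noteq> 0" "W 2 \<noteq> 0" "W 3 \<noteq> 0" "W 4 \<noteq> 0" "W 5 \<noteq> 0" "W 6 \<noteq> 0"
    by (simp_all add: W_nonzero)
qed (unfold W_def, (rule fls_theta_13_relations[OF zero_less_numeral])+)

sublocale level_13_char_3 "W 1" "W 2" "W 3" "W 4" "W 5" "W 6" E "abscissa 1" "abscissa 5"
proof
  show "(3 :: 'a fls) = 0" by (rule three_eq_0)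
  show "E \<noteq> 0" using \<eta>_nonzero by (simp add: E_def)
  show "abscissa 1 - abscissa 5 = E * A\<^sup>2 / C"
    using abscissa_diff[of 1 5] by (simp add: W_values A_def C_def power_divide mult_ac)
  show "abscissa 1 ^ 3 = E ^ 4 * (1 + W 3 / W 1 ^ 9)" "abscissa 5 ^ 3 = E ^ 4 * (1 - W 2 / W 5 ^ 9)"
    using abscissa_cube[of 1] abscissa_cube[of 5] by (simp_all add: W_values)
  show "(abscissa 1)\<^sup>2 = E ^ 3 * ((W 2)\<^sup>2 / W 1 ^ 8) - E ^ 4 * (W 3 / W 1 ^ 9)"
    "(abscissa 5)\<^sup>2 = E ^ 3 * ((W 3)\<^sup>2 / W 5 ^ 8) + E ^ 4 * (W 2 / W 5 ^ 9)"
    using abscissa_square[of 1] abscissa_square[of 5] by (simp_all add: W_values)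
qed

lemma E_eq: "E = (fls_X ^ (26 * 3)) ^ 13 * dilate (104 * 3) (euler 13) ^ 6"
  by (simp add: E_def \<eta>_eq power_mult_distrib flip: power_mult)

end

theorem modular_equation_mod_3:
  assumes "CHAR('a::prime_field) = 3"
  obtains Y :: "'a::prime_field fps"
    where "(euler 1)\<^sup>2 + fps_X * (euler 13)\<^sup>2 = euler 1 * euler 13 * Y ^ 3"
proof -
  interpret theta_13_char_3 "TYPE('a)"
    by unfold_locales (use assms in simp_all)
  define \<phi> where "\<phi> = (dilate (104 * 3) :: 'a fps \<Rightarrow> 'a fls)"
  define z where "z = (fls_X ^ (26 * 3) :: 'a fls)"
  define u v :: "'a fps"
    where "u = triple_product 13 1 * triple_product 13 5" and "v = triple_product 13 2 * triple_product 13 3"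
  let ?L = "((euler 1)\<^sup>2 + fps_X * (euler 13)\<^sup>2) * (u * v) ^ 3"
    and ?R = "- (euler 1 * euler 13 ^ 7 * (u + v) ^ 3)"
  have hom: "\<phi> (f + g) = \<phi> f + \<phi> g" "\<phi> (f * g) = \<phi> f * \<phi> g" "\<phi> (f ^ n) = \<phi> f ^ n"
    "\<phi> (- f) = - \<phi> f" "\<phi> fps_X = z ^ 4" for f g n
    by (simp_all add: \<phi>_def z_def dilate_hom flip: power_mult)
  note products = fls_theta_13_products[OF zero_less_numeral z_def \<phi>_def, folded W_def u_def v_def]
  have "z ^ 52 * \<phi> (euler 13) ^ 10 * \<phi> ?L = z ^ 52 * \<phi> (euler 13) ^ 10 * \<phi> ?R"
    using modular_equation[unfolded E_eq, folded \<phi>_def z_def]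
    unfolding products(3) unfolding products(1,2) hom by algebra
  moreover have "z ^ 52 * \<phi> (euler 13) ^ 10 \<noteq> 0"
    by (simp add: z_def \<phi>_def dilate_eq_0_iff)
  ultimately have "\<phi> ?L = \<phi> ?R"
    by (rule mult_left_cancelD)
  then have L: "?L = ?R"
    by (simp add: \<phi>_def dilate_eq_iff)
  have unit: "inverse (u * v) * (u * v) = 1"
    by (rule inverse_mult_eq_1) (simp add: u_def v_def)
  have "(euler 1)\<^sup>2 + fps_X * (euler 13)\<^sup>2 =
      ((euler 1)\<^sup>2 + fps_X * (euler 13)\<^sup>2) * (inverse (u * v) * (u * v)) ^ 3"
    unfolding unit by simp
  also have "\<dots> = ?L * inverse (u * v) ^ 3"
    by (simp only: power_mult_distrib mult_ac)
  also have "\<dots> = euler 1 * euler 13 * (- ((euler 13)\<^sup>2 * (u + v) * inverse (u * v))) ^ 3"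
    unfolding L by algebra
  finally show ?thesis by (rule that)
qed

locale theta_13_char_2 = theta_char_2 13 F for F :: "'a::prime_field itself"
begin

definition "A = 1 / (W 1 * W 5)"
definition "B = 1 / (W 2 * W 3)"
definition "C = 1 / (W 4 * W 6)"

lemma W_values: "W 8 = W 5" "W 10 = W 3" "W (- a) = W a"
  using W_reflect[of 5] W_reflect[of 3] by (simp_all add: W_def fls_theta_uminus uminus_eq)

lemma W_13_nonzero: "W 1 \<noteq> 0" "W 2 \<noteq> 0" "W 3 \<noteq> 0" "W 4 \<noteq> 0" "W 5 \<noteq> 0" "W 6 \<noteq> 0"
  by (simp_all add: W_nonzero)

lemma nonzero: "A \<noteq> 0" "B \<noteq> 0" "C \<noteq> 0" "E \<noteq> 0"
  using W_13_nonzero H_nonzero by (simp_all add: A_def B_def C_def E_def)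

lemma C_eq: "C = A - B"
  using fls_theta_13_relations(1)[of 2, where 'a = 'a, folded W_def] W_13_nonzero
  by (simp add: A_def B_def C_def field_simps)

lemma abscissa_sums:
  "abscissa 1 + abscissa 5 = A\<^sup>2 / C" "abscissa 2 + abscissa 3 = B\<^sup>2 / A" "abscissa 4 + abscissa 6 = C\<^sup>2 / B"
  using abscissa_add[of 1 5] abscissa_add[of 2 3] abscissa_add[of 4 6]
  by (simp_all add: W_values A_def B_def C_def power_divide mult.commute)

lemma abscissa_products: "abscissa 1 * abscissa 5 = E * A ^ 4 / B" "abscissa 2 * abscissa 3 = E * B ^ 4 / C"
proof -
  have "abscissa a = H * W (2 * a) / W a ^ 4" if "\<not> 13 dvd a" "\<not> 13 dvd 2 * a" for a
    using H_mult_W_double[of a] W_nonzero[of a] that by (simp add: field_simps)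
  from this[of 1] this[of 2] this[of 3] this[of 5]
  show "abscissa 1 * abscissa 5 = E * A ^ 4 / B" "abscissa 2 * abscissa 3 = E * B ^ 4 / C"
    by (simp_all add: W_values A_def B_def C_def E_def power2_eq_square power_mult_distrib power_divide mult_ac)
qed

lemma abscissa_doubles:
  "abscissa 2 * (abscissa 1)\<^sup>2 = E * (abscissa 1 ^ 4 + 1)"
  "abscissa 3 * (abscissa 5)\<^sup>2 = E * (abscissa 5 ^ 4 + 1)"
  "abscissa 4 * (abscissa 2)\<^sup>2 = E * (abscissa 2 ^ 4 + 1)"
  "abscissa 6 * (abscissa 3)\<^sup>2 = E * (abscissa 3 ^ 4 + 1)"
  using abscissa_double[of 1] abscissa_double[of 5] abscissa_double[of 2] abscissa_double[of 3]
    abscissa_reflect[of 3]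
  by simp_all

lemma doubling_A: "E * A ^ 3 * B\<^sup>2 * C\<^sup>2 = A ^ 8 * E\<^sup>2 + B\<^sup>2"
  using two_eq_0 nonzero abscissa_doubles(1,2) abscissa_sums(1,2) abscissa_products(1)
  by (rule doubling_relation)

lemma doubling_B: "E * B ^ 3 * C\<^sup>2 * A\<^sup>2 = B ^ 8 * E\<^sup>2 + C\<^sup>2"
  using two_eq_0 nonzero(2,3,1,4) abscissa_doubles(3,4) abscissa_sums(2,3) abscissa_products(2)
  by (rule doubling_relation)

lemma E_eq: "E = (fls_X ^ (26 * 2)) ^ 13 * dilate (104 * 2) (euler 13) ^ 6"
  by (simp add: E_def H_def power_mult_distrib flip: power_mult)

text \<open>This holds because the left-hand side has an odd leading coefficient.\<close>

lemma nondegenerate: "A ^ 3 + A * B\<^sup>2 + B ^ 3 \<noteq> 0"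
proof -
  define \<phi> where "\<phi> = (dilate (104 * 2) :: 'a fps \<Rightarrow> 'a fls)"
  define z where "z = (fls_X ^ (26 * 2) :: 'a fls)"
  define u v :: "'a fps"
    where "u = triple_product 13 1 * triple_product 13 5" and "v = triple_product 13 2 * triple_product 13 3"
  note products = fls_theta_13_products[OF zero_less_numeral z_def \<phi>_def, folded W_def u_def v_def]
  have "(v ^ 3 + u\<^sup>2 * v + u ^ 3) $ 0 = 1 + 2"
    by (simp add: u_def v_def fps_nth_power_0)
  also have "\<dots> = (1 :: 'a)"
    using numeral_eq_0_if_CHAR[OF CHAR_2] by simp
  finally have leading: "v ^ 3 + u\<^sup>2 * v + u ^ 3 \<noteq> 0"
    by (metis fps_zero_nth zero_neq_one)
  have "(A ^ 3 + A * B\<^sup>2 + B ^ 3) * (W 1 * W 5 * (W 2 * W 3)) ^ 3 =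
      (W 2 * W 3) ^ 3 + (W 1 * W 5)\<^sup>2 * (W 2 * W 3) + (W 1 * W 5) ^ 3"
    using W_13_nonzero by (simp add: A_def B_def field_simps power2_eq_square power3_eq_cube)
  also have "\<dots> = z ^ 15 * \<phi> (v ^ 3 + u\<^sup>2 * v + u ^ 3)"
    unfolding products(1,2) by (simp add: \<phi>_def dilate_hom) algebra
  finally show ?thesis
    using leading by (auto simp: z_def \<phi>_def dilate_eq_0_iff)
qed

sublocale level_13_char_2 A B C E
  by unfold_locales (fact two_eq_0 nonzero C_eq doubling_A doubling_B nondegenerate)+

lemma product_mult_T: "W 1 * W 5 * (W 2 * W 3) * (W 4 * W 6) * T = 1"
  unfolding T_def using W_13_nonzero by (simp add: A_def B_def C_def)

end

theorem modular_equation_mod_2: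
  assumes "CHAR('a::prime_field) = 2"
  shows "(euler 1 * euler 13 :: 'a fps) =
    ((euler 1)\<^sup>2 + fps_X * (euler 13)\<^sup>2) ^ 3 *
    (euler 1 ^ 4 + fps_X * (euler 1)\<^sup>2 * (euler 13)\<^sup>2 + fps_X\<^sup>2 * euler 13 ^ 4)\<^sup>2" (is "?L = ?R")
proof -
  interpret theta_13_char_2 "TYPE('a)"
    by unfold_locales (use assms in simp_all)
  define \<phi> where "\<phi> = (dilate (104 * 2) :: 'a fps \<Rightarrow> 'a fls)"
  define z where "z = (fls_X ^ (26 * 2) :: 'a fls)"
  have hom: "\<phi> (f + g) = \<phi> f + \<phi> g" "\<phi> (f * g) = \<phi> f * \<phi> g" "\<phi> (f ^ n) = \<phi> f ^ n"
    "\<phi> fps_X = z ^ 4" for f g n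
    by (simp_all add: \<phi>_def z_def dilate_hom flip: power_mult)
  have "z ^ 154 * \<phi> (euler 13) ^ 70 * \<phi> ?L = z ^ 154 * \<phi> (euler 13) ^ 70 * \<phi> ?R"
    using modular_equation[OF product_mult_T, unfolded E_eq, folded \<phi>_def z_def]
    unfolding fls_theta_13_products(3)[OF zero_less_numeral z_def \<phi>_def, folded W_def] hom by algebra
  moreover have "z ^ 154 * \<phi> (euler 13) ^ 70 \<noteq> 0"
    by (simp add: z_def \<phi>_def dilate_eq_0_iff)
  ultimately have "\<phi> ?L = \<phi> ?R"
    by (rule mult_left_cancelD)
  then show ?thesis
    by (simp add: \<phi>_def dilate_eq_iff)
qed

section \<open>Partition generating functions\<close>

definition partitions_into :: "nat set \<Rightarrow> nat \<Rightarrow> nat multiset set" where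
  "partitions_into S n = {P. set_mset P \<subseteq> S \<and> sum_mset P = n}"

definition partition_gf :: "nat set \<Rightarrow> 'a::comm_ring_1 fps" where
  "partition_gf S = Abs_fps (\<lambda>n. of_nat (card (partitions_into S n)))"

lemma member_le_sum_mset: "x \<in># P \<Longrightarrow> x \<le> sum_mset (P :: nat multiset)"
  by (metis le_add1 mset_add sum_mset.add_mset)

lemma finite_partitions_into:
  assumes "0 \<notin> S"
  shows "finite (partitions_into S n)"
proof (rule finite_subset)
  show "finite (mset ` {xs. set xs \<subseteq> {..n} \<and> length xs \<le> n})"
    by (intro finite_imageI finite_lists_length_le) simp
  show "partitions_into S n \<subseteq> mset ` {xs. set xs \<subseteq> {..n} \<and> length xs \<le> n}"
  proof
    fix P assume "P \<in> partitions_into S n"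
    then have P: "set_mset P \<subseteq> S" "sum_mset P = n" by (auto simp: partitions_into_def)
    obtain xs where xs: "P = mset xs" by (metis ex_mset)
    have "size P \<le> sum_mset P" using P(1)
    proof (induction P)
      case (add x P)
      then show ?case using assms by (cases x) auto
    qed simp
    moreover have "set_mset P \<subseteq> {..n}" using member_le_sum_mset P(2) by auto
    ultimately have "set xs \<subseteq> {..n}" "length xs \<le> n" using xs P(2) by auto
    then show "P \<in> mset ` {xs. set xs \<subseteq> {..n} \<and> length xs \<le> n}" using xs by auto
  qed
qed

lemma partitions_into_insert:
  assumes "s > 0"
  shows "partitions_into (insert s S) n =
    partitions_into S n \<union> (if s \<le> n then add_mset s ` partitions_into (insert s S) (n - s) else {})"
proof (intro equalityI subsetI)
  fix P assume P: "P \<in> partitions_into (insert s S) n"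
  show "P \<in> partitions_into S n \<union> (if s \<le> n then add_mset s ` partitions_into (insert s S) (n - s) else {})"
  proof (cases "s \<in># P")
    case True
    then obtain R where "P = add_mset s R" by (metis mset_add)
    then show ?thesis using P by (auto simp: partitions_into_def)
  qed (use P in \<open>auto simp: partitions_into_def\<close>)
qed (auto simp: partitions_into_def split: if_splits)

lemma partition_gf_insert:
  assumes "s \<notin> S" "s > 0" "0 \<notin> S"
  shows "(partition_gf (insert s S) :: 'a::comm_ring_1 fps) * (1 - fps_X ^ s) = partition_gf S"
proof (rule fps_ext)
  fix n
  let ?A = "add_mset s ` partitions_into (insert s S) (n - s)" and ?c = "\<lambda>S n. card (partitions_into S n)"
  have "0 \<notin> insert s S" using assms by simp
  note finite = finite_partitions_into[OF this] finite_partitions_into[OF assms(3)]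
  have "s \<notin># P" if "P \<in> partitions_into S n" for P
    using that assms(1) unfolding partitions_into_def by blast
  then have "partitions_into S n \<inter> ?A = {}" by fastforce
  then have "card (partitions_into S n \<union> ?A) = ?c S n + card ?A"
    by (intro card_Un_disjoint finite_imageI finite)
  moreover have "card ?A = ?c (insert s S) (n - s)"
    by (rule card_image) (auto simp: inj_on_def)
  ultimately have "?c (insert s S) n = ?c S n + (if s \<le> n then ?c (insert s S) (n - s) else 0)"
    unfolding partitions_into_insert[OF assms(2), of S n] by simp
  then show "(partition_gf (insert s S) * (1 - fps_X ^ s)) $ n = (partition_gf S :: 'a fps) $ n"
    by (simp add: partition_gf_def right_diff_distrib fps_X_power_mult_right_nth not_less)
qed

lemma partition_gf_finite:
  assumes "finite S" "0 \<notin> S"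
  shows "(partition_gf S :: 'a::comm_ring_1 fps) * (\<Prod>k\<in>S. 1 - fps_X ^ k) = 1"
  using assms
proof (induction S rule: finite_induct)
  case empty
  have "partitions_into {} n = (if n = 0 then {{#}} else {})" for n
    by (auto simp: partitions_into_def)
  then show ?case by (auto simp: partition_gf_def fps_eq_iff)
next
  case (insert s S)
  then have gf: "(partition_gf (insert s S) :: 'a fps) * (1 - fps_X ^ s) = partition_gf S"
    by (intro partition_gf_insert) auto
  have "(partition_gf (insert s S) :: 'a fps) * (\<Prod>k\<in>insert s S. 1 - fps_X ^ k) =
      partition_gf (insert s S) * (1 - fps_X ^ s) * (\<Prod>k\<in>S. 1 - fps_X ^ k)"
    using insert.hyps by (simp add: mult.assoc)
  then show ?case unfolding gf using insert by simp
qed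

theorem partition_gf_mult_euler_product:
  assumes "0 \<notin> S"
  shows "(partition_gf S :: 'a::comm_ring_1 fps) * euler_product S = 1"
proof (rule fps_eqI_eq_upto)
  fix N
  let ?T = "S \<inter> {1..<N}"
  have "partitions_into S n = partitions_into ?T n" if "n < N" for n
  proof (intro equalityI subsetI)
    fix P assume P: "P \<in> partitions_into S n"
    have "x \<in> ?T" if "x \<in># P" for x
      using that P \<open>n < N\<close> member_le_sum_mset[OF that] assms
      by (cases x) (auto simp: partitions_into_def)
    then show "P \<in> partitions_into ?T n" using P by (auto simp: partitions_into_def)
  qed (auto simp: partitions_into_def)
  then have "eq_upto N (partition_gf S) (partition_gf ?T :: 'a fps)"
    by (simp add: eq_upto_def partition_gf_def)
  then have "eq_upto N (partition_gf S * euler_product S) (partition_gf ?T * (\<Prod>k\<in>?T. 1 - fps_X ^ k) :: 'a fps)"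
    using assms by (intro eq_upto_mult euler_product_eq_upto) auto
  also have "\<dots> = 1"
    by (rule partition_gf_finite) (use assms in auto)
  finally show "eq_upto N (partition_gf S * euler_product S) (1 :: 'a fps)" .
qed

definition regular_gf :: "nat \<Rightarrow> 'a::comm_ring_1 fps" where
  "regular_gf l = Abs_fps (\<lambda>n. of_nat (b l n))"

lemma regular_gf_nth_eq_0_iff: "(regular_gf l :: 'a::comm_ring_1 fps) $ n = 0 \<longleftrightarrow> CHAR('a) dvd b l n"
  by (simp add: regular_gf_def of_nat_eq_0_iff_char_dvd)

lemma euler_1_mult_regular_gf: "(euler 1 :: 'a::comm_ring_1 fps) * regular_gf l = euler l"
proof -
  let ?S = "{n :: nat. \<not> l dvd n}"
  have "b l n = card (partitions_into ?S n)" for n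
    unfolding b_def partitions_into_def
    by (rule arg_cong[of _ _ card]) (auto intro: gr0I)
  then have gf: "regular_gf l = (partition_gf ?S :: 'a fps)"
    by (simp add: regular_gf_def partition_gf_def)
  have "{n :: nat. n mod 1 = 0} = {n. n mod l = 0} \<union> ?S" by auto
  then have "(euler 1 :: 'a fps) = euler_product ({n. n mod l = 0} \<union> ?S)"
    by (simp only: residue_product_def)
  also have "\<dots> = euler l * euler_product ?S"
    unfolding residue_product_def by (rule euler_product_Un_disjoint) auto
  finally have "(euler 1 :: 'a fps) * regular_gf l = euler l * (partition_gf ?S * euler_product ?S)"
    unfolding gf by (simp only: mult_ac)
  then show ?thesis
    using partition_gf_mult_euler_product[of ?S, where 'a = 'a] by simp
qed

section \<open>Congruences modulo 3\<close>

lemma fps_section_power_CHAR_mult: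
  fixes f g :: "'a::prime_field fps"
  assumes "r < CHAR('a)"
  shows "fps_section CHAR('a) r (g ^ CHAR('a) * f) = g * fps_section CHAR('a) r f"
proof -
  let ?p = "CHAR('a)"
  have "g ^ ?p * f = g ^ ?p * (\<Sum>i<?p. fps_X ^ i * fps_section ?p i f ^ ?p)"
    by (rule arg_cong[OF fps_eq_sum_sections])
  also have "\<dots> = (\<Sum>i<?p. fps_X ^ i * (g * fps_section ?p i f) ^ ?p)"
    by (simp add: sum_distrib_left power_mult_distrib mult_ac)
  finally show ?thesis
    using fps_section_sum_power_CHAR[OF assms, of "\<lambda>i. g * fps_section ?p i f"] by simp
qed

lemma fps_trisection:
  fixes f g h :: "'a::prime_field fps"
  assumes "CHAR('a) = 3"
  shows "fps_section 3 1 (f ^ 3 + fps_X * g ^ 3 + fps_X\<^sup>2 * h ^ 3) = g"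
    and "fps_section 3 2 (f ^ 3 + fps_X * g ^ 3 + fps_X\<^sup>2 * h ^ 3) = h"
  using fps_section_sum_power_CHAR[of 1 "\<lambda>i. [f, g, h] ! i"]
    fps_section_sum_power_CHAR[of 2 "\<lambda>i. [f, g, h] ! i"]
  by (simp_all add: assms lessThan_nat_numeral lessThan_Suc numeral_2_eq_2 ac_simps)

lemma section_of_quadratic_root_linear:
  fixes F Y :: "'a::prime_field fps"
  assumes "CHAR('a) = 3" and F: "1 + fps_X * F\<^sup>2 = F * Y ^ 3"
  shows "(Y ^ 6 - fps_X) * fps_section 3 1 F = Y ^ 3 + fps_X * F"
proof -
  have "(3 :: 'a fps) = 0"
    by (rule numeral_eq_0_if_CHAR) (simp add: assms(1))
  note cube_add = cube_add_if_3_eq_0[OF this] and cube_diff = cube_diff_if_3_eq_0[OF this]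
  have "F * (Y ^ 6 - fps_X) = Y ^ 3 + fps_X\<^sup>2 * F ^ 3"
    using F by algebra
  then have sections: "(Y ^ 6 - fps_X) ^ 3 * F =
      (Y ^ 5 + fps_X * (F * Y\<^sup>2)) ^ 3 + fps_X * (Y ^ 3 + fps_X * F) ^ 3 + fps_X\<^sup>2 * (Y + F * Y ^ 4) ^ 3"
    unfolding cube_add cube_diff by algebra
  have "(Y ^ 6 - fps_X) * fps_section 3 1 F = fps_section 3 1 ((Y ^ 6 - fps_X) ^ 3 * F)"
    using fps_section_power_CHAR_mult[of 1 "Y ^ 6 - fps_X" F] unfolding assms(1) by simp
  also have "\<dots> = Y ^ 3 + fps_X * F"
    unfolding sections by (rule fps_trisection(1)[OF assms(1)])
  finally show ?thesis .
qed

lemma section_of_quadratic_root: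
  fixes F Y :: "'a::prime_field fps"
  assumes "CHAR('a) = 3" and F: "1 + fps_X * F\<^sup>2 = F * Y ^ 3"
  shows "(fps_section 3 1 F)\<^sup>2 * (Y ^ 6 - fps_X) = 1"
proof -
  define V where "V = fps_section 3 1 F"
  define u where "u = 1 - fps_X * F\<^sup>2"
  have "(3 :: 'a fps) = 0"
    by (rule numeral_eq_0_if_CHAR) (simp add: assms(1))
  note eq_mod_3 = eq_if_multiple_of_char[OF this, of _ _ "fps_X * F\<^sup>2"]
  have "(Y ^ 6 - fps_X) * F\<^sup>2 = (1 + fps_X * F\<^sup>2)\<^sup>2 - fps_X * F\<^sup>2" unfolding F by algebra
  also have "\<dots> = u\<^sup>2" unfolding u_def by (rule eq_mod_3) algebra
  finally have square: "(Y ^ 6 - fps_X) * F\<^sup>2 = u\<^sup>2" .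
  have "(Y ^ 3 + fps_X * F) * F = (1 + fps_X * F\<^sup>2) + fps_X * F\<^sup>2" unfolding F by algebra
  also have "\<dots> = u" unfolding u_def by (rule eq_mod_3) algebra
  finally have linear: "(Y ^ 3 + fps_X * F) * F = u" .
  have "u * (V * u) = V * u\<^sup>2" by algebra
  also have "\<dots> = (Y ^ 6 - fps_X) * V * F * F" unfolding square[symmetric] by algebra
  also have "\<dots> = u * F"
    unfolding V_def section_of_quadratic_root_linear[OF assms] linear ..
  finally have eq: "u * (V * u) = u * F" .
  have "u $ 0 \<noteq> 0" by (simp add: u_def)
  then have "u \<noteq> 0" by (metis fps_zero_nth)
  with eq have V: "V * u = F" by (rule mult_left_cancelD)
  have "F\<^sup>2 * (V\<^sup>2 * (Y ^ 6 - fps_X)) = (V * u)\<^sup>2"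
    unfolding power_mult_distrib square[symmetric] by algebra
  then have "F\<^sup>2 * (V\<^sup>2 * (Y ^ 6 - fps_X)) = F\<^sup>2 * 1" unfolding V by simp
  moreover have "F\<^sup>2 \<noteq> 0"
  proof
    assume "F\<^sup>2 = 0"
    then show False using F by simp
  qed
  ultimately show ?thesis unfolding V_def by (rule mult_left_cancelD)
qed

lemma sections_if_square_mult_eq_1:
  fixes V Y :: "'a::prime_field fps"
  assumes "CHAR('a) = 3" "V\<^sup>2 * (Y ^ 6 - fps_X) = 1"
  shows "fps_section 3 1 V = - V" "fps_section 3 2 V = 0"
proof -
  have "V = V * (V\<^sup>2 * (Y ^ 6 - fps_X))" using assms(2) by simp
  also have "\<dots> = (V * Y\<^sup>2) ^ 3 + fps_X * (- V) ^ 3" by algebra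
  finally have V: "V = (V * Y\<^sup>2) ^ 3 + fps_X * (- V) ^ 3 + fps_X\<^sup>2 * 0 ^ 3" by simp
  show "fps_section 3 1 V = - V" "fps_section 3 2 V = 0"
    by (subst V, rule fps_trisection[OF assms(1)])+
qed

lemma regular_gf_13_char_3:
  assumes "CHAR('a::prime_field) = 3"
  shows "(regular_gf 13 :: 'a fps) $ (9 * n + 4) = - (regular_gf 13 $ (3 * n + 1))"
    and "(regular_gf 13 :: 'a fps) $ (9 * n + 7) = 0"
proof -
  define F :: "'a fps" where "F = regular_gf 13"
  obtain Y :: "'a fps" where Y: "(euler 1)\<^sup>2 + fps_X * (euler 13)\<^sup>2 = euler 1 * euler 13 * Y ^ 3"
    using modular_equation_mod_3[OF assms] by blast
  have F: "euler 13 = euler 1 * F"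
    unfolding F_def by (rule euler_1_mult_regular_gf[symmetric])
  have "(euler 1)\<^sup>2 * (1 + fps_X * F\<^sup>2) = (euler 1)\<^sup>2 * (F * Y ^ 3)"
    using Y unfolding F by algebra
  then have "1 + fps_X * F\<^sup>2 = F * Y ^ 3"
    by (rule mult_left_cancelD) simp
  then have "(fps_section 3 1 F)\<^sup>2 * (Y ^ 6 - fps_X) = 1"
    by (rule section_of_quadratic_root[OF assms])
  note sections = sections_if_square_mult_eq_1[OF assms this, THEN arg_cong, of "\<lambda>f. f $ n"]
  show "(regular_gf 13 :: 'a fps) $ (9 * n + 4) = - (regular_gf 13 $ (3 * n + 1))"
    using sections(1) by (simp add: F_def algebra_simps)
  show "(regular_gf 13 :: 'a fps) $ (9 * n + 7) = 0"
    using sections(2) by (simp add: F_def algebra_simps)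
qed

lemma b_13_mod_3:
  shows "3 dvd b 13 (9 * n + 7)"
    and "3 dvd b 13 (3 * n + 1) \<Longrightarrow> 3 dvd b 13 (9 * n + 4)"
proof -
  note coeff = regular_gf_13_char_3[OF CHAR_finite_3, of n]
  note nth_eq_0_iff = regular_gf_nth_eq_0_iff[where 'a = Enum.finite_3, unfolded CHAR_finite_3]
  show "3 dvd b 13 (9 * n + 7)"
    using coeff(2) unfolding nth_eq_0_iff .
  have "(regular_gf 13 :: Enum.finite_3 fps) $ (9 * n + 4) = 0 \<longleftrightarrow>
      (regular_gf 13 :: Enum.finite_3 fps) $ (3 * n + 1) = 0"
    unfolding coeff(1) by (rule neg_equal_0_iff_equal)
  then show "3 dvd b 13 (3 * n + 1) \<Longrightarrow> 3 dvd b 13 (9 * n + 4)"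
    unfolding nth_eq_0_iff by blast
qed

lemma b_13_mod_3_progression:
  assumes "2 * m + 1 = 3 ^ Suc j * u" "u mod 6 = 5"
  shows "3 dvd b 13 m"
  using assms(1)
proof (induction j arbitrary: m)
  case 0
  have "u = 6 * (u div 6) + 5" using assms(2) by presburger
  then have "m = 9 * (u div 6) + 7" using 0 by simp
  then show ?case using b_13_mod_3(1) by simp
next
  case (Suc j)
  have "odd u" using assms(2) by presburger
  then have "odd (3 ^ j * u)" by simp
  then obtain i where i: "3 ^ j * u = 2 * i + 1" by (elim oddE)
  then have "m = 9 * i + 4" using Suc.prems by simp
  moreover have "2 * (3 * i + 1) + 1 = 3 ^ Suc j * u" using i by simp
  ultimately show ?case using b_13_mod_3(2) Suc.IH by blast
qed

section \<open>Congruences modulo 2\<close>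

lemma euler_cubed_char_2:
  assumes "CHAR('a::prime_field) = 2"
  shows "(euler 1 :: 'a fps) ^ 3 = ramanujan_theta 1 3"
proof -
  let ?r = "residue_product 4 :: nat \<Rightarrow> 'a fps"
  have square: "(euler M)\<^sup>2 = (euler (2 * M) :: 'a fps)" for M
    using euler_power_CHAR[of M, where 'a = 'a] by (simp add: assms)
  have "(euler 1 :: 'a fps) = (\<Prod>i<4. ?r i)" "(euler 2 :: 'a fps) = (\<Prod>i<2. ?r (2 * i))"
    using residue_product_split[of 0 1 4, where 'a = 'a] residue_product_split[of 0 2 2, where 'a = 'a]
    by simp_all
  then have "(euler 1 :: 'a fps) = euler 2 * ?r 1 * ?r 3"
    by (simp add: lessThan_nat_numeral lessThan_Suc mult_ac)
  then have "euler 1 * euler 1 ^ 3 = euler 1 * ((euler 2)\<^sup>2 * ?r 1 * ?r 3)"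
    using square[of 1] unfolding mult_1_right by algebra
  also have "(euler 2)\<^sup>2 * ?r 1 * ?r 3 = triple_product 4 1"
    by (simp add: square triple_product_def)
  finally have "euler 1 ^ 3 = (triple_product 4 1 :: 'a fps)"
    by (rule mult_left_cancelD) simp
  then show ?thesis
    using jacobi_triple_product[of 1 3, where 'a = 'a] by simp
qed

lemma euler_cubed_nth_nonzero:
  assumes "CHAR('a::prime_field) = 2" "d > 0" "((euler d :: 'a fps) ^ 3) $ n \<noteq> 0"
  obtains y where "8 * int n + int d = int d * y\<^sup>2"
proof -
  have "(euler d :: 'a fps) ^ 3 = (euler 1 oo fps_X ^ d) ^ 3"
    using euler_times[OF assms(2), of 1, where 'a = 'a] by simp
  also have "\<dots> = ramanujan_theta 1 3 oo fps_X ^ d"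
    unfolding euler_cubed_char_2[OF assms(1), symmetric] by (rule fps_compose_power) (use assms(2) in simp)
  finally have "(euler d :: 'a fps) ^ 3 = ramanujan_theta 1 3 oo fps_X ^ d" .
  then have n: "d dvd n" and "(ramanujan_theta 1 3 :: 'a fps) $ (n div d) \<noteq> 0"
    using assms(3) by (auto simp: fps_nth_compose_X_power split: if_splits)
  then obtain k where "triangle k + 3 * triangle (- k) = n div d"
    unfolding ramanujan_theta_def monomial_sum_nth by (force intro: sum.neutral)
  then have "8 * int (n div d) + 1 = (4 * k - 1)\<^sup>2"
    using double_triangle[of k] double_triangle[of "- k"] by (simp add: power2_eq_square algebra_simps)
  moreover have "int n = int d * int (n div d)" using n by (metis dvd_mult_div_cancel of_nat_mult)
  then have "8 * int n + int d = int d * (8 * int (n div d) + 1)" by (simp add: algebra_simps)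
  ultimately have "8 * int n + int d = int d * (4 * k - 1)\<^sup>2" by simp
  then show ?thesis by (rule that)
qed

lemma regular_gf_13_char_2:
  assumes "CHAR('a::prime_field) = 2"
  shows "fps_section 2 0 (regular_gf 13 :: 'a fps) = (euler 1 ^ 3)\<^sup>2 + fps_X ^ 3 * (euler 13 ^ 3)\<^sup>2"
proof -
  define F Z :: "'a fps" where "F = regular_gf 13" and "Z = (euler 1 ^ 3)\<^sup>2 + fps_X ^ 3 * (euler 13 ^ 3)\<^sup>2"
  have two: "(2 :: 'a fps) = 0"
    by (rule numeral_eq_0_if_CHAR) (simp add: assms)
  have F: "euler 13 = euler 1 * F"
    unfolding F_def by (rule euler_1_mult_regular_gf[symmetric])
  have Z: "((euler 1)\<^sup>2 + fps_X * (euler 13)\<^sup>2) *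
      (euler 1 ^ 4 + fps_X * (euler 1)\<^sup>2 * (euler 13)\<^sup>2 + fps_X\<^sup>2 * euler 13 ^ 4) = Z"
    unfolding Z_def
    by (rule eq_if_multiple_of_char[OF two, of _ _
          "(euler 1)\<^sup>2 * (fps_X * (euler 13)\<^sup>2) * ((euler 1)\<^sup>2 + fps_X * (euler 13)\<^sup>2)"]) algebra
  have "(euler 1)\<^sup>2 * F = euler 1 * euler 13" unfolding F by algebra
  also have "\<dots> = ((euler 1)\<^sup>2 + fps_X * (euler 13)\<^sup>2) * Z\<^sup>2"
    unfolding modular_equation_mod_2[OF assms] Z[symmetric]
    by (simp add: power_mult_distrib power3_eq_cube power2_eq_square mult_ac)
  also have "\<dots> = (euler 1)\<^sup>2 * (Z\<^sup>2 + fps_X * (F * Z)\<^sup>2)"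
    unfolding F by algebra
  finally have "F = Z\<^sup>2 + fps_X * (F * Z)\<^sup>2"
    by (rule mult_left_cancelD) simp
  then have "fps_section 2 0 F = fps_section 2 0 (Z\<^sup>2 + fps_X * (F * Z)\<^sup>2)" by (rule arg_cong)
  also have "\<dots> = Z"
    using fps_section_sum_power_CHAR[of 0 "\<lambda>i. [Z, F * Z] ! i"]
    by (simp add: assms lessThan_nat_numeral lessThan_Suc add.commute)
  finally show ?thesis unfolding F_def Z_def .
qed

lemma regular_gf_13_even_nth_nonzero:
  assumes "CHAR('a::prime_field) = 2" "(regular_gf 13 :: 'a fps) $ (2 * m) \<noteq> 0"
  obtains y :: int where "4 * int m + 1 = y\<^sup>2 \<or> 4 * int m + 1 = 13 * y\<^sup>2"
proof -
  have square: "\<exists>i. n = 2 * i \<and> f $ i \<noteq> 0" if "(f\<^sup>2) $ n \<noteq> 0" for f :: "'a fps" and n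
    using that fps_power_CHAR_nth[of f n] by (intro exI[of _ "n div 2"]) (simp add: assms(1) split: if_splits)
  let ?Z\<^sub>1 = "(euler 1 ^ 3)\<^sup>2 :: 'a fps" and ?Z\<^sub>2 = "(euler 13 ^ 3)\<^sup>2 :: 'a fps"
  have "?Z\<^sub>1 $ m + (if m < 3 then 0 else ?Z\<^sub>2 $ (m - 3)) = (regular_gf 13 :: 'a fps) $ (2 * m)"
    using arg_cong[OF regular_gf_13_char_2[OF assms(1)], of "\<lambda>f. f $ m"]
    by (simp add: fps_X_power_mult_nth)
  with assms(2) consider "?Z\<^sub>1 $ m \<noteq> 0" | "m \<ge> 3" "?Z\<^sub>2 $ (m - 3) \<noteq> 0"
    by (cases "m < 3") fastforce+
  then show ?thesis
  proof cases
    case 1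
    then obtain i where i: "m = 2 * i" "(euler 1 ^ 3) $ i \<noteq> (0 :: 'a)"
      using square by blast
    then obtain y where "8 * int i + int 1 = int 1 * y\<^sup>2"
      using euler_cubed_nth_nonzero[OF assms(1) zero_less_one i(2)] by blast
    then have "4 * int m + 1 = y\<^sup>2" using i(1) by simp
    then show ?thesis using that by blast
  next
    case 2
    then obtain i where i: "m - 3 = 2 * i" "(euler 13 ^ 3) $ i \<noteq> (0 :: 'a)"
      using square by blast
    then obtain y where "8 * int i + int 13 = int 13 * y\<^sup>2"
      using euler_cubed_nth_nonzero[OF assms(1) _ i(2)] by auto
    moreover have "m = 2 * i + 3" using 2(1) i(1) by simp
    ultimately have "4 * int m + 1 = 13 * y\<^sup>2" by simp
    then show ?thesis using that by blast
  qed
qed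

lemma odd_b_13:
  assumes "odd (b 13 (2 * m))"
  obtains y :: int where "4 * int m + 1 = y\<^sup>2 \<or> 4 * int m + 1 = 13 * y\<^sup>2"
proof (rule regular_gf_13_even_nth_nonzero[OF CHAR_finite_2])
  show "(regular_gf 13 :: Enum.finite_2 fps) $ (2 * m) \<noteq> 0"
    unfolding regular_gf_nth_eq_0_iff CHAR_finite_2 by (rule assms)
qed (rule that)

lemma power_3_mult_neq_mult_square:
  fixes c u y :: int
  assumes "c mod 3 = 1" "u mod 3 = 2"
  shows "3 ^ k * u \<noteq> c * y\<^sup>2"
proof (induction k arbitrary: y rule: induct_nat_012)
  case 0
  have "y mod 3 = 0 \<or> y mod 3 = 1 \<or> y mod 3 = 2" by presburger
  then have "y\<^sup>2 mod 3 \<noteq> 2" unfolding power_mod[of y 3 2, symmetric] by auto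
  then have "(c * y\<^sup>2) mod 3 \<noteq> 2"
    unfolding mod_mult_left_eq[of c 3, symmetric] assms(1) by simp
  then show ?case using assms(2) by auto
next
  have dvd: "3 dvd y" if "3 * v = c * y\<^sup>2" for v y
  proof -
    have "prime (3 :: int)" by simp
    moreover have "3 dvd c * y\<^sup>2" unfolding that[symmetric] by simp
    moreover have "\<not> 3 dvd c" using assms(1) by presburger
    ultimately show ?thesis by (metis prime_dvd_mult_iff prime_dvd_power)
  qed
  case 1
  show ?case
  proof
    assume eq: "3 ^ Suc 0 * u = c * y\<^sup>2"
    then obtain x where "y = 3 * x" using dvd[of u y] by auto
    then have "u = 3 * (c * x\<^sup>2)" using eq by (simp add: power_mult_distrib)
    then show False using assms(2) by simp
  qed
  case (ge2 k)
  show ?case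
  proof
    assume eq: "3 ^ Suc (Suc k) * u = c * y\<^sup>2"
    then obtain x where "y = 3 * x" using dvd[of "3 ^ Suc k * u" y] by auto
    then have "3 ^ k * u = c * x\<^sup>2" using eq by (simp add: power_mult_distrib)
    then show False using ge2.IH(1) by blast
  qed
qed

theorem b_13_mod_6:
  assumes "2 * m + 1 = 3 ^ k * u" "k \<ge> 1" "u mod 6 = 5" "even m"
  shows "b 13 m mod 6 = 0"
proof -
  obtain j where "k = Suc j" using assms(2) by (cases k) auto
  then have "3 dvd b 13 m"
    using b_13_mod_3_progression assms(1,3) by blast
  moreover have "even (b 13 m)"
  proof (rule ccontr)
    assume odd: "odd (b 13 m)"
    obtain i where i: "m = 2 * i" using assms(4) by (elim evenE)
    obtain y :: int where "4 * int i + 1 = 1 * y\<^sup>2 \<or> 4 * int i + 1 = 13 * y\<^sup>2"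
      using odd_b_13 odd unfolding i by auto
    moreover have "4 * int i + 1 = 3 ^ k * int u"
      using arg_cong[OF assms(1), of int] by (simp add: i)
    moreover have "int u mod 3 = 2" using assms(3) by presburger
    ultimately show False
      using power_3_mult_neq_mult_square[of 1 "int u" k y] power_3_mult_neq_mult_square[of 13 "int u" k y]
      by auto
  qed
  ultimately show ?thesis by presburger
qed

theorem theorem3p15:
  fixes \<alpha> n :: nat
  assumes "\<alpha> \<ge> 1"
  shows "b 13 (4 * 3 ^ (2 * \<alpha> + 1) * n + (17 * 3 ^ (2 * \<alpha>) - 1) div 2) mod 6 = 0 \<and>
         b 13 (4 * 3 ^ (2 * \<alpha>) * n + (11 * 3 ^ (2 * \<alpha> - 1) - 1) div 2) mod 6 = 0"
proof
  obtain j where \<alpha>: "\<alpha> = Suc j" using assms by (cases \<alpha>) auto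
  have "(9 :: nat) ^ j mod 4 = 1"
    by (subst power_mod[symmetric]) simp
  then obtain r where r: "9 ^ j = 4 * r + (1 :: nat)"
    by (metis mult_div_mod_eq)
  have power: "3 ^ (2 * \<alpha> + 1) = 27 * (9 ^ j :: nat)" "3 ^ (2 * \<alpha>) = 9 * (9 ^ j :: nat)"
    "3 ^ (2 * \<alpha> - 1) = 3 * (9 ^ j :: nat)"
    by (simp_all add: \<alpha> power_mult)
  show "b 13 (4 * 3 ^ (2 * \<alpha> + 1) * n + (17 * 3 ^ (2 * \<alpha>) - 1) div 2) mod 6 = 0"
  proof (rule b_13_mod_6)
    show "2 * (4 * 3 ^ (2 * \<alpha> + 1) * n + (17 * 3 ^ (2 * \<alpha>) - 1) div 2) + 1 = 3 ^ (2 * \<alpha>) * (24 * n + 17)"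
      "even (4 * 3 ^ (2 * \<alpha> + 1) * n + (17 * 3 ^ (2 * \<alpha>) - 1) div 2)"
      unfolding power r by (simp_all add: algebra_simps)
  qed (use assms in presburger)+
  show "b 13 (4 * 3 ^ (2 * \<alpha>) * n + (11 * 3 ^ (2 * \<alpha> - 1) - 1) div 2) mod 6 = 0"
  proof (rule b_13_mod_6)
    show "2 * (4 * 3 ^ (2 * \<alpha>) * n + (11 * 3 ^ (2 * \<alpha> - 1) - 1) div 2) + 1 = 3 ^ (2 * \<alpha> - 1) * (24 * n + 11)"
      "even (4 * 3 ^ (2 * \<alpha>) * n + (11 * 3 ^ (2 * \<alpha> - 1) - 1) div 2)"
      unfolding power r by (simp_all add: algebra_simps)
  qed (use assms in presburger)+
qed

end
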